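(* Let $V\in \mathrm{BUC}(\mathbb R;L^\infty(\mathbb R^d))$. On $\mathrm{BUC}(\mathbb R;L^2(\mathbb R^d))$ consider the semigroups $$[\mathcal T(t)f](s):=e^{t\Delta}f(s-t),\qquad[\mathcal S(t)f](s):=e^{tV(s)}f(s)\qquad(t\ge0,\ s\in\mathbb R),$$ with generators $\mathcal A=-\frac{d}{ds}+\Delta$ (with appropriate domain) and $\mathcal B=$ pointwise multiplication by $V(\cdot)$, respectively, and let $\mathcal W$ denote the semigroup generated by $\mathcal A+\mathcal B$ on $\mathrm{BUC}(\mathbb R;L^2(\mathbb R^d))$. Then for every $f\in\mathrm{BUC}(\mathbb R;L^2(\mathbb R^d))$ $$\lim_{n\to\infty}\bigl(\mathcal S(\tfrac tn)\mathcal T(\tfrac tn)\bigr)^nf=\mathcal W(t)f,$$ where the convergence is uniform for $t$ in compact intervals. Moreover, assume that the non-autonomous Cauchy problem for $\frac{d}{dt}u(t)=\Delta u(t)+V(t)u(t)$ on $L^2(\mathbb R^d)$ is well-posed, and let $(W(t,s))_{t\ge s}$ denote the evolution family solving it. Then for every $u_0\in L^2(\mathbb R^d)$ $$\lim_{n\to\infty}\Bigl\|W(t,s)u_0-\prod_{p=0}^{n-1}e^{\frac{t-s}{n}V(s+\frac{p(t-s)}{n})}e^{\frac{t-s}{n}\Delta}u_0\Bigr\|_{L^2(\mathbb R^d)}=0,$$ locally uniformly for $s\le t$.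
   Context: $\mathrm{BUC}(\mathbb R;Y)$ is the space of bounded uniformly continuous functions $\mathbb R\to Y$ with the sup norm. $(e^{t\Delta})_{t\ge0}$ is the heat semigroup on $X:=L^2(\mathbb R^d)$, generated by $\Delta$ with domain $H^2(\mathbb R^d)$; $V(s)\in L^\infty(\mathbb R^d)$ acts on $L^2(\mathbb R^d)$ as a multiplication operator, and $e^{tV(s)}$ is multiplication by the exponential. The domain of $\mathcal A$ is $\{f\in \mathrm{BUC}(\mathbb R;X)\cap \mathrm{BUC}^1(\mathbb R;X_{-1}) : -f'+\Delta_{-1}f\in\mathrm{BUC}(\mathbb R;X)\}$, where $\Delta_{-1}$, with domain $X$, is the generator of the extrapolated heat semigroup on the extrapolation space $X_{-1}$. The product is time-ordered: $\prod_{p=0}^{n-1}U_p:=U_{n-1}\cdots U_1U_0$. An (exponentially bounded) evolution family on $X$ is a family $(W(t,s))_{t\ge s}$ of bounded linear operators on $X$ with $W(t,r)W(r,s)=W(t,s)$ and $W(t,t)=I$ for all $t\ge r\ge s$ in $\mathbb R$, such that $(t,s)\mapsto W(t,s)$ is strongly continuous and $\|W(t,s)\|\le Me^{\omega(t-s)}$ for some $M\ge1$, $\omega\in\mathbb R$ and all $t\ge s$. It is said to solve $\frac{d}{dt}u(t)=\Delta u(t)+V(t)u(t)$ if for every $s\in\mathbb R$ the set of those $y\in X$ for which $u(t):=W(t,s)y$, $t\ge s$, is a classical solution with $u(s)=y$ is dense in $X$; here a classical solution is a function $u\in C^1([s,\infty);X)$ with $u(t)$ in the domain $H^2(\mathbb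 R^d)$ of $\Delta+V(t)$ and $\frac{d}{dt}u(t)=\Delta u(t)+V(t)u(t)$ for all $t\ge s$. The problem is well-posed (with exponentially bounded solutions) precisely when there exists a unique evolution family solving it.
   Formalization: T is not strongly continuous on BUC(R;L^2) in the sup norm, so A+B generates no strongly continuous semigroup; "the semigroup W generated by A+B" is read in the bi-continuous sense (locally uniform convergence, norm-bounded quotients). The limits are still in the sup norm. *)

theory Defs
  imports "HOL-Analysis.Analysis" "HOL-Probability.Essential_Supremum"
begin

section \<open>The spaces $L^2(\mathbb{R}^d)$ and $L^\infty(\mathbb{R}^d)$\<close>

text \<open>
  Functions are complex valued, and \<open>'a::euclidean_space\<close> stands for the Euclidean
  space of dimension \<open>d = DIM('a)\<close>.
\<close>

definition l2_rel :: "('a::euclidean_space \<Rightarrow> complex) \<Rightarrow> ('a \<Rightarrow> complex) \<Rightarrow> bool" where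
  "l2_rel f g \<longleftrightarrow>
     f \<in> borel_measurable lborel \<and> integrable lborel (\<lambda>x. (cmod (f x))\<^sup>2) \<and>
     g \<in> borel_measurable lborel \<and> integrable lborel (\<lambda>x. (cmod (g x))\<^sup>2) \<and>
     (AE x in lborel. f x = g x)"

definition linf_rel :: "('a::euclidean_space \<Rightarrow> complex) \<Rightarrow> ('a \<Rightarrow> complex) \<Rightarrow> bool" where
  "linf_rel f g \<longleftrightarrow>
     f \<in> borel_measurable lborel \<and> (\<exists>C. AE x in lborel. cmod (f x) \<le> C) \<and>
     g \<in> borel_measurable lborel \<and> (\<exists>C. AE x in lborel. cmod (g x) \<le> C) \<and>
     (AE x in lborel. f x = g x)"

lemma part_equivp_l2_rel: "part_equivp l2_rel"
proof (rule part_equivpI)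
  show "\<exists>f. l2_rel f (f :: 'a::euclidean_space \<Rightarrow> complex)"
    by (rule exI[of _ "\<lambda>_. 0"]) (simp add: l2_rel_def)
  show "symp (l2_rel :: ('a \<Rightarrow> complex) \<Rightarrow> _)"
    by (rule sympI) (auto simp: l2_rel_def elim: AE_mp)
  show "transp (l2_rel :: ('a \<Rightarrow> complex) \<Rightarrow> _)"
    by (rule transpI) (auto simp: l2_rel_def)
qed

lemma part_equivp_linf_rel: "part_equivp linf_rel"
proof (rule part_equivpI)
  show "\<exists>f. linf_rel f (f :: 'a::euclidean_space \<Rightarrow> complex)"
    by (rule exI[of _ "\<lambda>_. 0"]) (auto simp: linf_rel_def)
  show "symp (linf_rel :: ('a \<Rightarrow> complex) \<Rightarrow> _)"
    by (rule sympI) (auto simp: linf_rel_def elim: AE_mp)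
  show "transp (linf_rel :: ('a \<Rightarrow> complex) \<Rightarrow> _)"
    by (rule transpI) (auto simp: linf_rel_def)
qed

quotient_type (overloaded) 'a l2 = "'a::euclidean_space \<Rightarrow> complex" / partial: l2_rel
  by (rule part_equivp_l2_rel)

quotient_type (overloaded) 'a linf = "'a::euclidean_space \<Rightarrow> complex" / partial: linf_rel
  by (rule part_equivp_linf_rel)

lemma square_integrable_add:
  fixes f g :: "'a::euclidean_space \<Rightarrow> complex"
  assumes "f \<in> borel_measurable lborel" "integrable lborel (\<lambda>x. (cmod (f x))\<^sup>2)"
    and "g \<in> borel_measurable lborel" "integrable lborel (\<lambda>x. (cmod (g x))\<^sup>2)"
  shows "integrable lborel (\<lambda>x. (cmod (f x + g x))\<^sup>2)"
proof (rule Bochner_Integration.integrable_bound)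
  show "integrable lborel (\<lambda>x. 2 * (cmod (f x))\<^sup>2 + 2 * (cmod (g x))\<^sup>2)"
    using assms by simp
  show "(\<lambda>x. (cmod (f x + g x))\<^sup>2) \<in> borel_measurable lborel"
    using assms by measurable
  show "AE x in lborel. norm ((cmod (f x + g x))\<^sup>2) \<le> norm (2 * (cmod (f x))\<^sup>2 + 2 * (cmod (g x))\<^sup>2)"
  proof (rule AE_I2)
    fix x
    have "(cmod (f x + g x))\<^sup>2 \<le> (cmod (f x) + cmod (g x))\<^sup>2"
      by (intro power_mono norm_triangle_ineq) simp
    also have "\<dots> \<le> 2 * (cmod (f x))\<^sup>2 + 2 * (cmod (g x))\<^sup>2"
      using sum_squares_bound[of "cmod (f x)" "cmod (g x)"] by (simp add: power2_sum)
    finally show "norm ((cmod (f x + g x))\<^sup>2) \<le> norm (2 * (cmod (f x))\<^sup>2 + 2 * (cmod (g x))\<^sup>2)"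
      by simp
  qed
qed

lemma square_integrable_scale:
  fixes f :: "'a::euclidean_space \<Rightarrow> complex"
  assumes "integrable lborel (\<lambda>x. (cmod (f x))\<^sup>2)"
  shows "integrable lborel (\<lambda>x. (cmod (c * f x))\<^sup>2)"
  using assms by (simp add: norm_mult power_mult_distrib)

lemma L2_triangle:
  fixes f g :: "'a::euclidean_space \<Rightarrow> complex"
  assumes f: "f \<in> borel_measurable lborel" "integrable lborel (\<lambda>x. (cmod (f x))\<^sup>2)"
    and g: "g \<in> borel_measurable lborel" "integrable lborel (\<lambda>x. (cmod (g x))\<^sup>2)"
  shows "sqrt (LINT x|lborel. (cmod (f x + g x))\<^sup>2)
    \<le> sqrt (LINT x|lborel. (cmod (f x))\<^sup>2) + sqrt (LINT x|lborel. (cmod (g x))\<^sup>2)"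
proof -
  define A where "A = (LINT x|lborel. (cmod (f x))\<^sup>2)"
  define B where "B = (LINT x|lborel. (cmod (g x))\<^sup>2)"
  have A: "A \<ge> 0" and B: "B \<ge> 0" by (simp_all add: A_def B_def)
  have *: "sqrt (LINT x|lborel. (cmod (f x + g x))\<^sup>2) \<le> (sqrt A + e) + (sqrt B + e)" if e: "e > 0" for e
  proof -
    define a where "a = sqrt A + e"
    define b where "b = sqrt B + e"
    have ab: "a > 0" "b > 0" using A B e by (auto simp: a_def b_def intro: add_nonneg_pos)
    have Aa: "A \<le> a\<^sup>2" and Bb: "B \<le> b\<^sup>2"
      using A B e by (auto simp: a_def b_def intro!: sqrt_le_D)
    have pt: "(cmod (f x + g x))\<^sup>2 \<le> (1 + b/a) * (cmod (f x))\<^sup>2 + (1 + a/b) * (cmod (g x))\<^sup>2" for x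
    proof -
      let ?p = "cmod (f x)" and ?q = "cmod (g x)"
      have "(cmod (f x + g x))\<^sup>2 \<le> (?p + ?q)\<^sup>2"
        by (intro power_mono norm_triangle_ineq) simp
      also have "(?p + ?q)\<^sup>2 \<le> (1 + b/a) * ?p\<^sup>2 + (1 + a/b) * ?q\<^sup>2"
      proof -
        have "0 \<le> (b * ?p - a * ?q)\<^sup>2 / (a * b)" using ab by simp
        also have "\<dots> = b/a * ?p\<^sup>2 + a/b * ?q\<^sup>2 - 2 * ?p * ?q"
          using ab by (simp add: field_simps power2_eq_square)
        finally show ?thesis by (simp add: power2_sum algebra_simps)
      qed
      finally show ?thesis .
    qed
    have "(LINT x|lborel. (cmod (f x + g x))\<^sup>2)
        \<le> (LINT x|lborel. (1 + b/a) * (cmod (f x))\<^sup>2 + (1 + a/b) * (cmod (g x))\<^sup>2)"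
      by (rule integral_mono[OF square_integrable_add[OF f g] _ pt]) (use f g in simp)
    also have "\<dots> = (1 + b/a) * A + (1 + a/b) * B"
      using f g by (simp add: A_def B_def)
    also have "\<dots> \<le> (1 + b/a) * a\<^sup>2 + (1 + a/b) * b\<^sup>2"
      using Aa Bb ab by (intro add_mono mult_left_mono) auto
    also have "\<dots> = (a + b)\<^sup>2" using ab by (simp add: field_simps power2_eq_square)
    finally have "sqrt (LINT x|lborel. (cmod (f x + g x))\<^sup>2) \<le> sqrt ((a + b)\<^sup>2)"
      by (rule real_sqrt_le_mono)
    then show ?thesis using ab by (simp add: a_def b_def)
  qed
  have "sqrt (LINT x|lborel. (cmod (f x + g x))\<^sup>2) \<le> sqrt A + sqrt B"
  proof (rule field_le_epsilon)
    fix e :: real assume "e > 0"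
    then show "sqrt (LINT x|lborel. (cmod (f x + g x))\<^sup>2) \<le> sqrt A + sqrt B + e"
      using *[of "e/2"] by simp
  qed
  then show ?thesis by (simp add: A_def B_def)
qed

instantiation l2 :: (euclidean_space) real_normed_vector
begin

lift_definition zero_l2 :: "'a l2" is "\<lambda>_. 0"
  by (simp add: l2_rel_def)

lift_definition plus_l2 :: "'a l2 \<Rightarrow> 'a l2 \<Rightarrow> 'a l2" is "\<lambda>f g x. f x + g x"
  unfolding l2_rel_def by (auto intro: square_integrable_add)

lift_definition uminus_l2 :: "'a l2 \<Rightarrow> 'a l2" is "\<lambda>f x. - f x"
  unfolding l2_rel_def by auto

lift_definition minus_l2 :: "'a l2 \<Rightarrow> 'a l2 \<Rightarrow> 'a l2" is "\<lambda>f g x. f x - g x"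
  unfolding l2_rel_def
  using square_integrable_add[where g = "\<lambda>x. - g x" for g] by auto

lift_definition scaleR_l2 :: "real \<Rightarrow> 'a l2 \<Rightarrow> 'a l2" is "\<lambda>r f x. r *\<^sub>R f x"
  unfolding l2_rel_def by (auto simp: power_mult_distrib)

lift_definition norm_l2 :: "'a l2 \<Rightarrow> real" is "\<lambda>f. sqrt (LINT x|lborel. (cmod (f x))\<^sup>2)"
  unfolding l2_rel_def by (auto intro!: integral_cong_AE)

definition sgn_l2 :: "'a l2 \<Rightarrow> 'a l2" where "sgn_l2 u = scaleR (inverse (norm u)) u"
definition dist_l2 :: "'a l2 \<Rightarrow> 'a l2 \<Rightarrow> real" where "dist_l2 u v = norm (u - v)"
definition uniformity_l2 :: "('a l2 \<times> 'a l2) filter" where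
  "uniformity_l2 = (INF e\<in>{0<..}. principal {(u, v). dist u v < e})"
definition open_l2 :: "'a l2 set \<Rightarrow> bool" where
  "open_l2 S = (\<forall>u\<in>S. \<forall>\<^sub>F (u', v) in uniformity. u' = u \<longrightarrow> v \<in> S)"

instance
proof
  fix u v w :: "'a l2" and a b :: real
  show "u + v + w = u + (v + w)" "u + v = v + u" "0 + u = u" "- u + u = 0" "u - v = u + - v"
    by (transfer; auto simp: l2_rel_def add_ac intro!: square_integrable_add
        square_integrable_add[where g = "\<lambda>x. - g x" for g, simplified])+
  show "a *\<^sub>R (u + v) = a *\<^sub>R u + a *\<^sub>R v" "(a + b) *\<^sub>R u = a *\<^sub>R u + b *\<^sub>R u"
    "a *\<^sub>R b *\<^sub>R u = (a * b) *\<^sub>R u" "1 *\<^sub>R u = u"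
    by (transfer; auto simp: l2_rel_def algebra_simps power_mult_distrib norm_mult
        simp flip: scaleR_scaleR intro!: square_integrable_add)+
  show "dist u v = norm (u - v)" by (rule dist_l2_def)
  show "sgn u = scaleR (inverse (norm u)) u" by (rule sgn_l2_def)
  show "uniformity = (INF e\<in>{0<..}. principal {(u :: 'a l2, v). dist u v < e})"
    by (rule uniformity_l2_def)
  show "open S = (\<forall>u\<in>S. \<forall>\<^sub>F (u', v) in uniformity. u' = u \<longrightarrow> v \<in> S)" for S :: "'a l2 set"
    by (rule open_l2_def)
  show "norm u = 0 \<longleftrightarrow> u = 0"
  proof (transfer, unfold l2_rel_def, elim conjE)
    fix f :: "'a \<Rightarrow> complex"
    assume f: "integrable lborel (\<lambda>x. (cmod (f x))\<^sup>2)" "f \<in> borel_measurable lborel"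
    have "(LINT x|lborel. (cmod (f x))\<^sup>2) = 0 \<longleftrightarrow> (AE x in lborel. (cmod (f x))\<^sup>2 = 0)"
      by (rule integral_nonneg_eq_0_iff_AE[OF f(1)]) simp
    then show "sqrt (LINT x|lborel. (cmod (f x))\<^sup>2) = 0 \<longleftrightarrow>
        f \<in> borel_measurable lborel \<and> integrable lborel (\<lambda>x. (cmod (f x))\<^sup>2) \<and>
        (\<lambda>_. 0 :: complex) \<in> borel_measurable lborel \<and>
        integrable lborel (\<lambda>x :: 'a. (cmod 0)\<^sup>2) \<and> (AE x in lborel. f x = 0)"
      using f by simp
  qed
  show "norm (u + v) \<le> norm u + norm v"
    by transfer (auto simp: l2_rel_def intro: L2_triangle)
  show "norm (a *\<^sub>R u) = \<bar>a\<bar> * norm u"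
    by transfer (simp add: power_mult_distrib real_sqrt_mult)
qed

end

text \<open>Multiplication of an \<open>L\<^sup>2\<close> function by a complex scalar.\<close>

lift_definition scaleC_l2 :: "complex \<Rightarrow> 'a::euclidean_space l2 \<Rightarrow> 'a l2" is "\<lambda>c f x. c * f x"
  unfolding l2_rel_def by (auto intro: square_integrable_scale)

lemma esssup_cmod_real:
  fixes f :: "'a::euclidean_space \<Rightarrow> complex"
  assumes f: "f \<in> borel_measurable lborel" and b: "\<exists>C. AE x in lborel. cmod (f x) \<le> C"
  obtains r where "r \<ge> 0" "esssup lborel (\<lambda>x. ereal (cmod (f x))) = ereal r"
proof -
  have m: "(\<lambda>x. ereal (cmod (f x))) \<in> borel_measurable lborel" using f by measurable
  obtain C where C: "AE x in lborel. cmod (f x) \<le> C" using b by blast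
  have up: "esssup lborel (\<lambda>x. ereal (cmod (f x))) \<le> ereal C"
    by (rule esssup_I[OF m]) (use C in auto)
  have "esssup lborel (\<lambda>x::'a. 0 :: ereal) \<le> esssup lborel (\<lambda>x. ereal (cmod (f x)))"
    by (rule esssup_mono) auto
  moreover have "esssup lborel (\<lambda>x::'a. 0 :: ereal) = 0"
    by (rule esssup_const) (simp add: emeasure_lborel_UNIV)
  ultimately have lo: "0 \<le> esssup lborel (\<lambda>x. ereal (cmod (f x)))" by simp
  show thesis
    by (rule that[of "real_of_ereal (esssup lborel (\<lambda>x. ereal (cmod (f x))))"])
      (use up lo in \<open>auto simp: real_of_ereal_pos ereal_real\<close>)
qed

instantiation linf :: (euclidean_space) real_normed_vector
begin

lift_definition zero_linf :: "'a linf" is "\<lambda>_. 0"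
  by (auto simp: linf_rel_def)

lemma linf_bdd_add:
  fixes f g :: "'b::euclidean_space \<Rightarrow> complex"
  assumes "\<exists>C. AE x in lborel. cmod (f x) \<le> C" "\<exists>C. AE x in lborel. cmod (g x) \<le> C"
  shows "\<exists>C. AE x in lborel. cmod (f x + g x) \<le> C" 
proof -
  obtain C D where "AE x in lborel. cmod (f x) \<le> C" "AE x in lborel. cmod (g x) \<le> D"
    using assms by blast
  then have "AE x in lborel. cmod (f x + g x) \<le> C + D"
    by eventually_elim (rule norm_triangle_le, simp)
  then show ?thesis ..
qed

lemma linf_bdd_scale:
  fixes f :: "'b::euclidean_space \<Rightarrow> complex"
  assumes "\<exists>C. AE x in lborel. cmod (f x) \<le> C"
  shows "\<exists>C. AE x in lborel. \<bar>r\<bar> * cmod (f x) \<le> C"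
proof -
  obtain C where "AE x in lborel. cmod (f x) \<le> C" using assms by blast
  then have "AE x in lborel. \<bar>r\<bar> * cmod (f x) \<le> \<bar>r\<bar> * C"
    by eventually_elim (simp add: mult_left_mono)
  then show ?thesis ..
qed

lift_definition plus_linf :: "'a linf \<Rightarrow> 'a linf \<Rightarrow> 'a linf" is "\<lambda>f g x. f x + g x"
  unfolding linf_rel_def by (auto intro!: linf_bdd_add)

lift_definition uminus_linf :: "'a linf \<Rightarrow> 'a linf" is "\<lambda>f x. - f x"
  unfolding linf_rel_def by auto

lift_definition minus_linf :: "'a linf \<Rightarrow> 'a linf \<Rightarrow> 'a linf" is "\<lambda>f g x. f x - g x"
  unfolding linf_rel_def
  using linf_bdd_add[where g = "\<lambda>x. - g x" for g] by auto

lift_definition scaleR_linf :: "real \<Rightarrow> 'a linf \<Rightarrow> 'a linf" is "\<lambda>r f x. r *\<^sub>R f x"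
  unfolding linf_rel_def by (auto intro: linf_bdd_scale)

lift_definition norm_linf :: "'a linf \<Rightarrow> real" is
  "\<lambda>f. real_of_ereal (esssup lborel (\<lambda>x. ereal (cmod (f x))))"
  unfolding linf_rel_def by (auto intro!: arg_cong[where f = real_of_ereal] esssup_AE_cong)

definition sgn_linf :: "'a linf \<Rightarrow> 'a linf" where "sgn_linf u = scaleR (inverse (norm u)) u"
definition dist_linf :: "'a linf \<Rightarrow> 'a linf \<Rightarrow> real" where "dist_linf u v = norm (u - v)"
definition uniformity_linf :: "('a linf \<times> 'a linf) filter" where
  "uniformity_linf = (INF e\<in>{0<..}. principal {(u, v). dist u v < e})"
definition open_linf :: "'a linf set \<Rightarrow> bool" where
  "open_linf S = (\<forall>u\<in>S. \<forall>\<^sub>F (u', v) in uniformity. u' = u \<longrightarrow> v \<in> S)"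

instance
proof
  fix u v w :: "'a linf" and a b :: real
  show "u + v + w = u + (v + w)" "u + v = v + u" "0 + u = u" "- u + u = 0" "u - v = u + - v"
    by (transfer; auto simp: linf_rel_def add_ac intro!: linf_bdd_add
        linf_bdd_add[where g = "\<lambda>x. - g x" for g, simplified])+
  show "a *\<^sub>R (u + v) = a *\<^sub>R u + a *\<^sub>R v" "(a + b) *\<^sub>R u = a *\<^sub>R u + b *\<^sub>R u"
    "1 *\<^sub>R u = u"
    by (transfer; auto simp: linf_rel_def algebra_simps 
        intro!: linf_bdd_add linf_bdd_scale)+
  show "a *\<^sub>R b *\<^sub>R u = (a * b) *\<^sub>R u"
  proof (transfer, unfold linf_rel_def, elim conjE)
    fix a b :: real and f :: "'a \<Rightarrow> complex"
    assume f: "f \<in> borel_measurable lborel" "\<exists>C. AE x in lborel. cmod (f x) \<le> C"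
    have "\<exists>C. AE x in lborel. cmod ((a * b) *\<^sub>R f x) \<le> C"
      using linf_bdd_scale[OF f(2), of "a * b"] by simp
    then show "(\<lambda>x. a *\<^sub>R b *\<^sub>R f x) \<in> borel_measurable lborel \<and>
        (\<exists>C. AE x in lborel. cmod (a *\<^sub>R b *\<^sub>R f x) \<le> C) \<and>
        (\<lambda>x. (a * b) *\<^sub>R f x) \<in> borel_measurable lborel \<and>
        (\<exists>C. AE x in lborel. cmod ((a * b) *\<^sub>R f x) \<le> C) \<and>
        (AE x in lborel. a *\<^sub>R b *\<^sub>R f x = (a * b) *\<^sub>R f x)"
      using f(1) by simp
  qed
  show "dist u v = norm (u - v)" by (rule dist_linf_def)
  show "sgn u = scaleR (inverse (norm u)) u" by (rule sgn_linf_def)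
  show "uniformity = (INF e\<in>{0<..}. principal {(u :: 'a linf, v). dist u v < e})"
    by (rule uniformity_linf_def)
  show "open S = (\<forall>u\<in>S. \<forall>\<^sub>F (u', v) in uniformity. u' = u \<longrightarrow> v \<in> S)" for S :: "'a linf set"
    by (rule open_linf_def)
  show "norm u = 0 \<longleftrightarrow> u = 0"
  proof (transfer, unfold linf_rel_def, elim conjE)
    fix f :: "'a \<Rightarrow> complex"
    assume f: "f \<in> borel_measurable lborel" "\<exists>C. AE x in lborel. cmod (f x) \<le> C"
    from esssup_cmod_real[OF f] obtain r where
      r: "r \<ge> 0" "esssup lborel (\<lambda>x. ereal (cmod (f x))) = ereal r" .
    have "AE x in lborel. cmod (f x) \<le> r"
      using esssup_AE[of "\<lambda>x. ereal (cmod (f x))" lborel] r by simp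
    then have "r = 0 \<Longrightarrow> AE x in lborel. f x = 0" by simp
    moreover have "r = 0" if "AE x in lborel. f x = 0"
    proof -
      have "esssup lborel (\<lambda>x. ereal (cmod (f x))) \<le> 0"
        by (rule esssup_I) (use that f in auto)
      then show ?thesis using r by simp
    qed
    ultimately show "real_of_ereal (esssup lborel (\<lambda>x. ereal (cmod (f x)))) = 0 \<longleftrightarrow>
        f \<in> borel_measurable lborel \<and> (\<exists>C. AE x in lborel. cmod (f x) \<le> C) \<and>
        (\<lambda>_ :: 'a. 0 :: complex) \<in> borel_measurable lborel \<and>
        (\<exists>C. AE x :: 'a in lborel. cmod 0 \<le> C) \<and> (AE x in lborel. f x = 0)"
      using f r by auto
  qed
  show "norm (u + v) \<le> norm u + norm v"
  proof (transfer, unfold linf_rel_def, elim conjE)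
    fix f g :: "'a \<Rightarrow> complex"
    assume f: "f \<in> borel_measurable lborel" "\<exists>C. AE x in lborel. cmod (f x) \<le> C"
      and g: "g \<in> borel_measurable lborel" "\<exists>C. AE x in lborel. cmod (g x) \<le> C"
    from esssup_cmod_real[OF f] obtain r where
      r: "r \<ge> 0" "esssup lborel (\<lambda>x. ereal (cmod (f x))) = ereal r" .
    from esssup_cmod_real[OF g] obtain s where
      s: "s \<ge> 0" "esssup lborel (\<lambda>x. ereal (cmod (g x))) = ereal s" .
    from esssup_cmod_real[OF borel_measurable_add[OF f(1) g(1)] linf_bdd_add[OF f(2) g(2)]]
    obtain q where q: "q \<ge> 0" "esssup lborel (\<lambda>x. ereal (cmod (f x + g x))) = ereal q" .
    have "AE x in lborel. cmod (f x) \<le> r" "AE x in lborel. cmod (g x) \<le> s"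
      using esssup_AE[of "\<lambda>x. ereal (cmod (f x))" lborel] r
        esssup_AE[of "\<lambda>x. ereal (cmod (g x))" lborel] s by simp_all
    then have "AE x in lborel. ereal (cmod (f x + g x)) \<le> ereal (r + s)"
      by eventually_elim (simp add: norm_triangle_le)
    then have "esssup lborel (\<lambda>x. ereal (cmod (f x + g x))) \<le> ereal (r + s)"
      by (intro esssup_I) (use f g in auto)
    then show "real_of_ereal (esssup lborel (\<lambda>x. ereal (cmod (f x + g x))))
      \<le> real_of_ereal (esssup lborel (\<lambda>x. ereal (cmod (f x))))
        + real_of_ereal (esssup lborel (\<lambda>x. ereal (cmod (g x))))"
      using q r s by simp
  qed
  show "norm (a *\<^sub>R u) = \<bar>a\<bar> * norm u"
  proof (transfer, unfold linf_rel_def, elim conjE)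
    fix a :: real and f :: "'a \<Rightarrow> complex"
    assume f: "f \<in> borel_measurable lborel" "\<exists>C. AE x in lborel. cmod (f x) \<le> C"
    show "real_of_ereal (esssup lborel (\<lambda>x. ereal (cmod (a *\<^sub>R f x))))
        = \<bar>a\<bar> * real_of_ereal (esssup lborel (\<lambda>x. ereal (cmod (f x))))"
    proof (cases "a = 0")
      case True
      have "esssup (lborel :: 'a measure) (\<lambda>x. ereal 0) = ereal 0"
        by (rule esssup_const) (simp add: emeasure_lborel_UNIV)
      then show ?thesis using True by simp
    next
      case False
      then show ?thesis
        using esssup_cmult[of "\<bar>a\<bar>" lborel "\<lambda>x. ereal (cmod (f x))"] by simp
    qed
  qed
qed

end

lift_definition exp_linf :: "'a::euclidean_space linf \<Rightarrow> 'a linf" is "\<lambda>m x. exp (m x)"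
proof -
  have *: "\<exists>C. AE x in lborel. cmod (exp (m x)) \<le> C" if "AE x in lborel. cmod (m x) \<le> C"
    for m :: "'a \<Rightarrow> complex" and C
  proof -
    from that have "AE x in lborel. cmod (exp (m x)) \<le> exp C"
      by eventually_elim (meson norm_exp exp_le_cancel_iff order_trans)
    then show ?thesis ..
  qed
  show "linf_rel m m' \<Longrightarrow> linf_rel (\<lambda>x. exp (m x)) (\<lambda>x. exp (m' x))" for m m' :: "'a \<Rightarrow> complex"
    unfolding linf_rel_def by (auto intro: * simp del: norm_exp_eq_Re)
qed

lift_definition mult_l2 :: "'a::euclidean_space linf \<Rightarrow> 'a l2 \<Rightarrow> 'a l2" is "\<lambda>m f x. m x * f x"
proof -
  have *: "integrable lborel (\<lambda>x. (cmod (m x * f x))\<^sup>2)"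
    if "m \<in> borel_measurable lborel" "AE x in lborel. cmod (m x) \<le> C"
      "f \<in> borel_measurable lborel" "integrable lborel (\<lambda>x. (cmod (f x))\<^sup>2)"
    for m f :: "'a \<Rightarrow> complex" and C
  proof (rule Bochner_Integration.integrable_bound)
    show "integrable lborel (\<lambda>x. C\<^sup>2 * (cmod (f x))\<^sup>2)" using that by simp
    show "(\<lambda>x. (cmod (m x * f x))\<^sup>2) \<in> borel_measurable lborel" using that by measurable
    show "AE x in lborel. norm ((cmod (m x * f x))\<^sup>2) \<le> norm (C\<^sup>2 * (cmod (f x))\<^sup>2)"
      using that(2)
      by eventually_elim (auto simp: norm_mult power_mult_distrib intro!: mult_right_mono power_mono)
  qed
  show "linf_rel m m' \<Longrightarrow> l2_rel f f' \<Longrightarrow> l2_rel (\<lambda>x. m x * f x) (\<lambda>x. m' x * f' x)"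
    for m m' f f' :: "'a \<Rightarrow> complex"
    unfolding linf_rel_def l2_rel_def by (auto intro: *)
qed


section \<open>The Laplacian with domain $H^2(\mathbb{R}^d)$\<close>

primrec C_k :: "nat \<Rightarrow> ('a::euclidean_space \<Rightarrow> real) \<Rightarrow> bool" where
  "C_k 0 \<phi> \<longleftrightarrow> continuous_on UNIV \<phi>"
| "C_k (Suc k) \<phi> \<longleftrightarrow> (\<forall>x. \<phi> differentiable (at x)) \<and>
     (\<forall>b\<in>Basis. C_k k (\<lambda>x. frechet_derivative \<phi> (at x) b))"

definition test_function :: "('a::euclidean_space \<Rightarrow> real) \<Rightarrow> bool" where
  "test_function \<phi> \<longleftrightarrow> (\<forall>k. C_k k \<phi>) \<and> compact (closure {x. \<phi> x \<noteq> 0})"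

text \<open>
  The function \<open>v\<close> is the distributional derivative of \<open>u\<close> in the direction \<open>b\<close>.  The values of the
  integrals do not depend on the representatives.
\<close>

definition weak_partial :: "'a::euclidean_space \<Rightarrow> 'a l2 \<Rightarrow> 'a l2 \<Rightarrow> bool" where
  "weak_partial b u v \<longleftrightarrow> (\<forall>\<phi>. test_function \<phi> \<longrightarrow>
     (LINT x|lborel. frechet_derivative \<phi> (at x) b *\<^sub>R rep_l2 u x)
       = - (LINT x|lborel. \<phi> x *\<^sub>R rep_l2 v x))"

definition weak_deriv :: "'a::euclidean_space \<Rightarrow> 'a l2 \<Rightarrow> 'a l2" where
  "weak_deriv b u = (THE v. weak_partial b u v)"

definition H1 :: "'a::euclidean_space l2 set" where
  "H1 = {u. \<forall>b\<in>Basis. \<exists>v. weak_partial b u v}"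

definition H2 :: "'a::euclidean_space l2 set" where
  "H2 = {u\<in>H1. \<forall>b\<in>Basis. weak_deriv b u \<in> H1}"

definition laplacian :: "'a::euclidean_space l2 \<Rightarrow> 'a l2" where
  "laplacian u = (\<Sum>b\<in>Basis. weak_deriv b (weak_deriv b u))"


section \<open>Semigroups, generators and the extrapolation space\<close>

text \<open>Unbounded operators are represented by their graphs.\<close>

definition C0_semigroup :: "(real \<Rightarrow> 'x \<Rightarrow> 'x::real_normed_vector) \<Rightarrow> bool" where
  "C0_semigroup G \<longleftrightarrow>
     (\<forall>t\<ge>0. bounded_linear (G t)) \<and> G 0 = id \<and>
     (\<forall>t\<ge>0. \<forall>r\<ge>0. G (t + r) = G t \<circ> G r) \<and>
     (\<forall>x. continuous_on {0..} (\<lambda>t. G t x))"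

definition generator :: "(real \<Rightarrow> 'x \<Rightarrow> 'x::real_normed_vector) \<Rightarrow> ('x \<times> 'x) set" where
  "generator G = {(x, y). ((\<lambda>h. (G h x - x) /\<^sub>R h) \<longlongrightarrow> y) (at_right 0)}"

definition resolvent :: "real \<Rightarrow> ('x \<times> 'x) set \<Rightarrow> 'x \<Rightarrow> 'x::real_normed_vector" where
  "resolvent l A x = (THE y. \<exists>z. (y, z) \<in> A \<and> l *\<^sub>R y - z = x)"

definition heat_semigroup :: "(real \<Rightarrow> 'a::euclidean_space l2 \<Rightarrow> 'a l2) \<Rightarrow> bool" where
  "heat_semigroup G \<longleftrightarrow> C0_semigroup G \<and> generator G = {(u, laplacian u) | u. u \<in> H2}"

text \<open>
  The extrapolation space \<open>X\<^sub>-\<^sub>1\<close> is a completion of \<open>X\<close> for the norm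
  \<open>\<parallel>R(1,\<Delta>)x\<parallel>\<close>; it is unique up to an isometric isomorphism.  It is given by a Banach space
  \<open>'y\<close> together with the embedding \<open>j\<close> of \<open>X\<close> into it, and \<open>G1 t\<close> is the
  continuous extension of \<open>G t\<close>.  Here \<open>1\<close> is in the resolvent set of the generator
  of the heat semigroup; any other point of that set yields an equivalent norm.
\<close>

definition extrapolation ::
  "(real \<Rightarrow> 'x \<Rightarrow> 'x::real_normed_vector) \<Rightarrow> ('x \<Rightarrow> 'y::banach) \<Rightarrow> (real \<Rightarrow> 'y \<Rightarrow> 'y) \<Rightarrow> bool" where
  "extrapolation G j G1 \<longleftrightarrow>
     linear j \<and> closure (range j) = UNIV \<and>
     (\<forall>x. norm (j x) = norm (resolvent 1 (generator G) x)) \<and>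
     (\<forall>t\<ge>0. bounded_linear (G1 t) \<and> (\<forall>x. G1 t (j x) = j (G t x)))"


section \<open>Semigroups on $\mathrm{BUC}(\mathbb{R};X)$\<close>

definition BUC :: "(real \<Rightarrow> 'x::real_normed_vector) set" where
  "BUC = {f. bounded (range f) \<and> uniformly_continuous_on UNIV f}"

definition buc_norm :: "(real \<Rightarrow> 'x::real_normed_vector) \<Rightarrow> real" where
  "buc_norm f = (SUP s. norm (f s))"

definition loc_uniform_limit ::
  "('i \<Rightarrow> real \<Rightarrow> 'x::metric_space) \<Rightarrow> (real \<Rightarrow> 'x) \<Rightarrow> 'i filter \<Rightarrow> bool" where
  "loc_uniform_limit F f net \<longleftrightarrow> (\<forall>K. compact K \<longrightarrow> uniform_limit K F f net)"

text \<open>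
  The shifted heat semigroup is not strongly continuous for the sup norm, since \<open>e\<^bsup>h\<Delta>\<^esup>f(s) \<rightarrow> f(s)\<close>
  need not be uniform in \<open>s\<close>.  Semigroups on \<open>BUC\<close> and their generators are therefore
  understood in the bi-continuous sense, with respect to locally uniform convergence.  For such a
  semigroup which is also strongly continuous for the sup norm this generator is the usual one.
\<close>

definition bicontinuous_semigroup ::
  "(real \<Rightarrow> (real \<Rightarrow> 'x) \<Rightarrow> (real \<Rightarrow> 'x::real_normed_vector)) \<Rightarrow> bool" where
  "bicontinuous_semigroup W \<longleftrightarrow>
     (\<forall>t\<ge>0. \<forall>f\<in>BUC. W t f \<in> BUC) \<and>
     (\<forall>t\<ge>0. \<forall>f\<in>BUC. \<forall>g\<in>BUC. \<forall>c. W t (\<lambda>s. f s + c *\<^sub>R g s) = (\<lambda>s. W t f s + c *\<^sub>R W t g s)) \<and>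
     (\<forall>f\<in>BUC. W 0 f = f) \<and>
     (\<forall>t\<ge>0. \<forall>r\<ge>0. \<forall>f\<in>BUC. W (t + r) f = W t (W r f)) \<and>
     (\<exists>M \<omega>. \<forall>t\<ge>0. \<forall>f\<in>BUC. buc_norm (W t f) \<le> M * exp (\<omega> * t) * buc_norm f) \<and>
     (\<forall>f\<in>BUC. \<forall>t\<ge>0. loc_uniform_limit (\<lambda>r. W r f) (W t f) (at t within {0..})) \<and>
     (\<forall>F. (\<forall>n. F n \<in> BUC) \<and> (\<exists>C. \<forall>n. buc_norm (F n) \<le> C) \<and>
          loc_uniform_limit F (\<lambda>_. 0) sequentially \<longrightarrow>
        (\<forall>b K. compact K \<longrightarrow>
          uniform_limit ({0..b} \<times> K) (\<lambda>n (t, s). W t (F n) s) (\<lambda>_. 0) sequentially))"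

definition bicontinuous_generator ::
  "(real \<Rightarrow> (real \<Rightarrow> 'x) \<Rightarrow> (real \<Rightarrow> 'x::real_normed_vector)) \<Rightarrow> ((real \<Rightarrow> 'x) \<times> (real \<Rightarrow> 'x)) set" where
  "bicontinuous_generator W = {(f, g). f \<in> BUC \<and> g \<in> BUC \<and>
     (\<exists>C. \<forall>h\<in>{0<..1}. buc_norm (\<lambda>s. (W h f s - f s) /\<^sub>R h) \<le> C) \<and>
     loc_uniform_limit (\<lambda>h s. (W h f s - f s) /\<^sub>R h) g (at_right 0)}"

definition shift_semigroup ::
  "(real \<Rightarrow> 'x \<Rightarrow> 'x) \<Rightarrow> real \<Rightarrow> (real \<Rightarrow> 'x) \<Rightarrow> (real \<Rightarrow> 'x::real_normed_vector)" where
  "shift_semigroup G t f = (\<lambda>s. G t (f (s - t)))"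

definition mult_semigroup ::
  "(real \<Rightarrow> 'a::euclidean_space linf) \<Rightarrow> real \<Rightarrow> (real \<Rightarrow> 'a l2) \<Rightarrow> (real \<Rightarrow> 'a l2)" where
  "mult_semigroup V t f = (\<lambda>s. mult_l2 (exp_linf (t *\<^sub>R V s)) (f s))"

text \<open>
  The operator \<open>-d/ds + \<Delta>\<close>: here \<open>f'\<close> is the derivative of \<open>f\<close> and \<open>d s\<close> is \<open>\<Delta>\<^sub>-\<^sub>1(f s)\<close>, both in
  \<open>X\<^sub>-\<^sub>1\<close>.  As \<open>X\<close> is the domain of \<open>\<Delta>\<^sub>-\<^sub>1\<close>, the value \<open>d s\<close> exists.
\<close>

definition evolution_operator ::
  "('x::real_normed_vector \<Rightarrow> 'y::banach) \<Rightarrow> (real \<Rightarrow> 'y \<Rightarrow> 'y) \<Rightarrow> ((real \<Rightarrow> 'x) \<times> (real \<Rightarrow> 'x)) set" where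
  "evolution_operator j G1 = {(f, g). f \<in> BUC \<and> g \<in> BUC \<and>
     (\<exists>f' d. (\<lambda>s. j (f s)) \<in> BUC \<and> f' \<in> BUC \<and>
        (\<forall>s. ((\<lambda>r. j (f r)) has_vector_derivative f' s) (at s)) \<and>
        (\<forall>s. (j (f s), d s) \<in> generator G1) \<and>
        (\<forall>s. j (g s) = - f' s + d s))}"

definition perturbed_operator ::
  "((real \<Rightarrow> 'a l2) \<times> (real \<Rightarrow> 'a l2)) set \<Rightarrow> (real \<Rightarrow> 'a::euclidean_space linf)
     \<Rightarrow> ((real \<Rightarrow> 'a l2) \<times> (real \<Rightarrow> 'a l2)) set" where
  "perturbed_operator A V = {(f, \<lambda>s. g s + mult_l2 (V s) (f s)) | f g. (f, g) \<in> A}"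


section \<open>The non-autonomous Cauchy problem\<close>

definition evolution_family :: "(real \<Rightarrow> real \<Rightarrow> 'a::euclidean_space l2 \<Rightarrow> 'a l2) \<Rightarrow> bool" where
  "evolution_family U \<longleftrightarrow>
     (\<forall>s t. s \<le> t \<longrightarrow> bounded_linear (U t s) \<and> (\<forall>c u. U t s (scaleC_l2 c u) = scaleC_l2 c (U t s u))) \<and>
     (\<forall>s r t. s \<le> r \<and> r \<le> t \<longrightarrow> U t r \<circ> U r s = U t s) \<and>
     (\<forall>t. U t t = id) \<and>
     (\<forall>u. continuous_on {(t, s). s \<le> t} (\<lambda>(t, s). U t s u)) \<and>
     (\<exists>M\<ge>1. \<exists>\<omega>. \<forall>s t. s \<le> t \<longrightarrow> onorm (U t s) \<le> M * exp (\<omega> * (t - s)))"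

definition classical_solution ::
  "(real \<Rightarrow> 'a::euclidean_space linf) \<Rightarrow> real \<Rightarrow> (real \<Rightarrow> 'a l2) \<Rightarrow> bool" where
  "classical_solution V s u \<longleftrightarrow>
     (\<exists>u'. continuous_on {s..} u' \<and>
        (\<forall>t\<ge>s. (u has_vector_derivative u' t) (at t within {s..}) \<and>
           u t \<in> H2 \<and> u' t = laplacian (u t) + mult_l2 (V t) (u t)))"

definition solves ::
  "(real \<Rightarrow> 'a::euclidean_space linf) \<Rightarrow> (real \<Rightarrow> real \<Rightarrow> 'a l2 \<Rightarrow> 'a l2) \<Rightarrow> bool" where
  "solves V U \<longleftrightarrow> evolution_family U \<and>
     (\<forall>s. closure {y. classical_solution V s (\<lambda>t. U t s y)} = UNIV)"

text \<open>Uniqueness concerns only the operators \<open>U t s\<close> with \<open>s \<le> t\<close>.\<close>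

definition well_posed :: "(real \<Rightarrow> 'a::euclidean_space linf) \<Rightarrow> bool" where
  "well_posed V \<longleftrightarrow> (\<exists>U. solves V U) \<and>
     (\<forall>U U'. solves V U \<and> solves V U' \<longrightarrow> (\<forall>s t. s \<le> t \<longrightarrow> U t s = U' t s))"

primrec time_ordered_prod :: "(nat \<Rightarrow> 'x \<Rightarrow> 'x) \<Rightarrow> nat \<Rightarrow> 'x \<Rightarrow> 'x" where
  "time_ordered_prod U 0 = id"
| "time_ordered_prod U (Suc n) = U n \<circ> time_ordered_prod U n"

end

theory Submission
  imports Defs
begin

text \<open>
  Both products compare a mild solution \<open>u\<close> of \<open>u' = \<Delta>u + V(r)u\<close> on \<open>[0,T]\<close> with a splitting scheme:
  in the first part \<open>u(r) = [W(r)f](\<sigma> + r)\<close> along a characteristic, in the second part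
  \<open>u(r) = W(s + r, s)y\<close>.  To leading order the error is that of a Riemann sum for
  \<open>r \<mapsto> e\<^bsup>(T-r)\<Delta>\<^esup> V(r) e\<^bsup>r\<Delta>\<^esup>\<close>.  The Laplacian is symmetric and dissipative, so
  \<open>\<parallel>\<Delta> e\<^bsup>t\<Delta>\<^esup>\<parallel> \<le> 1/t\<close> and this integrand is continuous in operator norm away from the end points.
  The error is therefore bounded by a null sequence times \<open>sup \<parallel>u\<parallel>\<close>, where the null sequence depends only
  on the bound and the modulus of continuity of \<open>V\<close> and on an upper bound for \<open>T\<close>.  This uniformity gives
  convergence in the sup norm although the shifted heat semigroup is not strongly continuous
  for it, and it allows passing from a dense set of initial values to all of them.
\<close>

section \<open>Contraction semigroups\<close>

text \<open>The smoothing bound \<open>h / a\<close> for \<open>G (a + h) - G a\<close> blows up at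
  \<open>a = 0\<close>; together with the trivial bound 2 it is replaced by
  \<open>3 * sqrt (h / (a + h))\<close>, which stays finite and over \<open>n\<close> steps of size
  \<open>h = T / n\<close> adds up to \<open>O(1 / sqrt n)\<close>. The hypothesis
  \<open>heat_semigroup\<close> supplies a generator, not a kernel or a Fourier multiplier. Symmetry
  and dissipativity come from integration by parts for weak derivatives: these are weak limits of
  difference quotients, and the adjoint of a translation is the opposite translation. In the first
  part \<open>- f'\<close> and the Laplacian of \<open>f\<close> need not take values in L2
  separately, only their sum does. The variation of constants formula is therefore derived in the
  extrapolation space, where both exist, and pulled back along the injective embedding; for the
  classical solutions of the second part the embedding is the identity.\<close>

locale c0_semigroup =
  fixes G :: "real \<Rightarrow> 'a::banach \<Rightarrow> 'a"
  assumes C0: "C0_semigroup G"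
begin

lemma G_bounded_linear: "t \<ge> 0 \<Longrightarrow> bounded_linear (G t)"
  using C0 by (simp add: C0_semigroup_def)

lemma G_zero [simp]: "G 0 x = x"
  using C0 by (simp add: C0_semigroup_def)

lemma G_add: "t \<ge> 0 \<Longrightarrow> r \<ge> 0 \<Longrightarrow> G (t + r) x = G t (G r x)"
  using C0 by (simp add: C0_semigroup_def)

lemma G_orbit_cont: "continuous_on {0..} (\<lambda>t. G t x)"
  using C0 by (simp add: C0_semigroup_def)

lemma G_diff: "t \<ge> 0 \<Longrightarrow> G t (x - y) = G t x - G t y"
  by (simp add: G_bounded_linear bounded_linear.linear linear_diff)

lemma G_scale: "t \<ge> 0 \<Longrightarrow> G t (c *\<^sub>R x) = c *\<^sub>R G t x"
  by (simp add: G_bounded_linear bounded_linear.linear linear_scale)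

lemma G_plus: "t \<ge> 0 \<Longrightarrow> G t (x + y) = G t x + G t y"
  by (simp add: G_bounded_linear bounded_linear.linear linear_add)

lemma G_map_zero [simp]: "t \<ge> 0 \<Longrightarrow> G t 0 = 0"
  by (simp add: G_bounded_linear bounded_linear.linear linear_0)

end

locale contraction_semigroup = c0_semigroup G for G :: "real \<Rightarrow> 'a::banach \<Rightarrow> 'a" +
  assumes contraction: "t \<ge> 0 \<Longrightarrow> norm (G t x) \<le> norm x"
begin

text \<open>Joint continuity in time and vector: contractivity makes
  \<open>G (a x) (v x - w)\<close> small, strong continuity handles
  \<open>G (a x) w\<close>.\<close>

lemma G_tendsto:
  assumes a: "(a \<longlongrightarrow> l) F" and v: "(v \<longlongrightarrow> w) F" and ev: "\<forall>\<^sub>F x in F. a x \<ge> 0" and l: "l \<ge> 0"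
  shows "((\<lambda>x. G (a x) (v x)) \<longlongrightarrow> G l w) F"
proof -
  have "continuous (at l within {0..}) (\<lambda>t. G t w)"
    using G_orbit_cont[of w] l by (simp add: continuous_on_eq_continuous_within)
  then have 1: "((\<lambda>x. G (a x) w) \<longlongrightarrow> G l w) F"
    using continuous_within_tendsto_compose[of l "{0..}" "\<lambda>t. G t w" a F] a ev l by simp
  have "((\<lambda>x. norm (v x - w)) \<longlongrightarrow> 0) F"
    using v by (simp add: LIM_zero_iff tendsto_norm_zero_iff)
  then have 2: "((\<lambda>x. G (a x) (v x - w)) \<longlongrightarrow> 0) F"
    by (rule Lim_null_comparison[rotated]) (use ev contraction in \<open>auto elim: eventually_mono\<close>)
  have "((\<lambda>x. G (a x) (v x - w) + G (a x) w) \<longlongrightarrow> 0 + G l w) F"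
    by (rule tendsto_add[OF 2 1])
  then show ?thesis
    by (auto intro!: Lim_transform_eventually[where f = "\<lambda>x. G (a x) (v x - w) + G (a x) w"]
        eventually_mono[OF ev] simp: G_diff)
qed

lemma G_continuous_on:
  assumes "continuous_on S a" "continuous_on S v" "\<And>x. x \<in> S \<Longrightarrow> a x \<ge> 0"
  shows "continuous_on S (\<lambda>x. G (a x) (v x))"
  unfolding continuous_on_def
proof
  fix x assume x: "x \<in> S"
  show "((\<lambda>x. G (a x) (v x)) \<longlongrightarrow> G (a x) (v x)) (at x within S)"
    by (rule G_tendsto) (use assms x in \<open>auto simp: continuous_on_def eventually_at_filter\<close>)
qed

end

section \<open>One-sided derivatives and the variation of constants formula\<close>

lemma right_derivative_nonpos_imp_le:
  fixes p :: "real \<Rightarrow> real"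
  assumes ab: "a \<le> b" and cont: "continuous_on {a..b} p"
    and step: "\<And>x e. a \<le> x \<Longrightarrow> x < b \<Longrightarrow> e > 0 \<Longrightarrow> \<forall>\<^sub>F h in at_right (0::real). p (x + h) \<le> p x + e * h"
  shows "p b \<le> p a"
proof (rule field_le_epsilon)
  fix e' :: real assume "e' > 0"
  define e where "e = e' / (b - a + 1)"
  have e: "e > 0" "e * (b - a) \<le> e'"
    using \<open>e' > 0\<close> ab by (auto simp: e_def divide_le_eq mult_left_mono)
  \<comment> \<open>Tilting by the slope \<open>e\<close> makes room for the error in
    \<open>step\<close>. At the last point where \<open>q \<le> 0\<close>, a short step to the right
    keeps \<open>q \<le> 0\<close>, so that point can only be \<open>b\<close>. The
    \<open>+ 1\<close> in the definition of \<open>e\<close> covers \<open>a = b\<close>.\<close>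
  define q where "q x = p x - p a - e * (x - a)" for x
  have q_cont: "continuous_on {a..b} q"
    unfolding q_def by (intro continuous_intros cont)
  have "q b \<le> 0"
  proof (rule ccontr)
    assume nb: "\<not> q b \<le> 0"
    define S where "S = {x \<in> {a..b}. q x \<le> 0}"
    have "closed S"
      unfolding S_def by (rule continuous_on_closed_Collect_le[OF q_cont]) auto
    moreover have "bounded S" by (rule bounded_subset[of "{a..b}"]) (auto simp: S_def)
    ultimately have "compact S" by (simp add: compact_eq_bounded_closed)
    moreover have "a \<in> S" using ab by (simp add: S_def q_def)
    ultimately obtain s where s: "s \<in> S" "\<forall>x\<in>S. x \<le> s"
      using compact_attains_sup[of S] by blast
    then have sb: "a \<le> s" "s < b" "q s \<le> 0" using nb by (auto simp: S_def less_le)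
    have "\<forall>\<^sub>F h in at_right (0::real). h < b - s"
      using sb by (auto simp: eventually_at_right_field intro!: exI[of _ "b - s"])
    moreover note step[OF sb(1,2) e(1)]
    moreover have "\<forall>\<^sub>F h in at_right (0::real). h > 0" by (rule eventually_at_right_less)
    ultimately have "\<forall>\<^sub>F h in at_right (0::real). False"
    proof eventually_elim
      case (elim h)
      have "q (s + h) \<le> q s" using elim by (simp add: q_def algebra_simps)
      then have "s + h \<in> S" using sb elim by (auto simp: S_def)
      then show False using s(2) elim by force
    qed
    then show False by simp
  qed
  then show "p b \<le> p a + e'" using e by (simp add: q_def)
qed

lemma right_derivative_zero_imp_eq:
  fixes f :: "real \<Rightarrow> 'a::real_normed_vector"
  assumes ab: "a \<le> b" and cont: "continuous_on {a..b} f"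
    and D: "\<And>x. a \<le> x \<Longrightarrow> x < b \<Longrightarrow> ((\<lambda>h. (f (x + h) - f x) /\<^sub>R h) \<longlongrightarrow> 0) (at_right 0)"
  shows "f b = f a"
proof -
  have "norm (f b - f a) \<le> norm (f a - f a)"
  proof (rule right_derivative_nonpos_imp_le[OF ab])
    fix x e :: real assume x: "a \<le> x" "x < b" and e: "e > 0"
    have "\<forall>\<^sub>F h in at_right 0. norm ((f (x + h) - f x) /\<^sub>R h) < e"
      using D[OF x] e by (auto simp: tendsto_iff)
    moreover have "\<forall>\<^sub>F h in at_right (0::real). h > 0" by (rule eventually_at_right_less)
    ultimately show "\<forall>\<^sub>F h in at_right 0. norm (f (x + h) - f a) \<le> norm (f x - f a) + e * h"
    proof eventually_elim
      case (elim h)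
      have "norm ((f (x + h) - f x) /\<^sub>R h) = norm (f (x + h) - f x) / h"
        using elim by (simp add: divide_inverse mult.commute)
      then have "norm (f (x + h) - f x) \<le> e * h" using elim by (simp add: pos_divide_less_eq)
      then show ?case using norm_triangle_ineq[of "f (x + h) - f x" "f x - f a"] by simp
    qed
  qed (intro continuous_intros cont)
  then show ?thesis by simp
qed

lemma right_derivativeI:
  fixes f :: "real \<Rightarrow> 'a::real_normed_vector"
  assumes "(f has_vector_derivative D) (at x within {a..b})" "a \<le> x" "x < b"
  shows "((\<lambda>h. (f (x + h) - f x) /\<^sub>R h) \<longlongrightarrow> D) (at_right 0)"
proof -
  have "((\<lambda>y. (f y - f x) /\<^sub>R (y - x)) \<longlongrightarrow> D) (at x within {a..b})"
  proof -
    have "((\<lambda>y. norm (f y - f x - (y - x) *\<^sub>R D) / norm (y - x)) \<longlongrightarrow> 0) (at x within {a..b})"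
      using assms(1) by (simp add: has_vector_derivative_def has_derivative_iff_norm)
    moreover have "norm (f y - f x - (y - x) *\<^sub>R D) / norm (y - x) = norm ((f y - f x) /\<^sub>R (y - x) - D)"
      if "y \<noteq> x" for y
    proof -
      have "f y - f x - (y - x) *\<^sub>R D = (y - x) *\<^sub>R ((f y - f x) /\<^sub>R (y - x) - D)"
        using that by (simp add: scaleR_diff_right)
      then show ?thesis using that by (simp only: norm_scaleR) simp
    qed
    ultimately have "((\<lambda>y. norm ((f y - f x) /\<^sub>R (y - x) - D)) \<longlongrightarrow> 0) (at x within {a..b})"
      by (auto elim!: Lim_transform_eventually simp: eventually_at_filter)
    then show ?thesis by (simp add: LIM_zero_iff tendsto_norm_zero_iff)
  qed
  moreover have "filterlim (\<lambda>h. x + h) (at x within {a..b}) (at_right 0)"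
  proof (rule filterlim_at_withinI)
    show "((\<lambda>h. x + h) \<longlongrightarrow> x) (at_right 0)" by (auto intro!: tendsto_eq_intros)
  qed (use assms in \<open>auto simp: eventually_at_right_field intro!: exI[of _ "b - x"]\<close>)
  ultimately show ?thesis
    by (auto dest: filterlim_compose)
qed

text \<open>Semigroups provide difference quotients for positive increments only. The function minus
  the integral of its right derivative has right derivative zero and is therefore constant; a
  continuous right derivative is thereby upgraded to an integral identity, hence to a two-sided
  derivative.\<close>

lemma continuous_right_derivative_integral:
  fixes f g :: "real \<Rightarrow> 'a::banach"
  assumes ab: "a \<le> b" and f: "continuous_on {a..b} f" and g: "continuous_on {a..b} g"
    and D: "\<And>x. a \<le> x \<Longrightarrow> x < b \<Longrightarrow> ((\<lambda>h. (f (x + h) - f x) /\<^sub>R h) \<longlongrightarrow> g x) (at_right 0)"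
  shows "f b - f a = integral {a..b} g"
proof -
  define F where "F x = integral {a..x} g" for x
  have F': "(F has_vector_derivative g x) (at x within {a..b})" if "x \<in> {a..b}" for x
    unfolding F_def by (rule integral_has_vector_derivative[OF g that])
  have "f b - F b = f a - F a"
  proof (rule right_derivative_zero_imp_eq[OF ab])
    have "continuous_on {a..b} F"
      using F' by (rule continuous_on_vector_derivative)
    then show "continuous_on {a..b} (\<lambda>x. f x - F x)" by (intro continuous_intros f)
    fix x assume x: "a \<le> x" "x < b"
    have "((\<lambda>h. (f (x + h) - f x) /\<^sub>R h - (F (x + h) - F x) /\<^sub>R h) \<longlongrightarrow> g x - g x) (at_right 0)"
      by (intro tendsto_diff D x right_derivativeI[OF F']) (use x in auto)
    then show "((\<lambda>h. (f (x + h) - F (x + h) - (f x - F x)) /\<^sub>R h) \<longlongrightarrow> 0) (at_right 0)"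
      by (simp add: scaleR_diff_right algebra_simps)
  qed
  then show ?thesis by (simp add: F_def algebra_simps)
qed

text \<open>The difference quotient is computed in a larger space carrying \<open>S\<close>, where
  the unbounded term \<open>d r\<close> exists. This term cancels, and what remains is the image of
  a vector of the original space. With \<open>j\<close> the identity this covers classical
  solutions, with the extrapolation space the orbits of the perturbed semigroup.\<close>

lemma (in contraction_semigroup) duhamel:
  fixes S :: "real \<Rightarrow> 'b::banach \<Rightarrow> 'b"
  assumes "contraction_semigroup S" and j: "bounded_linear j" "inj j"
    and inter: "\<And>t x. t \<ge> 0 \<Longrightarrow> S t (j x) = j (G t x)"
    and u: "continuous_on {0..T} u" and c: "continuous_on {0..T} c"
    and D: "\<And>r. 0 \<le> r \<Longrightarrow> r < T \<Longrightarrow>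
      ((\<lambda>h. (j (u (r + h)) - j (u r)) /\<^sub>R h) \<longlongrightarrow> d r + j (c r)) (at_right 0)"
    and d: "\<And>r. 0 \<le> r \<Longrightarrow> r < T \<Longrightarrow> (j (u r), d r) \<in> generator S"
    and r: "0 < r" "r < t" "t \<le> T"
  shows "((\<lambda>r. G (t - r) (u r)) has_vector_derivative G (t - r) (c r)) (at r)"
proof -
  interpret S: contraction_semigroup S by fact
  define w where "w r = G (t - r) (u r)" for r
  define v where "v r = G (t - r) (c r)" for r
  have wc: "continuous_on {0..t} w"
    unfolding w_def by (intro G_continuous_on continuous_intros continuous_on_subset[OF u]) (use r in auto)
  have vc: "continuous_on {0..t} v"
    unfolding v_def by (intro G_continuous_on continuous_intros continuous_on_subset[OF c]) (use r in auto)
  have eq: "w x = w 0 + integral {0..x} v" if x: "0 \<le> x" "x \<le> t" for x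
  proof -
    have vx: "continuous_on {0..x} v" using x by (auto intro: continuous_on_subset[OF vc])
    have "j (w x) - j (w 0) = integral {0..x} (\<lambda>r. j (v r))"
    proof (rule continuous_right_derivative_integral)
      show "continuous_on {0..x} (\<lambda>r. j (w r))" "continuous_on {0..x} (\<lambda>r. j (v r))"
        using x by (auto intro!: bounded_linear.continuous_on[OF j(1)] vx continuous_on_subset[OF wc])
      fix r assume r': "0 \<le> r" "r < x"
      then have rT: "r < T" "r < t" using x r by auto
      have ev: "\<forall>\<^sub>F h in at_right (0::real). 0 < h \<and> h < t - r"
        using rT by (auto simp: eventually_at_right_field intro!: exI[of _ "t - r"])
      \<comment> \<open>The increment of \<open>j (w r)\<close> is \<open>S (t - r - h)\<close>
        applied to \<open>j (u (r + h)) - S h (j (u r))\<close>. Subtracting \<open>j (u r)\<close>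
        from both terms gives two quotients, with limits \<open>d r + j (c r)\<close> and
        \<open>d r\<close>.\<close>
      have "((\<lambda>h. S (t - r - h) ((j (u (r + h)) - j (u r)) /\<^sub>R h - (S h (j (u r)) - j (u r)) /\<^sub>R h))
         \<longlongrightarrow> S (t - r - 0) (d r + j (c r) - d r)) (at_right 0)"
      proof (rule S.G_tendsto)
        have "((\<lambda>h. (S h (j (u r)) - j (u r)) /\<^sub>R h) \<longlongrightarrow> d r) (at_right 0)"
          using d[OF r'(1) rT(1)] by (simp add: generator_def)
        then show "((\<lambda>h. (j (u (r + h)) - j (u r)) /\<^sub>R h - (S h (j (u r)) - j (u r)) /\<^sub>R h)
          \<longlongrightarrow> d r + j (c r) - d r) (at_right 0)"
          by (intro tendsto_diff D r' rT)
        show "((\<lambda>h. t - r - h) \<longlongrightarrow> t - r - 0) (at_right 0)" by (intro tendsto_intros)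
        show "\<forall>\<^sub>F h in at_right 0. 0 \<le> t - r - h" using ev by eventually_elim simp
      qed (use rT in simp)
      then have "((\<lambda>h. S (t - r - h) ((j (u (r + h)) - j (u r)) /\<^sub>R h - (S h (j (u r)) - j (u r)) /\<^sub>R h))
         \<longlongrightarrow> j (v r)) (at_right 0)"
        using rT by (simp add: inter v_def)
      then show "((\<lambda>h. (j (w (r + h)) - j (w r)) /\<^sub>R h) \<longlongrightarrow> j (v r)) (at_right 0)"
      proof (rule Lim_transform_eventually)
        show "\<forall>\<^sub>F h in at_right 0. S (t - r - h) ((j (u (r + h)) - j (u r)) /\<^sub>R h - (S h (j (u r)) - j (u r)) /\<^sub>R h)
           = (j (w (r + h)) - j (w r)) /\<^sub>R h"
          using ev
        proof eventually_elim
          case (elim h)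
          have "S (t - r - h) (S h (j (u r))) = S (t - r) (j (u r))"
            using elim by (simp add: S.G_add[symmetric])
          then show ?case using elim
            by (simp add: S.G_diff S.G_scale w_def inter[symmetric] algebra_simps)
        qed
      qed
    qed (use x in auto)
    \<comment> \<open>The bounded operator \<open>j\<close> commutes with the integral, so
      injectivity removes it; the identity then holds in the original space and can be
      differentiated from both sides.\<close>
    also have "\<dots> = j (integral {0..x} v)"
      using integral_linear[OF integrable_continuous_real[OF vx] j(1)] by (simp add: o_def)
    finally have "j (w x) = j (w 0 + integral {0..x} v)"
      using j(1) by (simp add: bounded_linear.linear linear_add linear_diff algebra_simps)
    then show ?thesis using j(2) by (simp add: inj_eq)
  qed
  have "((\<lambda>x. integral {0..x} v) has_vector_derivative v r) (at r within {0..t})"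
    by (rule integral_has_vector_derivative[OF vc]) (use r in auto)
  then have "((\<lambda>x. w 0 + integral {0..x} v) has_vector_derivative v r) (at r within {0..t})"
    by (auto intro!: derivative_eq_intros)
  then have "(w has_vector_derivative v r) (at r within {0..t})"
    by (rule has_vector_derivative_transform[rotated 2]) (use r in \<open>auto intro: eq\<close>)
  moreover have "at r within {0..t} = at r" using r by (intro at_within_interior) auto
  ultimately show ?thesis by (simp add: w_def[abs_def] v_def)
qed

section \<open>Generators and time averages of orbits\<close>

context c0_semigroup
begin

lemma generator_unique: "(x, y) \<in> generator G \<Longrightarrow> (x, z) \<in> generator G \<Longrightarrow> y = z"
  unfolding generator_def by (auto intro: tendsto_unique[rotated])

lemma generator_invariant:
  assumes "(x, y) \<in> generator G" and t: "t \<ge> 0"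
  shows "(G t x, G t y) \<in> generator G"
proof -
  have "((\<lambda>h. G t ((G h x - x) /\<^sub>R h)) \<longlongrightarrow> G t y) (at_right 0)"
    using assms by (intro bounded_linear.tendsto[OF G_bounded_linear]) (auto simp: generator_def)
  moreover have "\<forall>\<^sub>F h in at_right 0. G t ((G h x - x) /\<^sub>R h) = (G h (G t x) - G t x) /\<^sub>R h"
    using eventually_at_right_less[of 0]
    by eventually_elim (use t in \<open>simp add: G_diff G_scale G_add[symmetric] add.commute\<close>)
  ultimately show ?thesis unfolding generator_def by (auto intro: Lim_transform_eventually)
qed

lemma orbit_right_derivative:
  assumes "(x, y) \<in> generator G" and t: "t \<ge> 0"
  shows "((\<lambda>h. (G (t + h) x - G t x) /\<^sub>R h) \<longlongrightarrow> G t y) (at_right 0)"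
proof -
  have "((\<lambda>h. (G h (G t x) - G t x) /\<^sub>R h) \<longlongrightarrow> G t y) (at_right 0)"
    using generator_invariant[OF assms] by (simp add: generator_def)
  moreover have "\<forall>\<^sub>F h in at_right 0. (G h (G t x) - G t x) /\<^sub>R h = (G (t + h) x - G t x) /\<^sub>R h"
    using eventually_at_right_less[of 0]
    by eventually_elim (use t in \<open>simp add: G_add[symmetric] add.commute\<close>)
  ultimately show ?thesis by (rule Lim_transform_eventually)
qed

lemma orbit_derivative:
  assumes xy: "(x, y) \<in> generator G" and t: "t > 0"
  shows "((\<lambda>t. G t x) has_vector_derivative G t y) (at t)"
proof -
  have c: "continuous_on {0..b} (\<lambda>t. G t z)" for b z
    by (rule continuous_on_subset[OF G_orbit_cont]) auto
  have eq: "G s x = x + integral {0..s} (\<lambda>t. G t y)" if "s \<ge> 0" for s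
    using continuous_right_derivative_integral[OF that c c orbit_right_derivative[OF xy]]
    by (simp add: algebra_simps)
  have "((\<lambda>s. x + integral {0..s} (\<lambda>t. G t y)) has_vector_derivative G t y) (at t within {0..t+1})"
  proof -
    have "((\<lambda>s. integral {0..s} (\<lambda>t. G t y)) has_vector_derivative G t y) (at t within {0..t+1})"
      by (rule integral_has_vector_derivative[OF c]) (use t in auto)
    then show ?thesis by (auto intro!: derivative_eq_intros)
  qed
  then have "((\<lambda>t. G t x) has_vector_derivative G t y) (at t within {0..t+1})"
    by (rule has_vector_derivative_transform[rotated 2]) (use t in \<open>auto intro: eq\<close>)
  moreover have "at t within {0..t+1} = at t" using t by (intro at_within_interior) auto
  ultimately show ?thesis by simp
qed

text \<open>These averages map into the domain of the generator, commute with the semigroup and tend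
  to the identity as \<open>\<delta>\<close> tends to 0. Every passage from the domain to the whole
  space goes through them.\<close>

definition mean :: "real \<Rightarrow> 'a \<Rightarrow> 'a" where
  "mean \<delta> x = integral {0..\<delta>} (\<lambda>r. G r x) /\<^sub>R \<delta>"

lemma orbit_integrable: "0 \<le> a \<Longrightarrow> (\<lambda>r. G r x) integrable_on {a..b}"
  by (intro integrable_continuous_real continuous_on_subset[OF G_orbit_cont]) auto

lemma mean_add: "mean \<delta> (x + y) = mean \<delta> x + mean \<delta> y"
proof -
  have "integral {0..\<delta>} (\<lambda>r. G r (x + y)) = integral {0..\<delta>} (\<lambda>r. G r x + G r y)"
    by (rule Henstock_Kurzweil_Integration.integral_cong) (simp add: G_plus)
  then show ?thesis
    by (simp add: mean_def Henstock_Kurzweil_Integration.integral_add orbit_integrable scaleR_add_right)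
qed

lemma mean_scale: "mean \<delta> (c *\<^sub>R x) = c *\<^sub>R mean \<delta> x"
proof -
  have "integral {0..\<delta>} (\<lambda>r. G r (c *\<^sub>R x)) = integral {0..\<delta>} (\<lambda>r. c *\<^sub>R G r x)"
    by (rule Henstock_Kurzweil_Integration.integral_cong) (simp add: G_scale)
  then show ?thesis by (simp add: mean_def)
qed

lemma mean_linear: "linear (mean \<delta>)"
  by (rule linearI) (simp_all add: mean_add mean_scale)

lemma mean_commute:
  assumes "t \<ge> 0"
  shows "G t (mean \<delta> x) = mean \<delta> (G t x)"
proof -
  have "G t (integral {0..\<delta>} (\<lambda>r. G r x)) = integral {0..\<delta>} (\<lambda>r. G t (G r x))"
    using integral_linear[OF orbit_integrable[of 0 x \<delta>] G_bounded_linear[OF assms]] by (simp add: o_def)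
  also have "\<dots> = integral {0..\<delta>} (\<lambda>r. G r (G t x))"
    by (rule Henstock_Kurzweil_Integration.integral_cong)
      (use assms in \<open>simp add: G_add[symmetric] add.commute\<close>)
  finally show ?thesis using assms by (simp add: mean_def G_scale)
qed

text \<open>A change of variable gives \<open>G h (F \<delta>) = F (\<delta> + h) - F h\<close> for
  the antiderivative \<open>F\<close> of the orbit, so the difference quotient splits into one of
  \<open>F\<close> at \<open>\<delta>\<close> and one at 0.\<close>

lemma mean_generator:
  assumes \<delta>: "\<delta> > 0"
  shows "(mean \<delta> x, (G \<delta> x - x) /\<^sub>R \<delta>) \<in> generator G"
proof -
  define F where "F s = integral {0..s} (\<lambda>r. G r x)" for s
  have c: "continuous_on {0..b} (\<lambda>t. G t x)" for b
    by (rule continuous_on_subset[OF G_orbit_cont]) auto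
  have F': "(F has_vector_derivative G s x) (at s within {0..\<delta> + 1})" if "s \<in> {0..\<delta> + 1}" for s
    unfolding F_def by (rule integral_has_vector_derivative[OF c that])
  have GF: "G h (F \<delta>) = F (\<delta> + h) - F h" if h: "h > 0" for h
  proof -
    have "G h (F \<delta>) = integral {0..\<delta>} (\<lambda>r. G h (G r x))"
      using integral_linear[OF orbit_integrable[of 0 x \<delta>] G_bounded_linear[of h]] h by (simp add: o_def F_def)
    also have "\<dots> = integral {0..\<delta>} (\<lambda>r. G (r + h) x)"
      by (rule Henstock_Kurzweil_Integration.integral_cong) (use h in \<open>simp add: G_add[symmetric] add.commute\<close>)
    also have "\<dots> = integral {h..\<delta> + h} (\<lambda>r. G r x)"
      using has_integral_affinity'[OF integrable_integral[OF orbit_integrable[of h x "\<delta> + h"], folded cbox_interval],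
          of 1 h] h by (intro integral_unique) simp
    also have "\<dots> = F (\<delta> + h) - F h"
      using Henstock_Kurzweil_Integration.integral_combine[of 0 h "\<delta> + h" "\<lambda>r. G r x"] h \<delta>
        orbit_integrable[of 0 x "\<delta> + h"] by (simp add: F_def algebra_simps)
    finally show ?thesis .
  qed
  have "((\<lambda>h. (F (\<delta> + h) - F \<delta>) /\<^sub>R h - (F (0 + h) - F 0) /\<^sub>R h) \<longlongrightarrow> G \<delta> x - G 0 x) (at_right 0)"
    by (intro tendsto_diff right_derivativeI[OF F']) (use \<delta> in auto)
  then have "((\<lambda>h. ((F (\<delta> + h) - F \<delta>) /\<^sub>R h - (F (0 + h) - F 0) /\<^sub>R h) /\<^sub>R \<delta>) \<longlongrightarrow> (G \<delta> x - x) /\<^sub>R \<delta>) (at_right 0)"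
    by (auto intro!: tendsto_scaleR)
  moreover have "\<forall>\<^sub>F h in at_right 0. ((F (\<delta> + h) - F \<delta>) /\<^sub>R h - (F (0 + h) - F 0) /\<^sub>R h) /\<^sub>R \<delta>
     = (G h (mean \<delta> x) - mean \<delta> x) /\<^sub>R h"
    using eventually_at_right_less[of 0]
  proof eventually_elim
    case (elim h)
    have m: "mean \<delta> x = F \<delta> /\<^sub>R \<delta>" by (simp add: mean_def F_def)
    have "F 0 = 0" by (simp add: F_def)
    then show ?case using elim
      by (simp add: m G_scale GF scaleR_diff_right algebra_simps)
  qed
  ultimately show ?thesis unfolding generator_def by (auto intro: Lim_transform_eventually)
qed

lemma mean_tendsto: "((\<lambda>\<delta>. mean \<delta> x) \<longlongrightarrow> x) (at_right 0)"
proof -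
  have "((\<lambda>s. integral {0..s} (\<lambda>r. G r x)) has_vector_derivative G 0 x) (at 0 within {0..1})"
    by (rule integral_has_vector_derivative) (auto intro: continuous_on_subset[OF G_orbit_cont])
  from right_derivativeI[OF this] show ?thesis by (simp add: mean_def)
qed

end


section \<open>Averages and the resolvent for contraction semigroups\<close>

context contraction_semigroup
begin

lemma mean_bound:
  assumes "\<delta> > 0"
  shows "norm (mean \<delta> x) \<le> norm x"
proof -
  have "norm (integral {0..\<delta>} (\<lambda>r. G r x)) \<le> norm x * (\<delta> - 0)"
    by (rule integral_bound) (use assms in \<open>auto intro: contraction continuous_on_subset[OF G_orbit_cont]\<close>)
  moreover have "norm (mean \<delta> x) = norm (integral {0..\<delta>} (\<lambda>r. G r x)) / \<delta>"
    using assms by (simp add: mean_def divide_inverse mult.commute)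
  ultimately show ?thesis using assms by (simp add: pos_divide_le_eq)
qed

lemma mean_bounded_linear: "\<delta> > 0 \<Longrightarrow> bounded_linear (mean \<delta>)"
  by (rule bounded_linear_intro[where K = 1]) (simp_all add: mean_add mean_scale mean_bound)

lemma mean_generator_commute:
  assumes \<delta>: "\<delta> > 0" and xy: "(x, y) \<in> generator G"
  shows "(mean \<delta> x, mean \<delta> y) \<in> generator G"
proof -
  have "((\<lambda>h. mean \<delta> ((G h x - x) /\<^sub>R h)) \<longlongrightarrow> mean \<delta> y) (at_right 0)"
    using xy by (intro bounded_linear.tendsto[OF mean_bounded_linear[OF \<delta>]]) (simp add: generator_def)
  moreover have "\<forall>\<^sub>F h in at_right 0. mean \<delta> ((G h x - x) /\<^sub>R h) = (G h (mean \<delta> x) - mean \<delta> x) /\<^sub>R h"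
    using eventually_at_right_less[of 0]
    by eventually_elim (simp add: mean_commute mean_scale linear_diff[OF mean_linear])
  ultimately show ?thesis unfolding generator_def by (auto intro: Lim_transform_eventually)
qed

text \<open>Averaging twice reaches the domain of the square of the generator, where the energy
  argument for the smoothing estimate takes place.\<close>

lemma mean_mean_tendsto: "((\<lambda>\<delta>. mean \<delta> (mean \<delta> x)) \<longlongrightarrow> x) (at_right 0)"
proof -
  have "((\<lambda>\<delta>. mean \<delta> x - x) \<longlongrightarrow> 0) (at_right 0)" using mean_tendsto by (simp add: LIM_zero_iff)
  then have 0: "((\<lambda>\<delta>. norm (mean \<delta> x - x)) \<longlongrightarrow> 0) (at_right 0)" by (rule tendsto_norm_zero)
  have "((\<lambda>\<delta>. mean \<delta> (mean \<delta> x - x)) \<longlongrightarrow> 0) (at_right 0)"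
    by (rule Lim_null_comparison[OF _ 0])
      (use eventually_at_right_less[of 0] in \<open>auto elim!: eventually_mono intro: mean_bound\<close>)
  from tendsto_add[OF this mean_tendsto[of x]] show ?thesis
    by (simp add: linear_diff[OF mean_linear])
qed

text \<open>Dissipativity in norm form: contractivity gives
  \<open>norm ((1 + h) *\<^sub>R y - G h y) \<ge> h * norm y\<close>, and dividing by
  \<open>h\<close> leads to the claim in the limit. It makes the resolvent at 1 single valued and
  contractive.\<close>

lemma generator_norm_le:
  assumes "(y, z) \<in> generator G"
  shows "norm y \<le> norm (y - z)"
proof (rule tendsto_lowerbound)
  show "((\<lambda>h. norm (y - (G h y - y) /\<^sub>R h)) \<longlongrightarrow> norm (y - z)) (at_right 0)"
    using assms by (intro tendsto_intros) (simp add: generator_def)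
  show "\<forall>\<^sub>F h in at_right 0. norm y \<le> norm (y - (G h y - y) /\<^sub>R h)"
    using eventually_at_right_less[of 0]
  proof eventually_elim
    case (elim h)
    have "(1 + h) * norm y - norm y \<le> norm ((1 + h) *\<^sub>R y) - norm (G h y)"
      using contraction[of h y] elim by simp
    also have "\<dots> \<le> norm ((1 + h) *\<^sub>R y - G h y)" by (rule norm_triangle_ineq2)
    also have "(1 + h) *\<^sub>R y - G h y = h *\<^sub>R (y - (G h y - y) /\<^sub>R h)"
      using elim by (simp add: algebra_simps)
    finally have "h * norm y \<le> norm (h *\<^sub>R (y - (G h y - y) /\<^sub>R h))"
      by (simp only: distrib_right mult_1 add_diff_cancel_left')
    then show ?case using elim by (simp only: norm_scaleR) simp
  qed
qed simp

lemma generator_diff: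
  assumes "(x, y) \<in> generator G" "(x', y') \<in> generator G"
  shows "(x - x', y - y') \<in> generator G"
proof -
  have "((\<lambda>h. (G h x - x) /\<^sub>R h - (G h x' - x') /\<^sub>R h) \<longlongrightarrow> y - y') (at_right 0)"
    using assms by (intro tendsto_diff) (auto simp: generator_def)
  moreover have "\<forall>\<^sub>F h in at_right 0. (G h x - x) /\<^sub>R h - (G h x' - x') /\<^sub>R h = (G h (x - x') - (x - x')) /\<^sub>R h"
    using eventually_at_right_less[of 0]
    by eventually_elim (simp add: G_diff algebra_simps)
  ultimately show ?thesis unfolding generator_def by (auto intro: Lim_transform_eventually)
qed

text \<open>
  With \<open>B = e\<^sup>-\<^sup>1 G(1)\<close> a strict contraction, the integral of \<open>e\<^sup>-\<^sup>r G(r)\<close> over \<open>[0,1]\<close> maps into the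
  domain and \<open>1 - A\<close> sends it to \<open>1 - B\<close>, so that no improper integral is needed.
\<close>

lemma one_minus_generator_surj: "\<exists>y. (y, y - x) \<in> generator G"
proof -
  define S where "S t x = exp (- t) *\<^sub>R G t x" for t x
  have "C0_semigroup S"
    unfolding C0_semigroup_def S_def
    by (auto intro!: bounded_linear_const_scaleR G_bounded_linear continuous_intros G_orbit_cont
        simp: G_add G_scale exp_add[symmetric] fun_eq_iff)
  then interpret S: c0_semigroup S by unfold_locales
  have "\<exists>!x'. x + S 1 x' = x'"
  proof (rule banach_fix_type[where c = "exp (- 1)"])
    have "dist (x + S 1 v) (x + S 1 w) \<le> exp (- 1) * dist v w" for v w
    proof -
    have "dist (x + S 1 v) (x + S 1 w) = exp (- 1) * norm (G 1 (v - w))"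
      by (simp add: dist_norm S_def G_diff flip: scaleR_diff_right)
    also have "\<dots> \<le> exp (- 1) * dist v w"
      using contraction[of 1 "v - w"] by (simp add: dist_norm)
    finally show "dist (x + S 1 v) (x + S 1 w) \<le> exp (- 1) * dist v w" .
    qed
    then show "\<forall>v w. dist (x + S 1 v) (x + S 1 w) \<le> exp (- 1) * dist v w" by blast
  qed auto
  then obtain x' where x': "x + S 1 x' = x'" by blast
  define y where "y = S.mean 1 x'"
  have "(y, S 1 x' - x') \<in> generator S"
    using S.mean_generator[of 1 x'] by (simp add: y_def)
  moreover have "S 1 x' - x' = - x" using x' by (simp add: algebra_simps)
  ultimately have "((\<lambda>h. (S h y - y) /\<^sub>R h) \<longlongrightarrow> - x) (at_right 0)" by (simp add: generator_def)
  moreover have "((\<lambda>h. (exp h - 1) / h :: real) \<longlongrightarrow> 1) (at_right 0)"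
  proof -
    have "(exp has_real_derivative 1) (at 0)" using DERIV_exp[of 0] by simp
    then have "((\<lambda>h. (exp h - 1) / h :: real) \<longlongrightarrow> 1) (at 0)" by (simp add: DERIV_def)
    then show ?thesis by (rule tendsto_mono[OF at_le, rotated]) simp
  qed
  \<comment> \<open>Product rule for \<open>G h y = exp h *\<^sub>R S h y\<close>: undoing the
    exponential weight adds \<open>y\<close> to the derivative \<open>- x\<close>.\<close>
  ultimately have "((\<lambda>h. exp h *\<^sub>R ((S h y - y) /\<^sub>R h) + ((exp h - 1) / h) *\<^sub>R y) \<longlongrightarrow> exp 0 *\<^sub>R (- x) + 1 *\<^sub>R y) (at_right 0)"
    by (intro tendsto_intros)
  moreover have "\<forall>\<^sub>F h in at_right 0. exp h *\<^sub>R ((S h y - y) /\<^sub>R h) + ((exp h - 1) / h) *\<^sub>R y = (G h y - y) /\<^sub>R h"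
    using eventually_at_right_less[of 0]
  proof eventually_elim
    case (elim h)
    have *: "exp h *\<^sub>R S h y = G h y" by (simp add: S_def exp_minus)
    have 1: "exp h *\<^sub>R ((S h y - y) /\<^sub>R h) = (G h y - exp h *\<^sub>R y) /\<^sub>R h"
      by (subst scaleR_left_commute) (simp only: scaleR_diff_right *)
    have 2: "((exp h - 1) / h) *\<^sub>R y = (exp h *\<^sub>R y - y) /\<^sub>R h"
      by (simp only: divide_inverse mult.commute[of _ "inverse h"] scaleR_scaleR[symmetric]
          scaleR_diff_left scaleR_one)
    show ?case unfolding 1 2 by (simp flip: scaleR_add_right)
  qed
  ultimately have "((\<lambda>h. (G h y - y) /\<^sub>R h) \<longlongrightarrow> exp 0 *\<^sub>R (- x) + 1 *\<^sub>R y) (at_right 0)"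
    by (rule Lim_transform_eventually)
  then have "(y, y - x) \<in> generator G" by (simp add: generator_def)
  then show ?thesis ..
qed

lemma resolvent_eqI:
  assumes "(y, y - x) \<in> generator G"
  shows "resolvent 1 (generator G) x = y"
  unfolding resolvent_def
proof (rule the_equality)
  show "\<exists>z. (y, z) \<in> generator G \<and> 1 *\<^sub>R y - z = x" using assms by (intro exI[of _ "y - x"]) simp
next
  fix y' assume "\<exists>z. (y', z) \<in> generator G \<and> 1 *\<^sub>R y' - z = x"
  then have "(y', y' - x) \<in> generator G" by (auto simp: algebra_simps)
  from generator_norm_le[OF generator_diff[OF this assms]] show "y' = y" by simp
qed

lemma resolvent_generator: "(resolvent 1 (generator G) x, resolvent 1 (generator G) x - x) \<in> generator G"
  using one_minus_generator_surj[of x] resolvent_eqI by metis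

lemma resolvent_bound: "norm (resolvent 1 (generator G) x) \<le> norm x"
  using generator_norm_le[OF resolvent_generator[of x]] by simp

lemma resolvent_commute:
  assumes "t \<ge> 0"
  shows "resolvent 1 (generator G) (G t x) = G t (resolvent 1 (generator G) x)"
  using generator_invariant[OF resolvent_generator assms] assms
  by (intro resolvent_eqI) (simp add: G_diff)

section \<open>The extrapolated semigroup\<close>

context
  fixes j :: "'a \<Rightarrow> 'b::banach" and G1 :: "real \<Rightarrow> 'b \<Rightarrow> 'b"
  assumes ex: "extrapolation G j G1"
begin

lemma extrapolation_bounded_linear: "bounded_linear j"
proof -
  have "linear j" "\<And>x. norm (j x) \<le> norm x"
    using ex resolvent_bound by (auto simp: extrapolation_def)
  then show ?thesis by (auto intro!: bounded_linear_intro[where K = 1] simp: linear_add linear_scale)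
qed

text \<open>If \<open>j x = 0\<close>, the resolvent of \<open>x\<close> vanishes and
  \<open>(0, - x)\<close> lies in the graph of the generator, which also contains
  \<open>(0, 0)\<close> and is single valued.\<close>

lemma extrapolation_inj: "inj j"
proof -
  have "x = 0" if "j x = 0" for x
  proof -
    have "norm (j x) = norm (resolvent 1 (generator G) x)" using ex by (simp add: extrapolation_def)
    then have "(0, - x) \<in> generator G" using resolvent_generator[of x] that by simp
    moreover have "(0, 0) \<in> generator G"
    proof -
      have "\<forall>\<^sub>F h in at_right 0. 0 = (G h 0 - 0) /\<^sub>R h"
        using eventually_at_right_less[of 0] by eventually_elim simp
      then show ?thesis unfolding generator_def by (auto intro: Lim_transform_eventually[OF tendsto_const])
    qed
    ultimately show "x = 0" using generator_unique by force
  qed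
  then show ?thesis using ex linear_injective_0 by (auto simp: extrapolation_def)
qed

lemma extrapolation_intertwine: "t \<ge> 0 \<Longrightarrow> G1 t (j x) = j (G t x)"
  using ex by (simp add: extrapolation_def)

text \<open>\<open>extrapolation\<close> demands only bounded operators that extend
  \<open>G\<close>; everything else follows by density of the range of \<open>j\<close>. On that
  range contractivity holds because the resolvent, which defines the norm there, commutes with
  \<open>G t\<close>.\<close>

lemma extrapolation_contraction_semigroup: "contraction_semigroup G1"
proof -
  have dense: "P y" if "closed {y. P y}" "\<And>x. P (j x)" for P y
  proof -
    have "closure (range j) \<subseteq> {y. P y}" using that by (intro closure_minimal) auto
    then show ?thesis using ex by (auto simp: extrapolation_def)
  qed
  have bl: "bounded_linear (G1 t)" if "t \<ge> 0" for t using ex that by (simp add: extrapolation_def)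
  have cont: "continuous_on UNIV (G1 t)" if "t \<ge> 0" for t
    using bl[OF that] by (rule linear_continuous_on)
  have contr: "norm (G1 t y) \<le> norm y" if t: "t \<ge> 0" for t y
  proof (rule dense[of "\<lambda>y. norm (G1 t y) \<le> norm y"])
    show "closed {y. norm (G1 t y) \<le> norm y}"
      using cont[OF t] by (intro closed_Collect_le continuous_intros)
    show "norm (G1 t (j x)) \<le> norm (j x)" for x
      using ex t by (simp add: extrapolation_def resolvent_commute contraction)
  qed
  have "G1 0 y = y" for y
    by (rule dense[of "\<lambda>y. G1 0 y = y"])
      (use cont[of 0] in \<open>auto intro!: closed_Collect_eq continuous_intros simp: extrapolation_intertwine\<close>)
  moreover have "G1 (t + r) y = G1 t (G1 r y)" if t: "t \<ge> 0" "r \<ge> 0" for t r y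
  proof (rule dense[of "\<lambda>y. G1 (t + r) y = G1 t (G1 r y)"])
    show "closed {y. G1 (t + r) y = G1 t (G1 r y)}"
      by (intro closed_Collect_eq cont continuous_on_compose2[OF cont cont]) (use t in auto)
  qed (use t in \<open>simp add: extrapolation_intertwine G_add\<close>)
  moreover have "continuous_on {0..} (\<lambda>t. G1 t y)" for y
  proof -
    have "y \<in> closure (range j)" using ex by (simp add: extrapolation_def)
    then obtain z where z: "\<And>n. z n \<in> range j" "z \<longlonglongrightarrow> y" by (auto simp: closure_sequential)
    then have "\<forall>n. \<exists>x. z n = j x" by auto
    then obtain x where "\<And>n. z n = j (x n)" by metis
    then have "z = (\<lambda>n. j (x n))" by auto
    then have x: "(\<lambda>n. j (x n)) \<longlonglongrightarrow> y" using z(2) by simp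
    show ?thesis
    \<comment> \<open>Contractivity makes the orbits of \<open>j (x n)\<close> converge to the orbit
      of \<open>y\<close> uniformly in time, so continuity is inherited.\<close>
    proof (rule uniform_limit_theorem[OF _ _ trivial_limit_sequentially])
      have "continuous_on {0..} (\<lambda>t. j (G t (x n)))" for n
        by (intro bounded_linear.continuous_on[OF extrapolation_bounded_linear] G_orbit_cont)
      then have "continuous_on {0..} (\<lambda>t. G1 t (j (x n)))" for n
        by (rule continuous_on_eq) (simp add: extrapolation_intertwine)
      then show "\<forall>\<^sub>F n in sequentially. continuous_on {0..} (\<lambda>t. G1 t (j (x n)))" by simp
      show "uniform_limit {0..} (\<lambda>n t. G1 t (j (x n))) (\<lambda>t. G1 t y) sequentially"
      proof (rule uniform_limitI)
        fix e :: real assume "e > 0"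
        with x have "\<forall>\<^sub>F n in sequentially. dist (j (x n)) y < e" by (rule tendstoD)
        then show "\<forall>\<^sub>F n in sequentially. \<forall>t\<in>{0..}. dist (G1 t (j (x n))) (G1 t y) < e"
        proof eventually_elim
          case (elim n)
          show ?case
          proof
            fix t :: real assume "t \<in> {0..}"
            then have "dist (G1 t (j (x n))) (G1 t y) = norm (G1 t (j (x n) - y))"
              using bl[of t] by (simp add: dist_norm bounded_linear.linear linear_diff)
            also have "\<dots> \<le> norm (j (x n) - y)" using \<open>t \<in> {0..}\<close> by (intro contr) simp
            finally show "dist (G1 t (j (x n))) (G1 t y) < e" using elim by (simp add: dist_norm)
          qed
        qed
      qed
    qed
  qed
  ultimately have "C0_semigroup G1" using bl by (auto simp: C0_semigroup_def fun_eq_iff)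
  then show ?thesis by unfold_locales (auto intro: contr)
qed

end

end

section \<open>Semigroups with symmetric dissipative generator\<close>

locale smoothing_semigroup = contraction_semigroup G for G :: "real \<Rightarrow> 'a::banach \<Rightarrow> 'a" +
  assumes smoothing: "r > 0 \<Longrightarrow> d \<ge> 0 \<Longrightarrow> norm (G (r + d) x - G r x) \<le> d / r * norm x"
begin

text \<open>Merges the trivial bound 2 with the smoothing bound \<open>h / a\<close>. For
  \<open>a < h\<close> the right-hand factor is at least \<open>3 * sqrt (1/2) \<ge> 2\<close>; for
  \<open>a \<ge> h\<close> it dominates \<open>h / a\<close>. The square root has an integrable
  singularity, and the \<open>h\<close> in the denominator keeps the bound finite at
  \<open>a = 0\<close>.\<close>

lemma smoothing_sqrt:
  assumes a: "a \<ge> 0" and d: "0 \<le> d" "d \<le> e" "e \<le> h" and h: "h > 0"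
  shows "norm (G (a + e) x - G (a + d) x) \<le> 3 * sqrt (h / (a + h)) * norm x"
proof (cases "a < h")
  case True
  have "sqrt (1/2) \<le> sqrt (h / (a + h))" using True a h by (simp add: field_simps)
  moreover have "2/3 \<le> sqrt (1/2::real)" by (rule real_le_rsqrt) (simp add: power2_eq_square)
  ultimately have 1: "2 \<le> 3 * sqrt (h / (a + h))" by linarith
  have "norm (G (a + e) x - G (a + d) x) \<le> norm (G (a + e) x) + norm (G (a + d) x)"
    by (rule norm_triangle_ineq4)
  also have "\<dots> \<le> norm x + norm x" using a d h by (intro add_mono contraction) auto
  also have "\<dots> = 2 * norm x" by simp
  also have "\<dots> \<le> 3 * sqrt (h / (a + h)) * norm x" by (intro mult_right_mono 1) simp
  finally show ?thesis .
next
  case False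
  then have a': "a \<ge> h" "a > 0" using h by auto
  have "norm (G (a + e) x - G (a + d) x) = norm (G ((a + d) + (e - d)) x - G (a + d) x)"
    by simp
  also have "\<dots> \<le> (e - d) / (a + d) * norm x" using a' d by (intro smoothing) auto
  also have "\<dots> \<le> (h / a) * norm x"
    using a' d h by (intro mult_right_mono frac_le) auto
  also have "h / a \<le> 3 * sqrt (h / (a + h))"
  proof -
    have "(h / a)^2 * (a + h) \<le> 9 * h"
    proof -
      have "h * (a + h) \<le> (a) * (a + a)" using a' h by (intro mult_mono) auto
      also have "\<dots> \<le> 9 * a^2" by (simp add: power2_eq_square)
      finally have "h * (h * (a + h)) \<le> h * (9 * a^2)" using h by (intro mult_left_mono) auto
      then show ?thesis using a' by (simp add: field_simps power2_eq_square)
    qed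
    then have "(h / a)^2 / 9 \<le> h / (a + h)" using a' h by (simp add: field_simps)
    then have "sqrt ((h / a)^2 / 9) \<le> sqrt (h / (a + h))" by (rule real_sqrt_le_mono)
    then show ?thesis using a' h by (simp add: real_sqrt_divide)
  qed
  finally show ?thesis by (simp add: mult_right_mono)
qed

end

text \<open>The squared norm of an orbit in the domain has derivative twice the inner product of its
  generator value with itself, hence does not increase; the averages carry the bound to all
  vectors.\<close>

lemma dissipative_imp_contraction:
  fixes G :: "real \<Rightarrow> 'a::{real_inner,banach} \<Rightarrow> 'a"
  assumes C0: "C0_semigroup G" and dis: "\<And>x y. (x, y) \<in> generator G \<Longrightarrow> y \<bullet> x \<le> 0"
  shows "contraction_semigroup G"
proof -
  interpret c0_semigroup G by unfold_locales (rule C0)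
  have D: "norm (G t x) \<le> norm x" if xy: "(x, y) \<in> generator G" and t: "t > 0" for x y t
  proof -
    have "G t x \<bullet> G t x \<le> G 0 x \<bullet> G 0 x"
    proof (rule DERIV_nonpos_imp_decreasing_open[OF less_imp_le[OF t]])
      show "continuous_on {0..t} (\<lambda>t. G t x \<bullet> G t x)"
        by (intro continuous_intros continuous_on_subset[OF G_orbit_cont]) auto
      fix s assume s: "0 < s" "s < t"
      have "((\<lambda>t. G t x \<bullet> G t x) has_vector_derivative G s x \<bullet> G s y + G s y \<bullet> G s x) (at s)"
        using orbit_derivative[OF xy s(1)] by (intro bounded_bilinear.has_vector_derivative[OF bounded_bilinear_inner])
      moreover have "G s y \<bullet> G s x \<le> 0" using generator_invariant[OF xy] s by (intro dis) auto
      ultimately show "\<exists>d. ((\<lambda>t. G t x \<bullet> G t x) has_real_derivative d) (at s) \<and> d \<le> 0"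
        by (auto simp: has_real_derivative_iff_has_vector_derivative inner_commute intro!: exI)
    qed
    then show ?thesis by (simp add: norm_le)
  qed
  show ?thesis
  proof
    fix t :: real and x assume "t \<ge> 0"
    have "((\<lambda>\<delta>. norm (G t (mean \<delta> x))) \<longlongrightarrow> norm (G t x)) (at_right 0)"
      using \<open>t \<ge> 0\<close> by (intro tendsto_norm bounded_linear.tendsto[OF G_bounded_linear] mean_tendsto)
    moreover have "((\<lambda>\<delta>. norm (mean \<delta> x)) \<longlongrightarrow> norm x) (at_right 0)"
      by (intro tendsto_norm mean_tendsto)
    moreover have "\<forall>\<^sub>F \<delta> in at_right 0. norm (G t (mean \<delta> x)) \<le> norm (mean \<delta> x)"
      using eventually_at_right_less[of 0]
      by eventually_elim (use D[OF mean_generator] \<open>t \<ge> 0\<close> in \<open>cases "t = 0"; force\<close>)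
    ultimately show "norm (G t x) \<le> norm x"
      by (intro tendsto_le[OF trivial_limit_at_right_real])
  qed
qed

text \<open>
  For \<open>x\<close> in the domain of \<open>A\<^sup>2\<close> and \<open>u(t) = G(t)x\<close>, the function
  \<open>\<parallel>u\<parallel>\<^sup>2 - 2t\<langle>Au,u\<rangle> + 2t\<^sup>2\<parallel>Au\<parallel>\<^sup>2\<close> has derivative \<open>4t\<^sup>2\<langle>A(Au),Au\<rangle> \<le> 0\<close>; hence \<open>\<parallel>AG(t)x\<parallel> \<le> \<parallel>x\<parallel>/t\<close>.
\<close>

lemma symmetric_dissipative_imp_smoothing:
  fixes G :: "real \<Rightarrow> 'a::{real_inner,banach} \<Rightarrow> 'a"
  assumes C0: "C0_semigroup G" and dis: "\<And>x y. (x, y) \<in> generator G \<Longrightarrow> y \<bullet> x \<le> 0"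
    and sym: "\<And>x y x' y'. (x, y) \<in> generator G \<Longrightarrow> (x', y') \<in> generator G \<Longrightarrow> y \<bullet> x' = x \<bullet> y'"
  shows "smoothing_semigroup G"
proof -
  interpret contraction_semigroup G by (rule dissipative_imp_contraction[OF C0 dis])
  have A_bound: "norm (G t y) \<le> norm x / t"
    if xy: "(x, y) \<in> generator G" and yz: "(y, z) \<in> generator G" and t: "t > 0" for x y z t
  proof -
    define E where "E t = G t x \<bullet> G t x - 2 * t * (G t y \<bullet> G t x) + 2 * t\<^sup>2 * (G t y \<bullet> G t y)" for t
    have "E t \<le> E 0"
    proof (rule DERIV_nonpos_imp_decreasing_open[OF less_imp_le[OF t]])
      show "continuous_on {0..t} E"
        unfolding E_def by (intro continuous_intros continuous_on_subset[OF G_orbit_cont]) auto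
      fix s assume s: "0 < s" "s < t"
      have inner: "((\<lambda>t. G t v \<bullet> G t w) has_real_derivative G s v \<bullet> G s w' + G s v' \<bullet> G s w) (at s)"
        if "(v, v') \<in> generator G" "(w, w') \<in> generator G" for v v' w w'
        unfolding has_real_derivative_iff_has_vector_derivative
        using orbit_derivative[OF that(1) s(1)] orbit_derivative[OF that(2) s(1)]
        by (intro bounded_bilinear.has_vector_derivative[OF bounded_bilinear_inner])
      have inv: "(G s x, G s y) \<in> generator G" "(G s y, G s z) \<in> generator G"
        using xy yz s by (auto intro: generator_invariant)
      \<comment> \<open>Symmetry is used here: in the derivative of \<open>E\<close> the terms
        \<open>- 2 * s * (G s z \<bullet> G s x)\<close>,
        \<open>- 2 * s * (G s y \<bullet> G s y)\<close> and
        \<open>4 * s * (G s y \<bullet> G s y)\<close> cancel, which fixes the weights in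
        \<open>E\<close>.\<close>
      have "G s z \<bullet> G s x = G s y \<bullet> G s y" by (rule sym[OF inv(2,1)])
      then have "(E has_real_derivative 4 * s\<^sup>2 * (G s z \<bullet> G s y)) (at s)"
        unfolding E_def
        by (auto intro!: derivative_eq_intros inner xy yz simp: inner_commute algebra_simps power2_eq_square)
      moreover have "4 * s\<^sup>2 * (G s z \<bullet> G s y) \<le> 0"
        using dis[OF inv(2)] by (intro mult_nonneg_nonpos) auto
      ultimately show "\<exists>d. (E has_real_derivative d) (at s) \<and> d \<le> 0" by blast
    qed
    moreover have E_eq: "E 0 = x \<bullet> x"
      "E t = G t x \<bullet> G t x - 2 * (t * (G t y \<bullet> G t x)) + 2 * t\<^sup>2 * (G t y \<bullet> G t y)"
      by (simp_all add: E_def)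
    moreover have "G t y \<bullet> G t x \<le> 0" using generator_invariant[OF xy] t by (intro dis) auto
    then have "t * (G t y \<bullet> G t x) \<le> 0" using t by (simp add: mult_nonneg_nonpos)
    ultimately have "2 * t\<^sup>2 * (G t y \<bullet> G t y) \<le> x \<bullet> x"
      using inner_ge_zero[of "G t x"] E_eq by linarith
    moreover have "0 \<le> t\<^sup>2 * (G t y \<bullet> G t y)" by simp
    ultimately have "t\<^sup>2 * (G t y \<bullet> G t y) \<le> x \<bullet> x" by linarith
    then have "t\<^sup>2 * (norm (G t y))\<^sup>2 \<le> (norm x)\<^sup>2" by (simp add: power2_norm_eq_inner)
    then have "t * norm (G t y) \<le> norm x"
      by (metis norm_ge_zero power2_le_imp_le power_mult_distrib)
    then show ?thesis using t by (simp add: field_simps)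
  qed
  have diff_bound: "norm (G (r + d) x - G r x) \<le> d / r * norm x"
    if xy: "(x, y) \<in> generator G" and yz: "(y, z) \<in> generator G" and r: "r > 0" "d > 0" for x y z r d
  proof -
    have "norm (G (r + d) x - G r x) \<le> (r + d) * (norm x / r) - r * (norm x / r)"
    proof (rule differentiable_bound_general)
      show "continuous_on {r..r + d} (\<lambda>t. G t x)"
        by (rule continuous_on_subset[OF G_orbit_cont]) (use r in auto)
      fix s assume s: "r < s" "s < r + d"
      then show "((\<lambda>t. G t x) has_vector_derivative G s y) (at s)"
        using r by (intro orbit_derivative[OF xy]) auto
      have "norm (G s y) \<le> norm x / s" using s r by (intro A_bound[OF xy yz]) auto
      also have "\<dots> \<le> norm x / r" using s r by (intro divide_left_mono) auto
      finally show "norm (G s y) \<le> norm x / r" .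
    qed (use r in \<open>auto intro!: continuous_intros derivative_eq_intros\<close>)
    also have "\<dots> = d / r * norm x" using r by (simp add: field_simps)
    finally show ?thesis .
  qed
  show ?thesis
  proof
    fix r d :: real and x assume r: "r > 0" "d \<ge> 0"
    show "norm (G (r + d) x - G r x) \<le> d / r * norm x"
    proof (cases "d = 0")
      case False
      then have d: "d > 0" using r by simp
      have "((\<lambda>\<delta>. norm (G (r + d) (mean \<delta> (mean \<delta> x)) - G r (mean \<delta> (mean \<delta> x))))
          \<longlongrightarrow> norm (G (r + d) x - G r x)) (at_right 0)"
        using r by (intro tendsto_intros bounded_linear.tendsto[OF G_bounded_linear] mean_mean_tendsto) auto
      moreover have "((\<lambda>\<delta>. d / r * norm (mean \<delta> (mean \<delta> x))) \<longlongrightarrow> d / r * norm x) (at_right 0)"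
        by (intro tendsto_intros mean_mean_tendsto)
      moreover have "\<forall>\<^sub>F \<delta> in at_right 0. norm (G (r + d) (mean \<delta> (mean \<delta> x)) - G r (mean \<delta> (mean \<delta> x)))
          \<le> d / r * norm (mean \<delta> (mean \<delta> x))"
        using eventually_at_right_less[of 0]
      proof eventually_elim
        case (elim \<delta>)
        have 1: "(mean \<delta> (mean \<delta> x), mean \<delta> ((G \<delta> x - x) /\<^sub>R \<delta>)) \<in> generator G"
          by (intro mean_generator_commute mean_generator elim)
        show ?case by (rule diff_bound[OF 1 mean_generator[OF elim] r(1) d])
      qed
      ultimately show ?thesis
        by (intro tendsto_le[OF trivial_limit_at_right_real])
    qed simp
  qed
qed

section \<open>The splitting error along a mild solution\<close>

text \<open>Each summand is at most twice an increment of the square root, so the sum telescopes.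
  Multiplied by the step size \<open>T / n\<close>, this makes the singularities at both end points
  contribute \<open>O(1 / sqrt n)\<close>.\<close>

lemma sum_inverse_sqrt_le: "(\<Sum>i<n. 1 / sqrt (real i + 1)) \<le> 2 * sqrt (real n)"
proof (induction n)
  case (Suc n)
  have "1 / sqrt (real n + 1) \<le> 2 * (sqrt (real n + 1) - sqrt (real n))"
  proof -
    have p: "sqrt (real n + 1) + sqrt (real n) > 0" by (simp add: add_pos_nonneg)
    have "(sqrt (real n + 1) - sqrt (real n)) * (sqrt (real n + 1) + sqrt (real n)) = 1"
      by (simp add: algebra_simps)
    then have e: "sqrt (real n + 1) - sqrt (real n) = 1 / (sqrt (real n + 1) + sqrt (real n))"
      using p by (simp add: field_simps)
    have "1 / sqrt (real n + 1) = 2 / (sqrt (real n + 1) + sqrt (real n + 1))" by simp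
    also have "\<dots> \<le> 2 / (sqrt (real n + 1) + sqrt (real n))"
      using p by (intro divide_left_mono) (auto intro!: mult_pos_pos add_pos_pos)
    finally show ?thesis by (simp add: e)
  qed
  with Suc show ?case by (simp add: algebra_simps)
qed simp

text \<open>The majorant \<open>R * (1 + c) ^ k\<close> satisfies the recursion with equality, by
  the geometric sum.\<close>

lemma discrete_gronwall:
  fixes d :: "nat \<Rightarrow> real"
  assumes d: "\<And>k. k \<le> n \<Longrightarrow> d k \<le> R + c * (\<Sum>i<k. d i)" and c: "c \<ge> 0" and k: "k \<le> n"
  shows "d k \<le> R * (1 + c) ^ k"
  using k
proof (induction k rule: less_induct)
  case (less k)
  have "R + c * (\<Sum>i<k. d i) \<le> R + c * (\<Sum>i<k. R * (1 + c) ^ i)"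
    using less c by (intro add_left_mono mult_left_mono sum_mono) auto
  also have "\<dots> = R * (1 + c * (\<Sum>i<k. (1 + c) ^ i))"
    by (simp add: sum_distrib_left[symmetric] algebra_simps)
  also have "1 + c * (\<Sum>i<k. (1 + c) ^ i) = (1 + c) ^ k"
    by (induction k) (auto simp: algebra_simps)
  finally show ?case using d[of k] less.prems by linarith
qed

text \<open>The equation enters only through \<open>deriv\<close>, the variation of constants
  formula in differentiated form, which does not ask \<open>u r\<close> to lie in the domain of the
  generator. All error bounds will be linear in \<open>C\<close>.\<close>

locale mild_solution = smoothing_semigroup G for G :: "real \<Rightarrow> 'a::banach \<Rightarrow> 'a" +
  fixes u :: "real \<Rightarrow> 'a" and L :: "real \<Rightarrow> 'a \<Rightarrow> 'a" and M C T :: real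
  assumes M: "M \<ge> 0" and T: "T \<ge> 0"
    and u_cont: "continuous_on {0..T} u"
    and u_bound: "0 \<le> r \<Longrightarrow> r \<le> T \<Longrightarrow> norm (u r) \<le> C"
    and L_linear: "linear (L r)"
    and L_bound: "norm (L r x) \<le> M * norm x"
    and deriv: "0 < r \<Longrightarrow> r < t \<Longrightarrow> t \<le> T \<Longrightarrow>
      ((\<lambda>r. G (t - r) (u r)) has_vector_derivative G (t - r) (L r (u r))) (at r)"
begin

lemma C: "C \<ge> 0"
  using u_bound[of 0] T norm_ge_zero order_trans by blast

lemma mean_value:
  assumes ab: "0 \<le> a" "a \<le> b" "b \<le> t" "t \<le> T" and P: "bounded_linear P"
    and bnd: "\<And>q. a < q \<Longrightarrow> q < b \<Longrightarrow> norm (P (G (t - q) (L q (u q))) - z) \<le> \<phi>' q"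
    and cont: "continuous_on {a..b} \<phi>"
    and \<phi>: "\<And>q. a < q \<Longrightarrow> q < b \<Longrightarrow> (\<phi> has_vector_derivative \<phi>' q) (at q)"
  shows "norm (P (G (t - b) (u b)) - P (G (t - a) (u a)) - (b - a) *\<^sub>R z) \<le> \<phi> b - \<phi> a"
proof (cases "a = b")
  case False
  let ?f = "\<lambda>q. P (G (t - q) (u q)) - q *\<^sub>R z"
  have "norm (?f b - ?f a) \<le> \<phi> b - \<phi> a"
  proof (rule differentiable_bound_general[where f' = "\<lambda>q. P (G (t - q) (L q (u q))) - z" and \<phi>' = \<phi>'])
    show "a < b" using ab False by simp
    show "continuous_on {a..b} ?f"
      by (intro continuous_intros bounded_linear.continuous_on[OF P] G_continuous_on
          continuous_on_subset[OF u_cont]) (use ab in auto)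
    fix q assume q: "a < q" "q < b"
    show "(?f has_vector_derivative P (G (t - q) (L q (u q))) - z) (at q)"
      using bounded_linear.has_vector_derivative[OF P deriv[of q t]] q ab
      by (auto intro!: derivative_eq_intros)
  qed (use \<phi> bnd cont in auto)
  then show ?thesis by (simp add: algebra_simps)
qed simp

text \<open>The reference value is \<open>G h (u (i * h))\<close> at every \<open>r\<close> of the
  interval, because the scheme applies the full heat step before the multiplication. The three
  errors are: the perturbation acting after \<open>i * h\<close>; the replacement of
  \<open>G (r - i * h)\<close> by \<open>G h\<close> on what the perturbation contributed earlier;
  and the same replacement on the freely evolved initial value.\<close>

lemma one_step:
  assumes h: "h > 0" and i: "(real i + 1) * h \<le> T" and r: "real i * h \<le> r" "r \<le> (real i + 1) * h"
  shows "norm (u r - G h (u (real i * h))) \<le> C * (h * M + 6 * M * sqrt (h * T) + 3 / sqrt (real i + 1))"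
proof -
  let ?a = "real i * h" let ?d = "r - ?a"
  have a0: "?a \<ge> 0" using h by simp
  have aT: "?a \<le> T" and dh: "0 \<le> ?d" "?d \<le> h" using r i h by (auto simp: algebra_simps)
  have rT: "r \<le> T" using r i by simp
  have MC: "norm (G (t - q) (L q (u q))) \<le> M * C" if "0 < q" "q < t" "t \<le> T" for q t
  proof -
    have "norm (G (t - q) (L q (u q))) \<le> norm (L q (u q))" using that by (intro contraction) auto
    also have "\<dots> \<le> M * norm (u q)" by (rule L_bound)
    also have "\<dots> \<le> M * C" using that by (intro mult_left_mono u_bound M) auto
    finally show ?thesis .
  qed
  have "norm (id (G (r - r) (u r)) - id (G (r - ?a) (u ?a)) - (r - ?a) *\<^sub>R 0) \<le> M * C * r - M * C * ?a"
    by (rule mean_value[where \<phi>' = "\<lambda>_. M * C"])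
      (use a0 r rT MC in \<open>auto intro!: continuous_intros derivative_eq_intros
         bounded_linear_ident simp: id_def simp del: G_zero\<close>)
  then have 1: "norm (u r - G ?d (u ?a)) \<le> M * C * ?d" by (simp add: algebra_simps)
  also have "\<dots> \<le> M * C * h" using dh M C by (intro mult_left_mono) auto
  finally have 1: "norm (u r - G ?d (u ?a)) \<le> C * (h * M)" by (simp add: algebra_simps)
  define P where "P x = G ?d x - G h x" for x
  have P: "bounded_linear P" unfolding P_def using dh h by (intro bounded_linear_sub G_bounded_linear) auto
  have PG: "norm (P (G b x)) \<le> 3 * sqrt (h / (b + h)) * norm x" if "b \<ge> 0" for b x
    using smoothing_sqrt[of b ?d h h x] that dh h
    by (simp add: P_def G_add[symmetric] add.commute norm_minus_commute)
  \<comment> \<open>The majorant is an antiderivative of the smoothing bound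
    \<open>3 * M * C * sqrt (h / (?a - q + h))\<close>, which explains the constant 6; its value is
    controlled by \<open>?a + h = (i + 1) * h \<le> T\<close>.\<close>
  have "norm (P (G (?a - ?a) (u ?a)) - P (G (?a - 0) (u 0)) - (?a - 0) *\<^sub>R 0)
     \<le> - (6 * M * C * sqrt h * sqrt (?a + h - ?a)) - (- (6 * M * C * sqrt h * sqrt (?a + h - 0)))"
  proof (rule mean_value[where \<phi>' = "\<lambda>q. M * C * (3 * sqrt (h / (?a - q + h)))" and
        \<phi> = "\<lambda>q. - (6 * M * C * sqrt h * sqrt (?a + h - q))", OF _ _ _ _ P])
    fix q assume q: "0 < q" "q < ?a"
    have "norm (P (G (?a - q) (L q (u q)))) \<le> 3 * sqrt (h / (?a - q + h)) * norm (L q (u q))"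
      using q by (intro PG) auto
    also have "norm (L q (u q)) \<le> M * norm (u q)" by (rule L_bound)
    also have "norm (u q) \<le> C" using q aT by (intro u_bound) auto
    finally show "norm (P (G (?a - q) (L q (u q))) - 0) \<le> M * C * (3 * sqrt (h / (?a - q + h)))"
      using h q M by (simp add: mult_left_mono mult_right_mono algebra_simps)
    have pos: "?a + h - q > 0" using q h by simp
    have "((\<lambda>q. - (6 * M * C * sqrt h * sqrt (?a + h - q))) has_real_derivative
       6 * M * C * sqrt h * (inverse (sqrt (?a + h - q)) / 2)) (at q)"
    proof -
      have "((\<lambda>q. ?a + h - q) has_real_derivative -1) (at q)"
        by (auto intro!: derivative_eq_intros)
      from DERIV_cmult[OF DERIV_chain2[OF DERIV_real_sqrt[OF pos] this], of "- (6 * M * C * sqrt h)"]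
      show ?thesis by simp
    qed
    also have "6 * M * C * sqrt h * (inverse (sqrt (?a + h - q)) / 2) = M * C * (3 * sqrt (h / (?a - q + h)))"
      using pos by (simp add: real_sqrt_divide field_simps add.commute)
    finally show "((\<lambda>q. - (6 * M * C * sqrt h * sqrt (?a + h - q))) has_vector_derivative
       M * C * (3 * sqrt (h / (?a - q + h)))) (at q)"
      by (simp add: has_real_derivative_iff_has_vector_derivative)
  qed (use a0 aT in \<open>auto intro!: continuous_intros\<close>)
  also have "\<dots> \<le> 6 * M * C * (sqrt h * sqrt (?a + h))" using M C h by simp
  also have "\<dots> \<le> 6 * M * C * sqrt (h * T)"
    unfolding real_sqrt_mult[symmetric] using i h M C
    by (intro real_sqrt_le_mono mult_left_mono) (auto simp: algebra_simps)
  finally have 2: "norm (P (u ?a) - P (G ?a (u 0))) \<le> C * (6 * M * sqrt (h * T))"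
    by (simp add: algebra_simps)
  have "norm (P (G ?a (u 0))) \<le> 3 * sqrt (h / (?a + h)) * norm (u 0)" using a0 by (rule PG)
  also have "h / (?a + h) = 1 / (real i + 1)"
  proof -
    have "?a + h = (real i + 1) * h" by (simp add: algebra_simps)
    then show ?thesis using h by (metis mult_zero_right nonzero_divide_mult_cancel_right less_irrefl)
  qed
  also have "norm (u 0) \<le> C" using T by (intro u_bound) auto
  finally have 3: "norm (P (G ?a (u 0))) \<le> C * (3 / sqrt (real i + 1))"
    by (simp add: real_sqrt_divide mult_left_mono divide_right_mono algebra_simps)
  have "u r - G h (u ?a) = (u r - G ?d (u ?a)) + (P (u ?a) - P (G ?a (u 0))) + P (G ?a (u 0))"
    by (simp add: P_def)
  also have "norm \<dots> \<le> C * (h * M) + C * (6 * M * sqrt (h * T)) + C * (3 / sqrt (real i + 1))"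
    by (intro norm_triangle_le add_mono 1 2 3)
  finally show ?thesis by (simp add: algebra_simps)
qed


text \<open>Over one interval the integrand \<open>G (k * h - q) (L q (u q))\<close> is frozen to
  \<open>G b (L \<tau> (G h (u (i * h))))\<close>, where \<open>b\<close> is the time left after the
  interval. Moving the heat operator costs the singularity at the final time \<open>k * h\<close>,
  freezing the coefficient costs \<open>w\<close>, and replacing \<open>u q\<close> costs
  \<open>one_step\<close>, with its singularity at time 0.\<close>

lemma step_increment:
  assumes h: "h > 0" and kT: "real k * h \<le> T" and i: "i < k" and w0: "w \<ge> 0"
    and w: "\<And>r x. real i * h \<le> r \<Longrightarrow> r \<le> (real i + 1) * h \<Longrightarrow> norm (L r x - L \<tau> x) \<le> w * norm x"
  shows "norm (G (real (k - Suc i) * h) (u (real (Suc i) * h)) - G (real (k - i) * h) (u (real i * h))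
      - h *\<^sub>R G (real (k - Suc i) * h) (L \<tau> (G h (u (real i * h)))))
    \<le> h * (C * (3 * M / sqrt (real (k - Suc i) + 1) + w
        + M * (h * M + 6 * M * sqrt (h * T) + 3 / sqrt (real i + 1))))"
proof -
  define b where "b = real (k - Suc i) * h"
  have b0: "b \<ge> 0" using h by (simp add: b_def)
  have kh: "real k * h = (real i + 1) * h + b"
    using i by (simp add: b_def of_nat_diff algebra_simps)
  have iT: "(real i + 1) * h \<le> T" using kh b0 kT by linarith
  define e where "e = C * (3 * M / sqrt (real (k - Suc i) + 1) + w
        + M * (h * M + 6 * M * sqrt (h * T) + 3 / sqrt (real i + 1)))"
  let ?u = "u (real i * h)"
  let ?z = "G b (L \<tau> (G h ?u))"
  have "norm (id (G (real k * h - (real i + 1) * h) (u ((real i + 1) * h)))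
      - id (G (real k * h - real i * h) (u (real i * h)))
      - ((real i + 1) * h - real i * h) *\<^sub>R ?z) \<le> (real i + 1) * h * e - real i * h * e"
  proof (rule mean_value[where \<phi>' = "\<lambda>_. e" and \<phi> = "\<lambda>q. q * e"])
    fix q assume q: "real i * h < q" "q < (real i + 1) * h"
    have q0: "0 \<le> q" "q \<le> T" using q h iT by (auto intro: order_trans[rotated] less_imp_le)
    define d where "d = (real i + 1) * h - q"
    have d: "0 \<le> d" "d \<le> h" using q by (auto simp: d_def algebra_simps)
    have kq: "real k * h - q = b + d" using kh by (simp add: d_def)
    have uC: "norm (u q) \<le> C" by (rule u_bound[OF q0])
    have LC: "norm (L q (u q)) \<le> M * C"
      using L_bound[of q "u q"] mult_left_mono[OF uC M] by linarith
    have sq: "sqrt (h / (b + h)) = 1 / sqrt (real (k - Suc i) + 1)"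
    proof -
      have "b + h = (real (k - Suc i) + 1) * h" by (simp add: b_def algebra_simps)
      then have "h / (b + h) = 1 / (real (k - Suc i) + 1)"
        using h by (metis mult_zero_right nonzero_divide_mult_cancel_right less_irrefl)
      then show ?thesis by (simp add: real_sqrt_divide)
    qed
    have 1: "norm (G (b + d) (L q (u q)) - G b (L q (u q))) \<le> C * (3 * M / sqrt (real (k - Suc i) + 1))"
    proof -
      have "norm (G (b + d) (L q (u q)) - G b (L q (u q))) \<le> 3 * sqrt (h / (b + h)) * norm (L q (u q))"
        using smoothing_sqrt[of b 0 d h] b0 d h by simp
      also have "\<dots> \<le> 3 * sqrt (h / (b + h)) * (M * C)"
        using LC h b0 by (intro mult_left_mono) auto
      finally show ?thesis by (simp add: sq algebra_simps)
    qed
    have 2: "norm (G b (L q (u q) - L \<tau> (u q))) \<le> C * w"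
    proof -
      have "norm (G b (L q (u q) - L \<tau> (u q))) \<le> norm (L q (u q) - L \<tau> (u q))"
        using b0 by (rule contraction)
      also have "\<dots> \<le> w * norm (u q)" using q by (intro w) auto
      also have "\<dots> \<le> w * C" using w0 uC by (rule mult_left_mono[rotated])
      also have "\<dots> = C * w" by simp
      finally show ?thesis .
    qed
    have 3: "norm (G b (L \<tau> (u q - G h ?u))) \<le> C * (M * (h * M + 6 * M * sqrt (h * T) + 3 / sqrt (real i + 1)))"
    proof -
      have "norm (G b (L \<tau> (u q - G h ?u))) \<le> norm (L \<tau> (u q - G h ?u))"
        using b0 by (rule contraction)
      also have "\<dots> \<le> M * norm (u q - G h ?u)" by (rule L_bound)
      also have "\<dots> \<le> M * (C * (h * M + 6 * M * sqrt (h * T) + 3 / sqrt (real i + 1)))"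
        by (intro mult_left_mono one_step M h iT) (use q in auto)
      finally show ?thesis by (simp add: algebra_simps)
    qed
    have "id (G (real k * h - q) (L q (u q))) - ?z = (G (b + d) (L q (u q)) - G b (L q (u q)))
       + G b (L q (u q) - L \<tau> (u q)) + G b (L \<tau> (u q - G h ?u))"
      using b0 by (simp add: kq G_diff linear_diff[OF L_linear])
    also have "norm \<dots> \<le> C * (3 * M / sqrt (real (k - Suc i) + 1)) + C * w
       + C * (M * (h * M + 6 * M * sqrt (h * T) + 3 / sqrt (real i + 1)))"
      by (intro norm_triangle_le add_mono 1 2 3)
    also have "\<dots> = e" by (simp add: e_def algebra_simps)
    finally show "norm (id (G (real k * h - q) (L q (u q))) - ?z) \<le> e" .
  qed (use h kh b0 kT in \<open>auto intro!: continuous_intros derivative_eq_intros bounded_linear_ident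
         simp: id_def\<close>)
  moreover have "real k * h - (real i + 1) * h = b" "real k * h - real i * h = real (k - i) * h"
    using kh i by (auto simp: of_nat_diff algebra_simps)
  moreover have "(real i + 1) * h * e - real i * h * e = h * e" "(real i + 1) * h - real i * h = h"
    "real (Suc i) * h = (real i + 1) * h"
    by (simp_all add: algebra_simps)
  ultimately show ?thesis unfolding b_def[symmetric] e_def[symmetric] by (simp add: add.commute)
qed

text \<open>Consistency plus stability. In \<open>R\<close>, \<open>T * w\<close> comes from the
  oscillation of \<open>L\<close>, the next term from the regular part of \<open>one_step\<close>,
  \<open>12 * M * (h * sqrt n)\<close> from the two end point singularities (each
  \<open>3 * M\<close> times at most \<open>2 * sqrt n\<close>), and the last from the second-order
  remainder of the factors \<open>E i\<close>. The exponential is the Gronwall factor.\<close>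

theorem product_estimate:
  fixes E :: "nat \<Rightarrow> 'a \<Rightarrow> 'a" and \<tau> :: "nat \<Rightarrow> real" and n :: nat and w :: real
  defines "h \<equiv> T / real n"
  defines "K \<equiv> exp (T * M)"
  defines "R \<equiv> T * w + M\<^sup>2 * T * (h + 6 * sqrt (h * T)) + 12 * M * (h * sqrt (real n)) + T * h * M\<^sup>2 * K"
  assumes n: "n > 0" and w0: "w \<ge> 0"
    and E_linear: "\<And>i. i < n \<Longrightarrow> linear (E i)"
    and E: "\<And>i x. i < n \<Longrightarrow> norm (E i x - x - h *\<^sub>R L (\<tau> i) x) \<le> (h * M)\<^sup>2 * exp (h * M) * norm x"
    and w: "\<And>i r x. i < n \<Longrightarrow> real i * h \<le> r \<Longrightarrow> r \<le> (real i + 1) * h \<Longrightarrow>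
        norm (L r x - L (\<tau> i) x) \<le> w * norm x"
  shows "norm (u T - time_ordered_prod (\<lambda>i x. E i (G h x)) n (u 0))
      \<le> C * R * exp (T * (M + T * M\<^sup>2 * K))"
proof (cases "T = 0")
  case True
  \<comment> \<open>With step size zero, the hypothesis \<open>E\<close> forces every factor to be
    the identity.\<close>
  have "time_ordered_prod (\<lambda>i x. E i (G h x)) k (u 0) = u 0" if "k \<le> n" for k
    using that E True by (induction k) (auto simp: h_def)
  then have "u T = time_ordered_prod (\<lambda>i x. E i (G h x)) n (u 0)" using True by simp
  moreover have "h = 0" using True by (simp add: h_def)
  ultimately show ?thesis using True C by (simp add: R_def)
next
  case False
  then have h: "h > 0" and Tpos: "T > 0" using T n by (auto simp: h_def)
  have hn: "real n * h = T" using n by (simp add: h_def)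
  have hT: "h \<le> T" using n T by (simp add: h_def divide_le_eq mult_le_cancel_left1)
  have K: "exp (h * M) \<le> K" "K > 0" using hT M by (auto simp: K_def mult_right_mono)
  define a where "a k = time_ordered_prod (\<lambda>i x. E i (G h x)) k (u 0)" for k
  define v where "v k = u (real k * h)" for k
  define M' where "M' = M + T * M\<^sup>2 * K"
  have M': "M' \<ge> 0" using M T K by (simp add: M'_def)
  have E1: "norm (E i x - x - h *\<^sub>R L (\<tau> i) x) \<le> h * (h * M\<^sup>2 * K) * norm x" if "i < n" for i x
  proof -
    have "(h * M)\<^sup>2 * exp (h * M) * norm x \<le> (h * M)\<^sup>2 * K * norm x"
      using K by (intro mult_right_mono mult_left_mono) auto
    then show ?thesis using E[OF that, of x] by (simp add: power2_eq_square mult_ac)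
  qed
  have E2: "norm (E i x - x) \<le> h * M' * norm x" if "i < n" for i x
  proof -
    have "norm (E i x - x) \<le> norm (E i x - x - h *\<^sub>R L (\<tau> i) x) + norm (h *\<^sub>R L (\<tau> i) x)"
      using norm_triangle_ineq[of "E i x - x - h *\<^sub>R L (\<tau> i) x" "h *\<^sub>R L (\<tau> i) x"] by simp
    also have "\<dots> \<le> h * (h * M\<^sup>2 * K) * norm x + h * (M * norm x)"
      using E1[OF that] L_bound[of "\<tau> i" x] h by (intro add_mono) auto
    also have "h * (h * M\<^sup>2 * K) * norm x \<le> h * (T * M\<^sup>2 * K) * norm x"
      using hT h K by (intro mult_right_mono mult_left_mono) auto
    finally show ?thesis by (simp add: M'_def algebra_simps)
  qed
  have jh: "real j * h \<ge> 0" for j using h by simp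
  define \<epsilon> where "\<epsilon> k i = h * (C * (3 * M / sqrt (real (k - Suc i) + 1) + w
        + M * (h * M + 6 * M * sqrt (h * T) + 3 / sqrt (real i + 1))))" for k i
  have \<epsilon>_sum: "(\<Sum>i<k. \<epsilon> k i + h * (h * M\<^sup>2 * K) * C) \<le> C * R" if k: "k \<le> n" for k
  proof -
    have kn: "real k \<le> real n" using k by simp
    \<comment> \<open>Reversing the order of summation turns the singularity at the final time into
      the one at the initial time.\<close>
    have "(\<Sum>i<k. 1 / sqrt (real (k - Suc i) + 1)) = (\<Sum>i<k. 1 / sqrt (real i + 1))"
      by (rule sum.nat_diff_reindex)
    then have s1: "(\<Sum>i<k. 1 / sqrt (real (k - Suc i) + 1)) \<le> 2 * sqrt (real n)"
      using sum_inverse_sqrt_le[of k] kn real_sqrt_le_mono[of "real k" "real n"] by linarith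
    have s2: "(\<Sum>i<k. 1 / sqrt (real i + 1)) \<le> 2 * sqrt (real n)"
      using sum_inverse_sqrt_le[of k] kn real_sqrt_le_mono[of "real k" "real n"] by linarith
    define B where "B = w + M * (h * M + 6 * M * sqrt (h * T)) + h * M\<^sup>2 * K"
    have B: "B \<ge> 0" using w0 M h T K by (simp add: B_def)
    have "(\<Sum>i<k. \<epsilon> k i + h * (h * M\<^sup>2 * K) * C)
       = (\<Sum>i<k. C * (h * (3 * M)) * (1 / sqrt (real (k - Suc i) + 1)) + C * h * B
           + C * (h * (3 * M)) * (1 / sqrt (real i + 1)))"
      by (intro sum.cong refl) (simp add: \<epsilon>_def B_def algebra_simps)
    also have "\<dots> = C * (h * (3 * M)) * (\<Sum>i<k. 1 / sqrt (real (k - Suc i) + 1)) + real k * (C * h * B)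
           + C * (h * (3 * M)) * (\<Sum>i<k. 1 / sqrt (real i + 1))"
      by (simp add: sum.distrib sum_distrib_left)
    also have "\<dots> \<le> C * (h * (3 * M)) * (2 * sqrt (real n)) + real n * (C * h * B)
           + C * (h * (3 * M)) * (2 * sqrt (real n))"
      using s1 s2 kn C h M B by (intro add_mono mult_left_mono mult_right_mono) auto
    also have "\<dots> = C * ((real n * h) * B + 12 * M * (h * sqrt (real n)))"
      by (simp add: algebra_simps)
    also have "\<dots> = C * R" unfolding hn B_def R_def by (simp add: algebra_simps power2_eq_square)
    finally show ?thesis .
  qed
  have main: "norm (v k - a k) \<le> C * R + h * M' * (\<Sum>i<k. norm (v i - a i))" if k: "k \<le> n" for k
  proof -
    \<comment> \<open>The error after \<open>i\<close> steps is carried to step \<open>k\<close> by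
      the free heat flow. Then \<open>g k\<close> is the error sought, \<open>g 0 = 0\<close>, and
      the differences are the local errors.\<close>
    define g where "g i = G (real (k - i) * h) (v i - a i)" for i
    have kT: "real k * h \<le> T" unfolding hn[symmetric] using k h by simp
    have incr: "norm (g (Suc i) - g i) \<le> (\<epsilon> k i + h * (h * M\<^sup>2 * K) * C) + h * M' * norm (v i - a i)"
      if i: "i < k" for i
    proof -
      let ?G = "G (real (k - Suc i) * h)"
      have i': "i < n" using i k by simp
      have b: "real (k - Suc i) * h \<ge> 0" by (rule jh)
      have split: "G (real (k - i) * h) x = ?G (G h x)" for x
      proof -
        have *: "real (k - i) * h = real (k - Suc i) * h + h" using i by (simp add: of_nat_diff algebra_simps)
        show ?thesis unfolding * using b h by (intro G_add) auto
      qed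
      have aS: "a (Suc i) = E i (G h (a i))" by (simp add: a_def)
      have vC: "norm (G h (v i)) \<le> C"
      proof -
        have "real i * h \<le> real k * h" using i h by simp
        then have "norm (v i) \<le> C" unfolding v_def using kT jh by (intro u_bound) auto
        then show ?thesis using contraction[of h "v i"] h by simp
      qed
      have 1: "norm (?G (v (Suc i)) - G (real (k - i) * h) (v i) - h *\<^sub>R ?G (L (\<tau> i) (G h (v i)))) \<le> \<epsilon> k i"
        unfolding v_def \<epsilon>_def by (rule step_increment[OF h kT i w0 w[OF i']])
      have 2: "norm (?G (E i (G h (v i)) - G h (v i) - h *\<^sub>R L (\<tau> i) (G h (v i)))) \<le> h * (h * M\<^sup>2 * K) * C"
      proof -
        have "norm (?G (E i (G h (v i)) - G h (v i) - h *\<^sub>R L (\<tau> i) (G h (v i))))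
          \<le> h * (h * M\<^sup>2 * K) * norm (G h (v i))"
          using contraction[OF b] E1[OF i'] by (rule order_trans)
        also have "\<dots> \<le> h * (h * M\<^sup>2 * K) * C" using vC h K by (intro mult_left_mono) auto
        finally show ?thesis .
      qed
      have 3: "norm (?G (E i (G h (v i - a i)) - G h (v i - a i))) \<le> h * M' * norm (v i - a i)"
      proof -
        have "norm (?G (E i (G h (v i - a i)) - G h (v i - a i))) \<le> h * M' * norm (G h (v i - a i))"
          using contraction[OF b] E2[OF i'] by (rule order_trans)
        also have "\<dots> \<le> h * M' * norm (v i - a i)"
          using h M' by (intro mult_left_mono contraction) auto
        finally show ?thesis .
      qed
      \<comment> \<open>The first two terms are the local error of the Riemann sum and the remainder
        of \<open>E i\<close> along the solution. In the third, only \<open>E i\<close> minus the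
        identity acts on the old error, which supplies the factor \<open>h\<close> for
        Gronwall.\<close>
      have "g (Suc i) - g i = (?G (v (Suc i)) - G (real (k - i) * h) (v i) - h *\<^sub>R ?G (L (\<tau> i) (G h (v i))))
         - ?G (E i (G h (v i)) - G h (v i) - h *\<^sub>R L (\<tau> i) (G h (v i)))
         + ?G (E i (G h (v i - a i)) - G h (v i - a i))"
        using b h E_linear[OF i']
        by (simp add: g_def aS split G_diff G_scale linear_diff)
      also have "norm \<dots> \<le> (\<epsilon> k i + h * (h * M\<^sup>2 * K) * C) + h * M' * norm (v i - a i)"
        by (intro norm_triangle_le add_mono order_trans[OF norm_triangle_ineq4] 1 2 3)
      finally show ?thesis .
    qed
    have "v k - a k = g k - g 0" using jh[of k] by (simp add: g_def v_def a_def)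
    also have "\<dots> = (\<Sum>i<k. g (Suc i) - g i)" by (rule sum_lessThan_telescope[symmetric])
    also have "norm \<dots> \<le> (\<Sum>i<k. (\<epsilon> k i + h * (h * M\<^sup>2 * K) * C) + h * M' * norm (v i - a i))"
      by (intro sum_norm_le incr) auto
    also have "\<dots> \<le> C * R + h * M' * (\<Sum>i<k. norm (v i - a i))"
      using \<epsilon>_sum[OF k] by (simp add: sum.distrib sum_distrib_left)
    finally show ?thesis .
  qed
  have "norm (v n - a n) \<le> C * R * (1 + h * M') ^ n"
    by (rule discrete_gronwall[where n = n]) (use main h M' in auto)
  also have "\<dots> \<le> C * R * exp (T * M')"
  proof (rule mult_left_mono)
    have "(1 + h * M') ^ n \<le> exp (h * M') ^ n"
      using h M' by (intro power_mono) auto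
    also have "\<dots> = exp (T * M')" by (simp add: exp_of_nat_mult[symmetric] hn[symmetric] mult_ac)
    finally show "(1 + h * M') ^ n \<le> exp (T * M')" .
    show "0 \<le> C * R" using \<epsilon>_sum[of 0] by simp
  qed
  finally show ?thesis by (simp add: v_def a_def hn M'_def)
qed

end

section \<open>$L^2$ as a Hilbert space\<close>

lemma l2_rel_rep: "l2_rel (rep_l2 u) (rep_l2 u)"
  using Quotient_l2 by (rule Quotient_rep_reflp)

lemma abs_rep_l2: "abs_l2 (rep_l2 u) = u"
  using Quotient_l2 by (rule Quotient_abs_rep)

lemma rep_l2_measurable [measurable]: "rep_l2 u \<in> borel_measurable lborel"
  and rep_l2_square_integrable: "integrable lborel (\<lambda>x. (cmod (rep_l2 u x))\<^sup>2)"
  using l2_rel_rep[of u] by (auto simp: l2_rel_def)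

lemma rep_abs_l2:
  assumes "l2_rel f f"
  shows "AE x in lborel. rep_l2 (abs_l2 f) x = f x"
proof -
  have "l2_rel (rep_l2 (abs_l2 f)) f"
    using rep_abs_rsp_left[OF Quotient3_l2] assms by blast
  then show ?thesis by (simp add: l2_rel_def)
qed

lemma l2_relI:
  assumes "f \<in> borel_measurable lborel" "integrable lborel (\<lambda>x. (cmod (f x))\<^sup>2)"
  shows "l2_rel f f"
  using assms by (simp add: l2_rel_def)

lemma l2_eqI:
  assumes "AE x in lborel. rep_l2 u x = rep_l2 v x"
  shows "u = v"
proof -
  have "l2_rel (rep_l2 u) (rep_l2 v)"
    using assms l2_rel_rep[of u] l2_rel_rep[of v] by (simp add: l2_rel_def)
  then show ?thesis using Quotient_rel_abs[OF Quotient_l2] abs_rep_l2 by metis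
qed

lemma rep_l2_add: "AE x in lborel. rep_l2 (u + v) x = rep_l2 u x + rep_l2 v x"
proof -
  have "u + v = abs_l2 (\<lambda>x. rep_l2 u x + rep_l2 v x)"
    using plus_l2.abs_eq[OF l2_rel_rep l2_rel_rep, of u v] by (simp add: abs_rep_l2)
  moreover have "l2_rel (\<lambda>x. rep_l2 u x + rep_l2 v x) (\<lambda>x. rep_l2 u x + rep_l2 v x)"
    by (intro l2_relI square_integrable_add rep_l2_square_integrable) measurable
  ultimately show ?thesis using rep_abs_l2 by metis
qed

lemma rep_l2_scaleR: "AE x in lborel. rep_l2 (c *\<^sub>R u) x = c *\<^sub>R rep_l2 u x"
proof -
  have "c *\<^sub>R u = abs_l2 (\<lambda>x. c *\<^sub>R rep_l2 u x)"
    using scaleR_l2.abs_eq[OF l2_rel_rep, of c u] by (simp add: abs_rep_l2)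
  moreover have "l2_rel (\<lambda>x. c *\<^sub>R rep_l2 u x) (\<lambda>x. c *\<^sub>R rep_l2 u x)"
    by (intro l2_relI) (auto simp: power_mult_distrib rep_l2_square_integrable)
  ultimately show ?thesis using rep_abs_l2 by metis
qed

lemma rep_l2_diff: "AE x in lborel. rep_l2 (u - v) x = rep_l2 u x - rep_l2 v x"
  using rep_l2_add[of u "(-1) *\<^sub>R v"] rep_l2_scaleR[of "-1" v] by eventually_elim simp

lemma norm_l2_rep: "norm u = sqrt (LINT x|lborel. (cmod (rep_l2 u x))\<^sup>2)"
  using norm_l2.abs_eq[OF l2_rel_rep, of u] by (simp add: abs_rep_l2)

lemma norm_l2_le:
  assumes "AE x in lborel. cmod (rep_l2 u x) \<le> c * cmod (rep_l2 v x)" and c: "c \<ge> 0"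
  shows "norm u \<le> c * norm v"
proof -
  have "(LINT x|lborel. (cmod (rep_l2 u x))\<^sup>2) \<le> (LINT x|lborel. c\<^sup>2 * (cmod (rep_l2 v x))\<^sup>2)"
  proof (rule integral_mono_AE)
    show "AE x in lborel. (cmod (rep_l2 u x))\<^sup>2 \<le> c\<^sup>2 * (cmod (rep_l2 v x))\<^sup>2"
      using assms(1) by eventually_elim (metis norm_ge_zero power_mono power_mult_distrib)
  qed (simp_all add: rep_l2_square_integrable)
  then have "sqrt (LINT x|lborel. (cmod (rep_l2 u x))\<^sup>2) \<le> sqrt (c\<^sup>2 * (LINT x|lborel. (cmod (rep_l2 v x))\<^sup>2))"
    by (intro real_sqrt_le_mono) simp
  then show ?thesis using c by (simp add: norm_l2_rep real_sqrt_mult)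
qed

lemma integrable_inner_square:
  fixes f g :: "'a::euclidean_space \<Rightarrow> complex"
  assumes [measurable]: "f \<in> borel_measurable lborel" "g \<in> borel_measurable lborel"
    and "integrable lborel (\<lambda>x. (cmod (f x))\<^sup>2)" "integrable lborel (\<lambda>x. (cmod (g x))\<^sup>2)"
  shows "integrable lborel (\<lambda>x. f x \<bullet> g x)"
proof (rule Bochner_Integration.integrable_bound)
  show "integrable lborel (\<lambda>x. (cmod (f x))\<^sup>2 + (cmod (g x))\<^sup>2)" using assms by simp
  show "AE x in lborel. norm (f x \<bullet> g x) \<le> norm ((cmod (f x))\<^sup>2 + (cmod (g x))\<^sup>2)"
  proof (rule AE_I2)
    fix x
    have "\<bar>f x \<bullet> g x\<bar> \<le> cmod (f x) * cmod (g x)" by (rule Cauchy_Schwarz_ineq2)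
    also have "\<dots> \<le> 2 * cmod (f x) * cmod (g x)" by simp
    also have "\<dots> \<le> (cmod (f x))\<^sup>2 + (cmod (g x))\<^sup>2" by (rule sum_squares_bound)
    finally show "norm (f x \<bullet> g x) \<le> norm ((cmod (f x))\<^sup>2 + (cmod (g x))\<^sup>2)" by simp
  qed
qed measurable

text \<open>On complex numbers \<open>f x \<bullet> g x\<close> is the real part of the Hermitian
  product. The resulting real Hilbert space induces the norm already defined, and the energy
  estimates and orthogonality arguments need no more.\<close>

instantiation l2 :: (euclidean_space) real_inner
begin

lift_definition inner_l2 :: "'a l2 \<Rightarrow> 'a l2 \<Rightarrow> real" is "\<lambda>f g. LINT x|lborel. f x \<bullet> g x"
  unfolding l2_rel_def by (intro integral_cong_AE) auto

instance
proof
  fix u v w :: "'a l2" and r :: real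
  show "u \<bullet> v = v \<bullet> u" by transfer (simp add: inner_commute)
  show "(u + v) \<bullet> w = u \<bullet> w + v \<bullet> w"
    by transfer (simp add: l2_rel_def inner_add_left integrable_inner_square)
  show "(r *\<^sub>R u) \<bullet> v = r * (u \<bullet> v)" by transfer (simp add: inner_scaleR_left)
  show "norm u = sqrt (u \<bullet> u)" by transfer (simp add: power2_norm_eq_inner)
  then have *: "(norm u)\<^sup>2 = u \<bullet> u" 
  proof -
    have "0 \<le> u \<bullet> u" by transfer simp
    then show ?thesis using \<open>norm u = sqrt (u \<bullet> u)\<close> by simp
  qed
  show "0 \<le> u \<bullet> u" by transfer simp
  show "u \<bullet> u = 0 \<longleftrightarrow> u = 0" unfolding *[symmetric] by simp
qed

end

lemma inner_l2_rep: "u \<bullet> v = (LINT x|lborel. rep_l2 u x \<bullet> rep_l2 v x)"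
  using inner_l2.abs_eq[OF l2_rel_rep l2_rel_rep, of u v] by (simp add: abs_rep_l2)

lemma nn_integral_l2: "(\<integral>\<^sup>+x. ennreal ((cmod (rep_l2 u x))\<^sup>2) \<partial>lborel) = ennreal ((norm u)\<^sup>2)"
  by (subst nn_integral_eq_integral) (auto simp: rep_l2_square_integrable norm_l2_rep)

lemma Cauchy_fast_subseq:
  fixes X :: "nat \<Rightarrow> 'b::metric_space" and e :: "nat \<Rightarrow> real"
  assumes X: "Cauchy X" and e: "\<And>k. e k > 0"
  obtains r where "strict_mono r" "\<And>k n. n \<ge> r k \<Longrightarrow> dist (X n) (X (r k)) < e k"
proof -
  have "\<exists>N. \<forall>m\<ge>N. \<forall>n\<ge>N. dist (X m) (X n) < e k" for k
    using X e unfolding Cauchy_def by blast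
  then obtain N where N: "\<And>k m n. m \<ge> N k \<Longrightarrow> n \<ge> N k \<Longrightarrow> dist (X m) (X n) < e k" by metis
  \<comment> \<open>Summing \<open>Suc (N i)\<close> gives strict growth and
    \<open>r k \<ge> N k\<close> at once.\<close>
  define r where "r k = (\<Sum>i\<le>k. Suc (N i))" for k
  have "strict_mono r" by (simp add: strict_mono_Suc_iff r_def)
  moreover have "N k \<le> r k" for k
    using member_le_sum[of k "{..k}" "\<lambda>i. Suc (N i)"] by (simp add: r_def)
  then have "dist (X n) (X (r k)) < e k" if "n \<ge> r k" for n k
    using that by (intro N) (auto intro: order_trans)
  ultimately show thesis by (rule that)
qed

text \<open>
  Along a subsequence with \<open>\<parallel>X\<^bsub>k+1\<^esub> - X\<^bsub>k\<^esub>\<parallel>\<^sup>2 < 8\<^bsup>-k\<^esup>\<close> the series of \<open>4\<^bsup>k\<^esup>|X\<^bsub>k+1\<^esub> - X\<^bsub>k\<^esub>|\<^sup>2\<close> is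
  integrable, so its terms are bounded almost everywhere.
\<close>

instance l2 :: (euclidean_space) banach
proof
  fix X :: "nat \<Rightarrow> 'a l2" assume X: "Cauchy X"
  obtain r where r: "strict_mono r" and rd: "\<And>k n. n \<ge> r k \<Longrightarrow> dist (X n) (X (r k)) < (1/4) ^ k"
    using Cauchy_fast_subseq[OF X, of "\<lambda>k. (1/4) ^ k"] by auto
  define f where "f k = rep_l2 (X (r k))" for k
  have f_meas [measurable]: "f k \<in> borel_measurable lborel" for k by (simp add: f_def)
  have diff_int: "(\<integral>\<^sup>+x. ennreal ((cmod (f m x - f k x))\<^sup>2) \<partial>lborel) = ennreal ((norm (X (r m) - X (r k)))\<^sup>2)" for m k
  proof -
    have "(\<integral>\<^sup>+x. ennreal ((cmod (f m x - f k x))\<^sup>2) \<partial>lborel)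
       = (\<integral>\<^sup>+x. ennreal ((cmod (rep_l2 (X (r m) - X (r k)) x))\<^sup>2) \<partial>lborel)"
      by (rule nn_integral_cong_AE) (use rep_l2_diff[of "X (r m)" "X (r k)"] in \<open>auto simp: f_def elim!: eventually_mono\<close>)
    then show ?thesis by (simp add: nn_integral_l2)
  qed
  have diff_le: "(norm (X (r m) - X (r k)))\<^sup>2 \<le> (1/16) ^ k" if "m \<ge> k" for m k
  proof -
    have "r m \<ge> r k" using that r by (simp add: strict_mono_less_eq)
    from rd[OF this] have "norm (X (r m) - X (r k)) \<le> (1/4) ^ k" by (simp add: dist_norm)
    then have "(norm (X (r m) - X (r k)))\<^sup>2 \<le> ((1/4) ^ k)\<^sup>2" by (intro power_mono) auto
    also have "((1/4) ^ k)\<^sup>2 = ((1/16)::real) ^ k"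
      by (simp add: power2_eq_square flip: power_mult_distrib)
    finally show ?thesis .
  qed
  have "(\<integral>\<^sup>+x. (\<Sum>k. ennreal (4 ^ k * (cmod (f (Suc k) x - f k x))\<^sup>2)) \<partial>lborel)
     = (\<Sum>k. \<integral>\<^sup>+x. ennreal (4 ^ k * (cmod (f (Suc k) x - f k x))\<^sup>2) \<partial>lborel)"
    by (rule nn_integral_suminf) measurable
  also have "\<dots> \<le> (\<Sum>k. ennreal ((1/4) ^ k))"
  proof (rule suminf_le)
    fix k
    have "(\<integral>\<^sup>+x. ennreal (4 ^ k * (cmod (f (Suc k) x - f k x))\<^sup>2) \<partial>lborel)
      = ennreal (4 ^ k) * ennreal ((norm (X (r (Suc k)) - X (r k)))\<^sup>2)"
      unfolding diff_int[symmetric] by (subst nn_integral_cmult[symmetric]) (auto simp: ennreal_mult)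
    also have "\<dots> = ennreal (4 ^ k * (norm (X (r (Suc k)) - X (r k)))\<^sup>2)"
      by (simp add: ennreal_mult)
    also have "\<dots> \<le> ennreal (4 ^ k * (1/16) ^ k)"
      by (intro ennreal_leI mult_left_mono diff_le) auto
    also have "4 ^ k * (1/16) ^ k = ((1/4)::real) ^ k"
      by (simp flip: power_mult_distrib)
    finally show "(\<integral>\<^sup>+x. ennreal (4 ^ k * (cmod (f (Suc k) x - f k x))\<^sup>2) \<partial>lborel) \<le> ennreal ((1/4) ^ k)" .
  qed auto
  also have "(\<Sum>k. ennreal ((1/4) ^ k)) = ennreal (\<Sum>k. (1/4) ^ k)"
    by (rule suminf_ennreal2) (auto simp: summable_geometric)
  also have "\<dots> < \<infinity>" by simp
  finally have "AE x in lborel. (\<Sum>k. ennreal (4 ^ k * (cmod (f (Suc k) x - f k x))\<^sup>2)) \<noteq> \<infinity>"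
    by (intro nn_integral_noteq_infinite) auto
  then have conv: "AE x in lborel. convergent (\<lambda>k. f k x)"
  proof eventually_elim
    case (elim x)
    define a where "a k = 4 ^ k * (cmod (f (Suc k) x - f k x))\<^sup>2" for k
    define S where "S = (\<Sum>k. ennreal (a k))"
    have S: "S \<noteq> \<infinity>" using elim by (simp add: S_def a_def)
    have "a k \<le> enn2real S" for k
    proof -
      have "sum (\<lambda>k. ennreal (a k)) {k} \<le> S"
        unfolding S_def by (intro sum_le_suminf summableI) auto
      then have "enn2real (ennreal (a k)) \<le> enn2real S"
        using S by (intro enn2real_mono) (auto simp: less_top)
      then show ?thesis by (simp add: a_def)
    qed
    then have "4 ^ k * (cmod (f (Suc k) x - f k x))\<^sup>2 \<le> enn2real S" for k
      by (simp add: a_def)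
    then have "sqrt (4 ^ k * (cmod (f (Suc k) x - f k x))\<^sup>2) \<le> sqrt (enn2real S)" for k
      by (rule real_sqrt_le_mono)
    moreover have "sqrt (4 ^ k) = 2 ^ k" for k
      by (rule real_sqrt_unique) (simp_all add: power2_eq_square flip: power_mult_distrib)
    ultimately have "2 ^ k * cmod (f (Suc k) x - f k x) \<le> sqrt (enn2real S)" for k
      by (simp add: real_sqrt_mult)
    then have b: "norm (f (Suc k) x - f k x) \<le> sqrt (enn2real S) * (1/2) ^ k" for k
      by (simp add: power_divide pos_le_divide_eq mult.commute)
    have "summable (\<lambda>k. sqrt (enn2real S) * (1/2) ^ k)"
      by (intro summable_mult summable_geometric) simp
    then have "summable (\<lambda>k. f (Suc k) x - f k x)"
      by (rule summable_comparison_test'[where N = 0]) (rule b)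
    then have "convergent (\<lambda>n. \<Sum>k<n. f (Suc k) x - f k x)" by (simp add: summable_iff_convergent)
    then have "convergent (\<lambda>n. f n x - f 0 x)" by (simp add: sum_lessThan_telescope[of "\<lambda>k. f k x"])
    then have "convergent (\<lambda>n. (f n x - f 0 x) + f 0 x)" by (intro convergent_add convergent_const)
    then show "convergent (\<lambda>k. f k x)" by simp
  qed
  define g where "g x = lim (\<lambda>k. f k x)" for x
  have g_meas [measurable]: "g \<in> borel_measurable lborel"
    unfolding g_def by measurable
  \<comment> \<open>Fatou's lemma transfers the bound for \<open>f m - f k\<close> to the pointwise
    limit as \<open>m\<close> grows.\<close>
  have fg: "(\<integral>\<^sup>+x. ennreal ((cmod (g x - f k x))\<^sup>2) \<partial>lborel) \<le> ennreal ((1/16) ^ k)" for k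
  proof -
    have "(\<integral>\<^sup>+x. ennreal ((cmod (g x - f k x))\<^sup>2) \<partial>lborel)
        = (\<integral>\<^sup>+x. liminf (\<lambda>m. ennreal ((cmod (f m x - f k x))\<^sup>2)) \<partial>lborel)"
    proof (rule nn_integral_cong_AE)
      show "AE x in lborel. ennreal ((cmod (g x - f k x))\<^sup>2) = liminf (\<lambda>m. ennreal ((cmod (f m x - f k x))\<^sup>2))"
        using conv
      proof eventually_elim
        case (elim x)
        then have "(\<lambda>m. f m x) \<longlonglongrightarrow> g x" by (simp add: g_def convergent_LIMSEQ_iff)
        then have "(\<lambda>m. ennreal ((cmod (f m x - f k x))\<^sup>2)) \<longlonglongrightarrow> ennreal ((cmod (g x - f k x))\<^sup>2)"
          by (intro tendsto_ennrealI tendsto_intros)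
        then show ?case by (intro lim_imp_Liminf[symmetric]) auto
      qed
    qed
    also have "\<dots> \<le> liminf (\<lambda>m. \<integral>\<^sup>+x. ennreal ((cmod (f m x - f k x))\<^sup>2) \<partial>lborel)"
      by (rule nn_integral_liminf) measurable
    also have "\<dots> \<le> ennreal ((1/16) ^ k)"
    proof (rule Liminf_le)
      show "\<forall>\<^sub>F m in sequentially. (\<integral>\<^sup>+x. ennreal ((cmod (f m x - f k x))\<^sup>2) \<partial>lborel) \<le> ennreal ((1/16) ^ k)"
        using eventually_ge_at_top[of k] by eventually_elim (simp add: diff_int ennreal_leI diff_le)
    qed simp
    finally show ?thesis .
  qed
  have gf_int: "integrable lborel (\<lambda>x. (cmod (g x - f k x))\<^sup>2)" for k
    by (rule integrableI_bounded) (use order.strict_trans1[OF fg] in auto)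
  have "integrable lborel (\<lambda>x. (cmod ((g x - f 0 x) + f 0 x))\<^sup>2)"
    by (intro square_integrable_add gf_int) (auto simp: f_def rep_l2_square_integrable)
  then have g2: "l2_rel g g" by (intro l2_relI g_meas) simp
  have "(norm (abs_l2 g - X (r k)))\<^sup>2 \<le> (1/16) ^ k" for k
  proof -
    have "ennreal ((norm (abs_l2 g - X (r k)))\<^sup>2) = (\<integral>\<^sup>+x. ennreal ((cmod (rep_l2 (abs_l2 g - X (r k)) x))\<^sup>2) \<partial>lborel)"
      by (simp add: nn_integral_l2)
    also have "\<dots> = (\<integral>\<^sup>+x. ennreal ((cmod (g x - f k x))\<^sup>2) \<partial>lborel)"
    proof (rule nn_integral_cong_AE)
      show "AE x in lborel. ennreal ((cmod (rep_l2 (abs_l2 g - X (r k)) x))\<^sup>2) = ennreal ((cmod (g x - f k x))\<^sup>2)"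
        using rep_l2_diff[of "abs_l2 g" "X (r k)"] rep_abs_l2[OF g2] by eventually_elim (simp add: f_def)
    qed
    also note fg
    finally show ?thesis by simp
  qed
  then have b: "norm (X (r k) - abs_l2 g) \<le> (1/4) ^ k" for k
  proof -
    have "((1/4)::real) ^ k = sqrt ((1/16) ^ k)"
      by (rule real_sqrt_unique[symmetric]) (simp_all add: power2_eq_square flip: power_mult_distrib)
    then show ?thesis
      using \<open>(norm (abs_l2 g - X (r k)))\<^sup>2 \<le> (1/16) ^ k\<close> by (simp add: real_le_rsqrt norm_minus_commute)
  qed
  have "(\<lambda>k. X (r k) - abs_l2 g) \<longlonglongrightarrow> 0"
    by (rule Lim_null_comparison[OF always_eventually LIMSEQ_power_zero[of "1/4 :: real"]]) (use b in auto)
  then have "(X \<circ> r) \<longlonglongrightarrow> abs_l2 g" by (simp add: LIM_zero_iff o_def)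
  then have "X \<longlonglongrightarrow> abs_l2 g" by (rule Cauchy_converges_subseq[OF X r])
  then show "convergent X" by (rule convergentI)
qed

section \<open>Multiplication operators\<close>

lemma linf_rel_rep: "linf_rel (rep_linf m) (rep_linf m)"
  using Quotient_linf by (rule Quotient_rep_reflp)

lemma abs_rep_linf: "abs_linf (rep_linf m) = m"
  using Quotient_linf by (rule Quotient_abs_rep)

lemma rep_linf_measurable [measurable]: "rep_linf m \<in> borel_measurable lborel"
  using linf_rel_rep[of m] by (auto simp: linf_rel_def)

lemma rep_abs_linf:
  assumes "linf_rel f f"
  shows "AE x in lborel. rep_linf (abs_linf f) x = f x"
proof -
  have "linf_rel (rep_linf (abs_linf f)) f"
    using rep_abs_rsp_left[OF Quotient3_linf] assms by blast
  then show ?thesis by (simp add: linf_rel_def)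
qed

lemma rep_linf_le_norm: "AE x in lborel. cmod (rep_linf m x) \<le> norm m"
proof -
  have m: "rep_linf m \<in> borel_measurable lborel" "\<exists>C. AE x in lborel. cmod (rep_linf m x) \<le> C"
    using linf_rel_rep[of m] by (auto simp: linf_rel_def)
  obtain r where r: "r \<ge> 0" "esssup lborel (\<lambda>x. ereal (cmod (rep_linf m x))) = ereal r"
    using esssup_cmod_real[OF m] .
  have "norm m = r"
    using norm_linf.abs_eq[OF linf_rel_rep, of m] r by (simp add: abs_rep_linf)
  then show ?thesis using esssup_AE[of "\<lambda>x. ereal (cmod (rep_linf m x))" lborel] r by simp
qed

lemma rep_linf_scaleR: "AE x in lborel. rep_linf (c *\<^sub>R m) x = c *\<^sub>R rep_linf m x"
proof -
  have 1: "linf_rel (rep_linf m) (rep_linf m)" by (rule linf_rel_rep)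
  have "c *\<^sub>R m = abs_linf (\<lambda>x. c *\<^sub>R rep_linf m x)"
    using scaleR_linf.abs_eq[OF 1, of c] by (simp add: abs_rep_linf)
  moreover have "linf_rel (\<lambda>x. c *\<^sub>R rep_linf m x) (\<lambda>x. c *\<^sub>R rep_linf m x)"
    using scaleR_linf.rsp 1 unfolding rel_fun_def by blast
  ultimately show ?thesis using rep_abs_linf by metis
qed

lemma rep_linf_add: "AE x in lborel. rep_linf (m + m') x = rep_linf m x + rep_linf m' x"
proof -
  have "m + m' = abs_linf (\<lambda>x. rep_linf m x + rep_linf m' x)"
    using plus_linf.abs_eq[OF linf_rel_rep linf_rel_rep, of m m'] by (simp add: abs_rep_linf)
  moreover have "linf_rel (\<lambda>x. rep_linf m x + rep_linf m' x) (\<lambda>x. rep_linf m x + rep_linf m' x)"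
    using plus_linf.rsp linf_rel_rep unfolding rel_fun_def by blast
  ultimately show ?thesis using rep_abs_linf by metis
qed

lemma rep_exp_linf: "AE x in lborel. rep_linf (exp_linf m) x = exp (rep_linf m x)"
proof -
  have "exp_linf m = abs_linf (\<lambda>x. exp (rep_linf m x))"
    using exp_linf.abs_eq[OF linf_rel_rep, of m] by (simp add: abs_rep_linf)
  moreover have "linf_rel (\<lambda>x. exp (rep_linf m x)) (\<lambda>x. exp (rep_linf m x))"
    using exp_linf.rsp linf_rel_rep unfolding rel_fun_def by blast
  ultimately show ?thesis using rep_abs_linf by metis
qed

lemma rep_mult_l2: "AE x in lborel. rep_l2 (mult_l2 m u) x = rep_linf m x * rep_l2 u x"
proof -
  have "mult_l2 m u = abs_l2 (\<lambda>x. rep_linf m x * rep_l2 u x)"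
    using mult_l2.abs_eq[OF linf_rel_rep l2_rel_rep, of m u] by (simp add: abs_rep_linf abs_rep_l2)
  moreover have "l2_rel (\<lambda>x. rep_linf m x * rep_l2 u x) (\<lambda>x. rep_linf m x * rep_l2 u x)"
    using mult_l2.rsp linf_rel_rep l2_rel_rep unfolding rel_fun_def by blast
  ultimately show ?thesis using rep_abs_l2 by metis
qed

lemma mult_l2_bound: "norm (mult_l2 m u) \<le> norm m * norm u"
proof (rule norm_l2_le)
  show "AE x in lborel. cmod (rep_l2 (mult_l2 m u) x) \<le> norm m * cmod (rep_l2 u x)"
    using rep_mult_l2[of m u] rep_linf_le_norm[of m]
    by eventually_elim (simp add: norm_mult mult_right_mono)
qed simp

lemma bounded_bilinear_mult_l2: "bounded_bilinear mult_l2"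
proof (unfold_locales, goal_cases)
  case (1 m m' u)
  show ?case by (rule l2_eqI)
    (use rep_mult_l2[of "m + m'" u] rep_mult_l2[of m u] rep_mult_l2[of m' u] rep_linf_add[of m m']
      rep_l2_add[of "mult_l2 m u" "mult_l2 m' u"] in \<open>eventually_elim; simp add: algebra_simps\<close>)
next
  case (2 m u v)
  show ?case by (rule l2_eqI)
    (use rep_mult_l2[of m "u + v"] rep_mult_l2[of m u] rep_mult_l2[of m v] rep_l2_add[of u v]
      rep_l2_add[of "mult_l2 m u" "mult_l2 m v"] in \<open>eventually_elim; simp add: algebra_simps\<close>)
next
  case (3 c m u)
  show ?case by (rule l2_eqI)
    (use rep_mult_l2[of "c *\<^sub>R m" u] rep_mult_l2[of m u] rep_linf_scaleR[of c m]
      rep_l2_scaleR[of c "mult_l2 m u"] in \<open>eventually_elim; simp\<close>)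
next
  case (4 m c u)
  show ?case by (rule l2_eqI)
    (use rep_mult_l2[of m "c *\<^sub>R u"] rep_mult_l2[of m u] rep_l2_scaleR[of c u]
      rep_l2_scaleR[of c "mult_l2 m u"] in \<open>eventually_elim; simp\<close>)
next
  case 5
  show ?case by (rule exI[of _ 1]) (simp add: mult_l2_bound)
qed

lemma norm_exp_minus_linear: "cmod (exp z - 1 - z) \<le> (cmod z)\<^sup>2 * exp (cmod z)"
proof -
  have "cmod (exp z - 1 - z) \<le> exp \<bar>Re z\<bar> * (cmod z)\<^sup>2"
    using Taylor_exp[of z 1] by (simp add: power2_eq_square algebra_simps)
  also have "\<dots> \<le> exp (cmod z) * (cmod z)\<^sup>2"
    by (intro mult_right_mono) (auto simp: abs_Re_le_cmod)
  finally show ?thesis by (simp add: mult.commute)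
qed

text \<open>The pointwise Taylor remainder, in the form of hypothesis \<open>E\<close> of
  \<open>product_estimate\<close>; being quadratic in \<open>h\<close>, it sums to
  \<open>O(h)\<close> over \<open>n\<close> steps.\<close>

lemma mult_exp_minus_linear:
  assumes h: "h \<ge> 0" and M: "norm m \<le> M"
  shows "norm (mult_l2 (exp_linf (h *\<^sub>R m)) u - u - h *\<^sub>R mult_l2 m u) \<le> (h * M)\<^sup>2 * exp (h * M) * norm u"
proof (rule norm_l2_le)
  show "AE x in lborel. cmod (rep_l2 (mult_l2 (exp_linf (h *\<^sub>R m)) u - u - h *\<^sub>R mult_l2 m u) x)
      \<le> (h * M)\<^sup>2 * exp (h * M) * cmod (rep_l2 u x)"
    using rep_l2_diff[of "mult_l2 (exp_linf (h *\<^sub>R m)) u - u" "h *\<^sub>R mult_l2 m u"]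
      rep_l2_diff[of "mult_l2 (exp_linf (h *\<^sub>R m)) u" u] rep_l2_scaleR[of h "mult_l2 m u"]
      rep_mult_l2[of m u] rep_mult_l2[of "exp_linf (h *\<^sub>R m)" u] rep_exp_linf[of "h *\<^sub>R m"]
      rep_linf_scaleR[of h m] rep_linf_le_norm[of m]
  proof eventually_elim
    case (elim x)
    let ?z = "h *\<^sub>R rep_linf m x"
    have z: "cmod ?z \<le> h * M" using elim(8) M h by (simp add: mult_left_mono)
    have "rep_l2 (mult_l2 (exp_linf (h *\<^sub>R m)) u - u - h *\<^sub>R mult_l2 m u) x
      = (exp ?z - 1 - ?z) * rep_l2 u x"
      using elim by (simp add: algebra_simps)
    also have "cmod \<dots> \<le> ((cmod ?z)\<^sup>2 * exp (cmod ?z)) * cmod (rep_l2 u x)"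
      unfolding norm_mult by (intro mult_right_mono norm_exp_minus_linear) simp
    also have "\<dots> \<le> ((h * M)\<^sup>2 * exp (h * M)) * cmod (rep_l2 u x)"
      using z by (intro mult_right_mono mult_mono power_mono) auto
    finally show ?case .
  qed
qed simp

section \<open>Smooth functions of compact support\<close>

text \<open>The denominator \<open>x ^ n\<close> makes the family closed under differentiation, so
  that smoothness of the classical bump \<open>n = 0\<close> follows by one induction over all
  \<open>n\<close>.\<close>

definition exp_bump :: "nat \<Rightarrow> real \<Rightarrow> real" where
  "exp_bump n x = (if x > 0 then exp (- (1 / x)) / x ^ n else 0)"

lemma exp_bump_at_right_0: "(exp_bump n \<longlongrightarrow> 0) (at_right 0)"
proof -
  have "((\<lambda>x::real. (inverse x) ^ n / exp (inverse x)) \<longlongrightarrow> 0) (at_right 0)"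
    by (rule filterlim_compose[OF tendsto_power_div_exp_0 filterlim_inverse_at_top_right])
  moreover have "\<forall>\<^sub>F x in at_right 0. (inverse x) ^ n / exp (inverse x) = exp_bump n x"
    using eventually_at_right_less[of 0]
    by eventually_elim (simp add: exp_bump_def exp_minus divide_inverse power_inverse)
  ultimately show ?thesis by (rule Lim_transform_eventually)
qed

lemma exp_bump_deriv:
  "(exp_bump n has_real_derivative exp_bump (n + 2) x - real n * exp_bump (n + 1) x) (at x)"
proof -
  consider "x > 0" | "x < 0" | "x = 0" by linarith
  then show ?thesis
  proof cases
    case 1
    have "((\<lambda>x. exp (- (1 / x)) / x ^ n) has_real_derivative exp_bump (n + 2) x - real n * exp_bump (n + 1) x) (at x)"
      using 1 by (auto intro!: derivative_eq_intros simp: exp_bump_def field_simps power2_eq_square)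
        (cases n; simp add: field_simps)
    then show ?thesis
      by (rule has_field_derivative_transform_within_open[where S = "{0<..}"]) (use 1 in \<open>auto simp: exp_bump_def\<close>)
  next
    case 2
    have "((\<lambda>x. 0) has_real_derivative exp_bump (n + 2) x - real n * exp_bump (n + 1) x) (at x)"
      using 2 by (simp add: exp_bump_def)
    then show ?thesis
      by (rule has_field_derivative_transform_within_open[where S = "{..<0}"]) (use 2 in \<open>auto simp: exp_bump_def\<close>)
  next
    case 3
    have "((\<lambda>y. (exp_bump n y - exp_bump n 0) / (y - 0)) \<longlongrightarrow> 0) (at 0)"
    proof (rule filterlim_split_at)
      have "\<forall>\<^sub>F y in at_left (0::real). 0 = (exp_bump n y - exp_bump n 0) / (y - 0)"
        by (auto simp: eventually_at_filter exp_bump_def)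
      then show "((\<lambda>y. (exp_bump n y - exp_bump n 0) / (y - 0)) \<longlongrightarrow> 0) (at_left 0)"
        by (rule Lim_transform_eventually[OF tendsto_const])
      \<comment> \<open>At the only critical point the right difference quotient is again a member
        of the family, hence tends to 0.\<close>
      have "\<forall>\<^sub>F y in at_right (0::real). exp_bump (n + 1) y = (exp_bump n y - exp_bump n 0) / (y - 0)"
        by (auto simp: eventually_at_filter exp_bump_def)
      then show "((\<lambda>y. (exp_bump n y - exp_bump n 0) / (y - 0)) \<longlongrightarrow> 0) (at_right 0)"
        by (rule Lim_transform_eventually[OF exp_bump_at_right_0])
    qed
    then show ?thesis using 3 by (simp add: has_field_derivative_iff exp_bump_def)
  qed
qed

lemma exp_bump_range: "0 \<le> exp_bump 0 x" "exp_bump 0 x \<le> 1" "exp_bump 0 x > 0 \<longleftrightarrow> x > 0"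
  by (auto simp: exp_bump_def)

lemma frechet_derivative_eqI: "(f has_derivative f') (at x) \<Longrightarrow> frechet_derivative f (at x) = f'"
  using frechet_derivative_at by metis

section \<open>Closure properties of smooth functions and of test functions\<close>

lemma C_k_Suc: "C_k (Suc k) \<phi> \<Longrightarrow> C_k k \<phi>"
proof (induction k arbitrary: \<phi>)
  case 0
  then show ?case
    by (auto intro!: differentiable_imp_continuous_on simp: differentiable_on_def differentiable_at_withinI)
qed auto

lemma C_k_const: "C_k k (\<lambda>x. c)"
  by (induction k arbitrary: c) (auto simp: frechet_derivative_eqI[OF has_derivative_const])

lemma C_k_add: "C_k k f \<Longrightarrow> C_k k g \<Longrightarrow> C_k k (\<lambda>x. f x + g x)"
proof (induction k arbitrary: f g)
  case 0
  then show ?case by (auto intro: continuous_intros)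
next
  case (Suc k)
  then have d: "f differentiable (at x)" "g differentiable (at x)" for x by auto
  note D = has_derivative_add[OF d[unfolded frechet_derivative_works]]
  have "(\<lambda>x. f x + g x) differentiable (at x)" for x using D by (rule differentiableI)
  with Suc show ?case by (simp add: frechet_derivative_eqI[OF D])
qed

lemma C_k_mult: "C_k k f \<Longrightarrow> C_k k g \<Longrightarrow> C_k k (\<lambda>x. f x * g x)"
proof (induction k arbitrary: f g)
  case 0
  then show ?case by (auto intro: continuous_intros)
next
  case (Suc k)
  then have d: "f differentiable (at x)" "g differentiable (at x)" for x by auto
  note D = has_derivative_mult[OF d[unfolded frechet_derivative_works]]
  have "(\<lambda>x. f x * g x) differentiable (at x)" for x using D by (rule differentiableI)
  moreover have "C_k k f" "C_k k g" using Suc.prems C_k_Suc by blast+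
  ultimately show ?case using Suc by (simp add: frechet_derivative_eqI[OF D] C_k_add)
qed

lemma C_k_prod: "finite I \<Longrightarrow> (\<And>i. i \<in> I \<Longrightarrow> C_k k (f i)) \<Longrightarrow> C_k k (\<lambda>x. \<Prod>i\<in>I. f i x)"
  by (induction rule: finite_induct) (auto intro: C_k_const C_k_mult)

lemma C_k_power: "C_k k f \<Longrightarrow> C_k k (\<lambda>x. f x ^ n)"
  by (induction n) (auto intro: C_k_const C_k_mult)

lemma C_k_exp_bump: "C_k k (\<lambda>x. exp_bump n (c + x \<bullet> v))"
proof (induction k arbitrary: n)
  have D: "((\<lambda>x. exp_bump n (c + x \<bullet> v)) has_derivative
      (\<lambda>b. (b \<bullet> v) * (exp_bump (n + 2) (c + x \<bullet> v) - real n * exp_bump (n + 1) (c + x \<bullet> v)))) (at x)" for x n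
  proof -
    have "((\<lambda>x. c + x \<bullet> v) has_derivative (\<lambda>b. b \<bullet> v)) (at x)"
      by (auto intro!: derivative_eq_intros)
    from has_derivative_compose[OF this exp_bump_deriv[unfolded has_field_derivative_def]]
    show ?thesis by (simp add: mult.commute)
  qed
  {
    case 0
    show ?case unfolding C_k.simps
      using D[THEN has_derivative_continuous] by (auto simp: continuous_on_eq_continuous_within)
  next
    case (Suc k)
    have "C_k k (\<lambda>x. (b \<bullet> v) * (exp_bump (n + 2) (c + x \<bullet> v) + (- real n) * exp_bump (n + 1) (c + x \<bullet> v)))" for b
      by (intro C_k_mult C_k_add C_k_const Suc)
    then show ?case using D by (auto simp: frechet_derivative_eqI[OF D] differentiable_def)
  }
qed

lemma has_derivative_shift:
  assumes "\<phi> differentiable (at (x + z))"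
  shows "((\<lambda>x. \<phi> (x + z)) has_derivative frechet_derivative \<phi> (at (x + z))) (at x)"
proof -
  have 1: "((\<lambda>x. x + z) has_derivative (\<lambda>h. h)) (at x)" by (auto intro!: derivative_eq_intros)
  have 2: "(\<phi> has_derivative frechet_derivative \<phi> (at (x + z))) (at (x + z))"
    using assms by (simp add: frechet_derivative_works)
  from has_derivative_compose[OF 1 2] show ?thesis .
qed

lemma C_k_shift: "C_k k \<phi> \<Longrightarrow> C_k k (\<lambda>x. \<phi> (x + z))"
proof (induction k arbitrary: \<phi>)
  case 0
  then show ?case by (auto intro!: continuous_intros continuous_on_compose2[of UNIV \<phi>])
next
  case (Suc k)
  then have d: "\<phi> differentiable (at x)" for x by auto
  have "(\<lambda>x. \<phi> (x + z)) differentiable (at x)" for x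
    using has_derivative_shift[OF d] by (rule differentiableI)
  moreover have "C_k k (\<lambda>x. frechet_derivative \<phi> (at (x + z)) b)" if "b \<in> Basis" for b
    using Suc.IH[of "\<lambda>y. frechet_derivative \<phi> (at y) b"] Suc.prems that by simp
  ultimately show ?case by (simp add: frechet_derivative_eqI[OF has_derivative_shift[OF d]])
qed

lemma test_function_shift:
  assumes "test_function \<phi>"
  shows "test_function (\<lambda>x. \<phi> (x + z))"
proof -
  have "{x. \<phi> (x + z) \<noteq> 0} = (\<lambda>x. - z + x) ` {x. \<phi> x \<noteq> 0}"
    by (force simp: image_iff intro: exI[of _ "_ + z"])
  then have "closure {x. \<phi> (x + z) \<noteq> 0} = (\<lambda>x. - z + x) ` closure {x. \<phi> x \<noteq> 0}"
    by (simp only: closure_translation)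
  moreover have "compact ((\<lambda>x. - z + x) ` closure {x. \<phi> x \<noteq> 0})"
    using assms by (intro compact_translation) (simp add: test_function_def)
  ultimately have "compact (closure {x. \<phi> (x + z) \<noteq> 0})" by (simp only:)
  then show ?thesis using assms C_k_shift by (auto simp: test_function_def)
qed

lemma test_function_differentiable: "test_function \<phi> \<Longrightarrow> \<phi> differentiable (at x)"
  unfolding test_function_def by (metis C_k.simps(2))

lemma test_function_continuous: "test_function \<phi> \<Longrightarrow> continuous_on UNIV \<phi>"
  unfolding test_function_def by (metis C_k.simps(1))

lemma test_function_partial:
  assumes "test_function \<phi>" "b \<in> Basis"
  shows "test_function (\<lambda>x. frechet_derivative \<phi> (at x) b)"
proof -
  let ?K = "closure {x. \<phi> x \<noteq> 0}"
  have "frechet_derivative \<phi> (at x) b = 0" if "x \<notin> ?K" for x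
  proof -
    have "((\<lambda>x. 0) has_derivative (\<lambda>h. 0)) (at x)" by simp
    then have "(\<phi> has_derivative (\<lambda>h. 0)) (at x)"
    proof (rule has_derivative_transform_within_open[where s = "- ?K"])
      show "0 = \<phi> y" if "y \<in> - ?K" for y
        using that closure_subset[of "{x. \<phi> x \<noteq> 0}"] by auto
    qed (use that in auto)
    then show ?thesis by (simp add: frechet_derivative_eqI)
  qed
  then have "{x. frechet_derivative \<phi> (at x) b \<noteq> 0} \<subseteq> ?K" by auto
  then have "closure {x. frechet_derivative \<phi> (at x) b \<noteq> 0} \<subseteq> ?K" by (rule closure_minimal) simp
  moreover have "C_k k (\<lambda>x. frechet_derivative \<phi> (at x) b)" for k
    using assms by (auto simp: test_function_def dest: spec[of _ "Suc k"])
  moreover have "compact ?K" using assms(1) by (simp add: test_function_def)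
  ultimately show ?thesis
    by (metis closed_closure compact_Int_closed inf.absorb_iff2 test_function_def)
qed

lemma test_function_bounded:
  assumes "test_function \<phi>"
  obtains B where "B \<ge> 0" "\<And>x. \<bar>\<phi> x\<bar> \<le> B"
proof -
  let ?K = "closure {x. \<phi> x \<noteq> 0}"
  have "compact ?K" using assms by (simp add: test_function_def)
  then have "bounded (\<phi> ` ?K)"
    by (intro compact_imp_bounded compact_continuous_image
        continuous_on_subset[OF test_function_continuous[OF assms]]) auto
  then obtain B where B: "\<And>x. x \<in> ?K \<Longrightarrow> \<bar>\<phi> x\<bar> \<le> B" by (auto simp: bounded_iff)
  have "\<bar>\<phi> x\<bar> \<le> max B 0" for x
    using B[of x] closure_subset[of "{x. \<phi> x \<noteq> 0}"] by (cases "\<phi> x = 0") auto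
  then show thesis by (intro that[of "max B 0"]) auto
qed

lemma test_function_measurable [measurable]: "test_function \<phi> \<Longrightarrow> \<phi> \<in> borel_measurable borel"
  by (intro borel_measurable_continuous_onI test_function_continuous)

lemma test_function_square_integrable:
  fixes \<phi> :: "'a::euclidean_space \<Rightarrow> real"
  assumes \<phi>: "test_function \<phi>"
  shows "integrable lborel (\<lambda>x. (\<phi> x)\<^sup>2)"
proof -
  let ?K = "closure {x. \<phi> x \<noteq> 0}"
  obtain B where B: "B \<ge> 0" "\<And>x. \<bar>\<phi> x\<bar> \<le> B" using test_function_bounded[OF \<phi>] by blast
  have K: "compact ?K" using \<phi> by (simp add: test_function_def)
  show ?thesis
  proof (rule Bochner_Integration.integrable_bound)
    show "integrable lborel (\<lambda>x. B\<^sup>2 * indicator ?K x :: real)"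
      using emeasure_compact_finite[OF K] by simp
    show "AE x in lborel. norm ((\<phi> x)\<^sup>2) \<le> norm (B\<^sup>2 * indicator ?K x :: real)"
    proof (rule AE_I2)
      fix x
      have "(\<phi> x)\<^sup>2 \<le> B\<^sup>2" using B(2)[of x] B(1) by (metis abs_ge_zero power2_abs power_mono)
      then show "norm ((\<phi> x)\<^sup>2) \<le> norm (B\<^sup>2 * indicator ?K x :: real)"
        using closure_subset[of "{x. \<phi> x \<noteq> 0}"] by (cases "\<phi> x = 0") (auto simp: indicator_def)
    qed
  qed (use \<phi> in measurable)
qed

lemma test_function_scaleR_integrable:
  assumes \<phi>: "test_function \<phi>"
  shows "integrable lborel (\<lambda>x. \<phi> x *\<^sub>R rep_l2 u x)"
proof (rule Bochner_Integration.integrable_bound)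
  show "integrable lborel (\<lambda>x. (\<phi> x)\<^sup>2 + (cmod (rep_l2 u x))\<^sup>2)"
    by (intro Bochner_Integration.integrable_add test_function_square_integrable \<phi> rep_l2_square_integrable)
  show "AE x in lborel. norm (\<phi> x *\<^sub>R rep_l2 u x) \<le> norm ((\<phi> x)\<^sup>2 + (cmod (rep_l2 u x))\<^sup>2)"
  proof (rule AE_I2)
    fix x
    have "\<bar>\<phi> x\<bar> * cmod (rep_l2 u x) \<le> 2 * \<bar>\<phi> x\<bar> * cmod (rep_l2 u x)" by simp
    also have "\<dots> \<le> \<bar>\<phi> x\<bar>\<^sup>2 + (cmod (rep_l2 u x))\<^sup>2" by (rule sum_squares_bound)
    finally show "norm (\<phi> x *\<^sub>R rep_l2 u x) \<le> norm ((\<phi> x)\<^sup>2 + (cmod (rep_l2 u x))\<^sup>2)" by simp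
  qed
qed (use \<phi> in measurable)

text \<open>Both functions are written with sums and products only, to match the closure rules for \<open>C_k\<close>.\<close>

definition box_bump :: "'a::euclidean_space \<Rightarrow> 'a \<Rightarrow> 'a \<Rightarrow> real" where
  "box_bump a b x = (\<Prod>i\<in>Basis. exp_bump 0 (- (a \<bullet> i) + x \<bullet> i) * exp_bump 0 (b \<bullet> i + x \<bullet> (- i)))"

definition box_test :: "nat \<Rightarrow> 'a::euclidean_space \<Rightarrow> 'a \<Rightarrow> 'a \<Rightarrow> real" where
  "box_test m a b x = 1 + (-1) * (1 + (-1) * box_bump a b x) ^ m"

lemma box_bump_range: "0 \<le> box_bump a b x" "box_bump a b x \<le> 1"
  unfolding box_bump_def
  by (auto intro!: prod_nonneg prod_le_1 mult_nonneg_nonneg mult_le_one simp: exp_bump_range)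

lemma box_bump_pos: "x \<in> box a b \<Longrightarrow> box_bump a b x > 0"
  unfolding box_bump_def by (intro prod_pos) (auto intro!: mult_pos_pos simp: exp_bump_range box_def)

lemma box_bump_zero: "x \<notin> box a b \<Longrightarrow> box_bump a b x = 0"
  unfolding box_bump_def by (force intro!: prod_zero simp: box_def exp_bump_def not_less)

lemma box_test_range: "0 \<le> box_test m a b x" "box_test m a b x \<le> 1"
  using box_bump_range[of a b x] by (auto simp: box_test_def power_le_one)

lemma box_test_zero: "x \<notin> box a b \<Longrightarrow> box_test m a b x = 0"
  by (simp add: box_test_def box_bump_zero)

text \<open>Inside the box \<open>1 - box_bump a b x\<close> lies in \<open>[0, 1)\<close>, so its
  powers vanish; outside every member is 0. Indicators of boxes are thus dominated pointwise limits
  of test functions, without mollification.\<close>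

lemma box_test_tendsto: "(\<lambda>m. box_test m a b x) \<longlonglongrightarrow> indicator (box a b) x"
proof (cases "x \<in> box a b")
  case True
  then have "(\<lambda>m. (1 - box_bump a b x) ^ m) \<longlonglongrightarrow> 0"
    using box_bump_pos[OF True] box_bump_range[of a b x] by (intro LIMSEQ_power_zero) auto
  then have "(\<lambda>m. 1 - (1 - box_bump a b x) ^ m) \<longlonglongrightarrow> 1 - 0"
    by (rule tendsto_diff[OF tendsto_const])
  then show ?thesis using True by (simp add: box_test_def)
qed (simp add: box_test_zero)

lemma test_function_box_test: "test_function (box_test m a b)"
proof -
  have "C_k k (box_test m a b)" for k
    unfolding box_test_def box_bump_def
    by (intro C_k_add C_k_mult C_k_const C_k_power C_k_prod C_k_exp_bump) auto
  moreover have "closure {x. box_test m a b x \<noteq> 0} \<subseteq> cbox a b"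
    using box_test_zero[of _ a b m] box_subset_cbox[of a b] by (intro closure_minimal) auto
  then have "compact (closure {x. box_test m a b x \<noteq> 0})"
    by (metis closed_closure compact_Int_closed compact_cbox inf.absorb_iff2)
  ultimately show ?thesis by (simp add: test_function_def)
qed

text \<open>\<open>ennreal\<close> sends negative numbers to 0, so the two densities are the
  positive and the negative part of \<open>f\<close>. The measures agree on boxes, an
  intersection-stable generator, hence everywhere, and by uniqueness of densities both parts
  coincide; since one of them is 0 at each point, both vanish.\<close>

lemma AE_zero_if_box_integrals_zero:
  fixes f :: "'a::euclidean_space \<Rightarrow> real"
  assumes [measurable]: "f \<in> borel_measurable lborel"
    and int: "\<And>a b. integrable lborel (\<lambda>x. indicator (box a b) x * f x)"
    and zero: "\<And>a b. (LINT x|lborel. indicator (box a b) x * f x) = 0"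
  shows "AE x in lborel. f x = 0"
proof -
  have "density lborel (\<lambda>x. ennreal (f x)) = density lborel (\<lambda>x. ennreal (- f x))" (is "?M = ?N")
  proof (rule measure_eqI_generator_eq)
    let ?E = "range (\<lambda>(a, b). box a b::'a set)"
    show "Int_stable ?E"
      by (auto simp: Int_stable_def box_Int_box)
    show "?E \<subseteq> Pow UNIV" "sets ?M = sigma_sets UNIV ?E" "sets ?N = sigma_sets UNIV ?E"
      by (simp_all add: borel_eq_box)
    let ?A = "\<lambda>n::nat. box (- (real n *\<^sub>R One)) (real n *\<^sub>R One) :: 'a set"
    show "range ?A \<subseteq> ?E" "(\<Union>i. ?A i) = UNIV"
      unfolding UN_box_eq_UNIV by auto
    have *: "emeasure (density lborel (\<lambda>x. ennreal (g x))) (box a b)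
        = ennreal (LINT x|lborel. max 0 (indicator (box a b) x * g x))"
      if "integrable lborel (\<lambda>x. indicator (box a b) x * g x)" "g \<in> borel_measurable lborel" for g a b
    proof -
      have "emeasure (density lborel (\<lambda>x. ennreal (g x))) (box a b)
          = (\<integral>\<^sup>+x. ennreal (max 0 (indicator (box a b) x * g x)) \<partial>lborel)"
        using that by (subst emeasure_density) (auto intro!: nn_integral_cong simp: indicator_def max_def ennreal_neg)
      also have "\<dots> = ennreal (LINT x|lborel. max 0 (indicator (box a b) x * g x))"
        using that by (intro nn_integral_eq_integral integrable_max) auto
      finally show ?thesis .
    qed
    have int': "integrable lborel (\<lambda>x. indicator (box a b) x * (- f x))" for a b
      using int[of a b] by simp
    show "emeasure ?M (?A i) \<noteq> \<infinity>" for i by (subst *[OF int]) auto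
    show "emeasure ?M X = emeasure ?N X" if X: "X \<in> ?E" for X
    proof -
      obtain a b where X: "X = box a b" using X by auto
      let ?h = "\<lambda>x. indicator (box a b) x * f x"
      have "(LINT x|lborel. max 0 (?h x)) - (LINT x|lborel. max 0 (- ?h x)) = (LINT x|lborel. max 0 (?h x) - max 0 (- ?h x))"
        using int[of a b] by (intro Bochner_Integration.integral_diff[symmetric] integrable_max) auto
      also have "\<dots> = (LINT x|lborel. ?h x)" by (intro Bochner_Integration.integral_cong) auto
      finally have "(LINT x|lborel. max 0 (?h x)) = (LINT x|lborel. max 0 (- ?h x))" using zero by simp
      then show ?thesis unfolding X by (subst (1 2) *) (use int' int in auto)
    qed
  qed
  then have "AE x in lborel. ennreal (f x) = ennreal (- f x)"
    by (subst (asm) sigma_finite_measure.density_unique_iff[OF sigma_finite_lborel]) auto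
  then show ?thesis
  proof eventually_elim
    case (elim x)
    then show ?case by (cases "f x \<ge> 0") (auto simp: ennreal_neg ennreal_eq_0_iff)
  qed
qed

lemma l2_zero_if_orthogonal_to_test_functions:
  fixes w :: "'a::euclidean_space l2"
  assumes w: "\<And>\<phi>. test_function \<phi> \<Longrightarrow> (LINT x|lborel. \<phi> x *\<^sub>R rep_l2 w x) = 0"
  shows "w = 0"
proof -
  have int: "integrable lborel (\<lambda>x. indicator (box a b) x *\<^sub>R rep_l2 w x)" for a b
  proof (rule Bochner_Integration.integrable_bound)
    show "integrable lborel (\<lambda>x. indicator (box a b) x + (cmod (rep_l2 w x))\<^sup>2 :: real)"
      by (intro Bochner_Integration.integrable_add integrable_real_indicator rep_l2_square_integrable)
        (use emeasure_bounded_finite[OF bounded_box, of a b] in simp_all)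
    show "AE x in lborel. norm (indicator (box a b) x *\<^sub>R rep_l2 w x)
        \<le> norm (indicator (box a b) x + (cmod (rep_l2 w x))\<^sup>2 :: real)"
    proof (rule AE_I2)
      fix x
      have "cmod (rep_l2 w x) \<le> 2 * 1 * cmod (rep_l2 w x)" by simp
      also have "\<dots> \<le> 1\<^sup>2 + (cmod (rep_l2 w x))\<^sup>2" by (rule sum_squares_bound)
      finally show "norm (indicator (box a b) x *\<^sub>R rep_l2 w x) \<le> norm (indicator (box a b) x + (cmod (rep_l2 w x))\<^sup>2 :: real)"
        by (auto simp: indicator_def)
    qed
  qed measurable
  have zero: "(LINT x|lborel. indicator (box a b) x *\<^sub>R rep_l2 w x) = 0" for a b
  proof -
    have "(\<lambda>m. LINT x|lborel. box_test m a b x *\<^sub>R rep_l2 w x) \<longlonglongrightarrow> (LINT x|lborel. indicator (box a b) x *\<^sub>R rep_l2 w x)"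
    proof (rule integral_dominated_convergence[where w = "\<lambda>x. norm (indicator (box a b) x *\<^sub>R rep_l2 w x)"])
      show "AE x in lborel. (\<lambda>m. box_test m a b x *\<^sub>R rep_l2 w x) \<longlonglongrightarrow> indicator (box a b) x *\<^sub>R rep_l2 w x"
        by (intro AE_I2 tendsto_intros box_test_tendsto)
      show "AE x in lborel. norm (box_test m a b x *\<^sub>R rep_l2 w x) \<le> norm (indicator (box a b) x *\<^sub>R rep_l2 w x)" for m
        using box_test_range[of m a b] box_test_zero[of _ a b m]
        by (intro AE_I2) (auto simp: indicator_def mult_left_le_one_le)
      show "(\<lambda>x. box_test m a b x *\<^sub>R rep_l2 w x) \<in> borel_measurable lborel" for m
        using test_function_scaleR_integrable[OF test_function_box_test]
        by (rule borel_measurable_integrable)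
    qed (use integrable_norm[OF int] in auto)
    moreover have "(LINT x|lborel. box_test m a b x *\<^sub>R rep_l2 w x) = 0" for m
      by (rule w[OF test_function_box_test])
    ultimately show ?thesis by (simp add: LIMSEQ_const_iff)
  qed
  have "AE x in lborel. rep_l2 w x \<bullet> c = 0" for c
  proof (rule AE_zero_if_box_integrals_zero)
    fix a b
    have *: "(\<lambda>x. indicator (box a b) x * (rep_l2 w x \<bullet> c)) = (\<lambda>x. (indicator (box a b) x *\<^sub>R rep_l2 w x) \<bullet> c)"
      by simp
    show "integrable lborel (\<lambda>x. indicator (box a b) x * (rep_l2 w x \<bullet> c))"
      unfolding * by (rule integrable_inner_left[OF int])
    show "(LINT x|lborel. indicator (box a b) x * (rep_l2 w x \<bullet> c)) = 0"
      unfolding * by (simp only: integral_inner_left[OF int] zero) simp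
  qed measurable
  from this[of 1] this[of \<i>] have "AE x in lborel. Re (rep_l2 w x) = 0" "AE x in lborel. Im (rep_l2 w x) = 0"
    by (simp_all add: inner_complex_def)
  moreover have "AE x in lborel. rep_l2 (0 :: 'a l2) x = 0"
    using rep_l2_scaleR[of 0 "0 :: 'a l2"] by simp
  ultimately have "AE x in lborel. rep_l2 w x = rep_l2 0 x"
    by eventually_elim (simp add: complex_eq_iff)
  then show ?thesis by (rule l2_eqI)
qed

section \<open>Density of test functions\<close>

text \<open>The witness is \<open>x\<close> minus its nearest point in \<open>S\<close>, which
  exists because minimising sequences are Cauchy by the parallelogram law.\<close>

lemma exists_orthogonal_to_closed_subspace:
  fixes S :: "'a::{real_inner,banach} set"
  assumes S: "subspace S" "closed S" and x: "x \<notin> S"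
  obtains w where "w \<noteq> 0" "\<And>s. s \<in> S \<Longrightarrow> s \<bullet> w = 0"
proof -
  have ne: "S \<noteq> {}" using S(1) subspace_0 by blast
  define d where "d = infdist x S"
  have d0: "d \<ge> 0" by (simp add: d_def infdist_nonneg)
  have dle: "d \<le> norm (x - s)" if "s \<in> S" for s
    using infdist_le[OF that, of x] by (simp add: d_def dist_norm)
  have "\<exists>s\<in>S. norm (x - s) < d + 1 / real (Suc n)" for n
  proof -
    have "(INF s\<in>S. dist x s) < d + 1 / real (Suc n)" using ne by (simp add: d_def infdist_def)
    moreover have "bdd_below (dist x ` S)" by (rule bdd_belowI2[of _ 0]) simp
    ultimately show ?thesis using ne by (auto simp: cINF_less_iff dist_norm)
  qed
  then obtain s where s: "\<And>n. s n \<in> S" "\<And>n. norm (x - s n) < d + 1 / real (Suc n)" by metis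
  define \<epsilon> where "\<epsilon> n = 4 * ((d + 1 / real (Suc n))\<^sup>2 - d\<^sup>2)" for n
  have par: "(norm (s m - s n))\<^sup>2 \<le> \<epsilon> n" if "n \<le> m" for m n
  proof -
    have mid: "(1/2) *\<^sub>R (s m + s n) \<in> S" using S(1) s(1) by (intro subspace_scale subspace_add)
    have "norm (x - s m) \<le> d + 1 / real (Suc n)"
      using s(2)[of m] that frac_le[of 1 1 "real (Suc n)" "real (Suc m)"] by simp
    then have 1: "(norm (x - s m))\<^sup>2 \<le> (d + 1 / real (Suc n))\<^sup>2" by (intro power_mono) auto
    have 2: "(norm (x - s n))\<^sup>2 \<le> (d + 1 / real (Suc n))\<^sup>2" using s(2)[of n] by (intro power_mono) auto
    have 3: "d\<^sup>2 \<le> (norm (x - (1/2) *\<^sub>R (s m + s n)))\<^sup>2" by (intro power_mono dle mid d0)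
    \<comment> \<open>Parallelogram law: the midpoint belongs to \<open>S\<close>, so its distance
      to \<open>x\<close> is at least \<open>d\<close>.\<close>
    have "(norm (s m - s n))\<^sup>2 = 2 * (norm (x - s m))\<^sup>2 + 2 * (norm (x - s n))\<^sup>2
        - 4 * (norm (x - (1/2) *\<^sub>R (s m + s n)))\<^sup>2"
      by (simp add: power2_norm_eq_inner inner_diff inner_add inner_commute algebra_simps)
    also have "\<dots> \<le> \<epsilon> n" using 1 2 3 by (simp add: \<epsilon>_def)
    finally show ?thesis .
  qed
  have "\<epsilon> \<longlonglongrightarrow> 4 * ((d + 0)\<^sup>2 - d\<^sup>2)"
    unfolding \<epsilon>_def by (intro tendsto_intros LIMSEQ_inverse_real_of_nat[unfolded inverse_eq_divide])
  then have \<epsilon>0: "\<epsilon> \<longlonglongrightarrow> 0" by simp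
  have "Cauchy s"
  proof (rule metric_CauchyI)
    fix e :: real assume e: "e > 0"
    then have "\<forall>\<^sub>F n in sequentially. \<epsilon> n < e\<^sup>2" using order_tendstoD(2)[OF \<epsilon>0, of "e\<^sup>2"] by simp
    then obtain N where N: "\<And>n. n \<ge> N \<Longrightarrow> \<epsilon> n < e\<^sup>2" by (auto simp: eventually_sequentially)
    have "dist (s m) (s n) < e" if "n \<ge> N" "n \<le> m" for m n
    proof -
      have "(norm (s m - s n))\<^sup>2 < e\<^sup>2" using par[OF that(2)] N[OF that(1)] by linarith
      then show ?thesis using e by (simp add: dist_norm power2_less_imp_less)
    qed
    then show "\<exists>M. \<forall>m\<ge>M. \<forall>n\<ge>M. dist (s m) (s n) < e"
      by (metis dist_commute linorder_linear)
  qed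
  then obtain p where p: "s \<longlonglongrightarrow> p" using Cauchy_convergent convergent_def by blast
  then have pS: "p \<in> S" using s(1) S(2) closed_sequentially by blast
  define w where "w = x - p"
  have "norm w \<le> d"
  proof (rule tendsto_le[OF sequentially_bot])
    show "(\<lambda>n. norm (x - s n)) \<longlonglongrightarrow> norm w" unfolding w_def by (intro tendsto_intros p)
    show "(\<lambda>n. d + 1 / real (Suc n)) \<longlonglongrightarrow> d"
      using tendsto_add[OF tendsto_const LIMSEQ_inverse_real_of_nat[unfolded inverse_eq_divide], of d] by simp
  qed (use s(2) in \<open>auto intro: always_eventually less_imp_le\<close>)
  then have min: "norm w \<le> norm (w - v)" if "v \<in> S" for v
    using dle[of "p + v"] subspace_add[OF S(1) pS that] by (simp add: w_def algebra_simps)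
  have "v \<bullet> w = 0" if v: "v \<in> S" for v
  proof (cases "v = 0")
    case False
    \<comment> \<open>The minimiser of \<open>norm (w - t *\<^sub>R v)\<close>; minimality of
      \<open>w\<close> then leaves no room for a nonzero inner product.\<close>
    define t where "t = (v \<bullet> w) / (v \<bullet> v)"
    have vv: "v \<bullet> v > 0" using False by simp
    have "(norm w)\<^sup>2 \<le> (norm (w - t *\<^sub>R v))\<^sup>2"
      by (intro power_mono min subspace_scale[OF S(1) v]) auto
    also have "\<dots> = w \<bullet> w - 2 * t * (v \<bullet> w) + t\<^sup>2 * (v \<bullet> v)"
      unfolding power2_norm_eq_inner
      by (simp add: inner_diff_left inner_diff_right inner_commute[of w v] power2_eq_square algebra_simps)
    also have "\<dots> = w \<bullet> w - (v \<bullet> w)\<^sup>2 / (v \<bullet> v)"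
      using vv by (simp add: t_def power2_eq_square field_simps)
    finally have "(v \<bullet> w)\<^sup>2 / (v \<bullet> v) \<le> 0" by (simp add: power2_norm_eq_inner)
    then show ?thesis using vv by (simp add: divide_le_0_iff)
  qed simp
  moreover have "w \<noteq> 0" using x pS by (auto simp: w_def)
  ultimately show thesis by (intro that)
qed

lemma subspace_closure_of_subspace:
  fixes S :: "'a::real_normed_vector set"
  assumes S: "subspace S"
  shows "subspace (closure S)"
proof (rule subspaceI)
  show "0 \<in> closure S" using subspace_0[OF S] closure_subset by blast
next
  fix x y assume "x \<in> closure S" "y \<in> closure S"
  then obtain f g where "\<And>n. f n \<in> S" "f \<longlonglongrightarrow> x" "\<And>n. g n \<in> S" "g \<longlonglongrightarrow> y"
    by (auto simp: closure_sequential)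
  then have "\<And>n. f n + g n \<in> S" "(\<lambda>n. f n + g n) \<longlonglongrightarrow> x + y"
    using subspace_add[OF S] by (auto intro: tendsto_add)
  then show "x + y \<in> closure S" by (auto simp: closure_sequential intro: exI[of _ "\<lambda>n. f n + g n"])
next
  fix c x assume "x \<in> closure S"
  then obtain f where "\<And>n. f n \<in> S" "f \<longlonglongrightarrow> x" by (auto simp: closure_sequential)
  then have "\<And>n. c *\<^sub>R f n \<in> S" "(\<lambda>n. c *\<^sub>R f n) \<longlonglongrightarrow> c *\<^sub>R x"
    using subspace_scale[OF S] by (auto intro: tendsto_scaleR)
  then show "c *\<^sub>R x \<in> closure S" by (auto simp: closure_sequential intro: exI[of _ "\<lambda>n. c *\<^sub>R f n"])
qed

text \<open>Test functions are real valued and \<open>span\<close> is taken over the reals; the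
  constant \<open>c\<close> supplies the imaginary direction.\<close>

definition test_l2 :: "('a::euclidean_space \<Rightarrow> real) \<Rightarrow> complex \<Rightarrow> 'a l2" where
  "test_l2 \<phi> c = abs_l2 (\<lambda>x. \<phi> x *\<^sub>R c)"

lemma rep_test_l2:
  assumes \<phi>: "test_function \<phi>"
  shows "AE x in lborel. rep_l2 (test_l2 \<phi> c) x = \<phi> x *\<^sub>R c"
  unfolding test_l2_def
  by (intro rep_abs_l2 l2_relI)
    (use \<phi> test_function_square_integrable[OF \<phi>] in \<open>auto simp: power_mult_distrib\<close>)

lemma inner_test_l2:
  assumes \<phi>: "test_function \<phi>"
  shows "u \<bullet> test_l2 \<phi> c = (LINT x|lborel. \<phi> x *\<^sub>R rep_l2 u x) \<bullet> c"
proof -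
  have "u \<bullet> test_l2 \<phi> c = (LINT x|lborel. (\<phi> x *\<^sub>R rep_l2 u x) \<bullet> c)"
    unfolding inner_l2_rep
  proof (rule integral_cong_AE)
    show "AE x in lborel. rep_l2 u x \<bullet> rep_l2 (test_l2 \<phi> c) x = (\<phi> x *\<^sub>R rep_l2 u x) \<bullet> c"
      using rep_test_l2[OF \<phi>, of c] by eventually_elim simp
  qed (use \<phi> in measurable)
  also have "\<dots> = (LINT x|lborel. \<phi> x *\<^sub>R rep_l2 u x) \<bullet> c"
    by (intro integral_inner_left test_function_scaleR_integrable \<phi>)
  finally show ?thesis .
qed

definition test_span :: "'a::euclidean_space l2 set" where
  "test_span = span {test_l2 \<phi> c | \<phi> c. test_function \<phi>}"

lemma test_span_dense: "closure (test_span :: 'a::euclidean_space l2 set) = UNIV"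
proof (rule ccontr)
  assume "closure (test_span :: 'a l2 set) \<noteq> UNIV"
  then obtain x where "x \<notin> closure (test_span :: 'a l2 set)" by blast
  moreover have "subspace (closure (test_span :: 'a l2 set))"
    unfolding test_span_def by (intro subspace_closure_of_subspace subspace_span)
  ultimately obtain w where w: "w \<noteq> 0" "\<And>s. s \<in> closure test_span \<Longrightarrow> s \<bullet> (w :: 'a l2) = 0"
    using exists_orthogonal_to_closed_subspace[OF _ closed_closure] by metis
  have "w = 0"
  proof (rule l2_zero_if_orthogonal_to_test_functions)
    fix \<phi> :: "'a \<Rightarrow> real" assume \<phi>: "test_function \<phi>"
    \<comment> \<open>Taking this integral itself as the constant of \<open>test_l2\<close> turns
      orthogonality into \<open>?I \<bullet> ?I = 0\<close>.\<close>
    let ?I = "LINT x|lborel. \<phi> x *\<^sub>R rep_l2 w x"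
    have "test_l2 \<phi> ?I \<in> test_span" unfolding test_span_def using \<phi> by (intro span_base) auto
    then have "test_l2 \<phi> ?I \<bullet> w = 0" using closure_subset w(2) by blast
    then have "?I \<bullet> ?I = 0" using inner_test_l2[OF \<phi>, of w ?I] by (simp add: inner_commute)
    then show "?I = 0" by simp
  qed
  with w show False by simp
qed

section \<open>Translations and weak derivatives\<close>

lemma lborel_translate:
  fixes f :: "'a::euclidean_space \<Rightarrow> 'b::{banach,second_countable_topology}"
  assumes [measurable]: "f \<in> borel_measurable borel"
  shows "integrable lborel (\<lambda>x. f (x + z)) \<longleftrightarrow> integrable lborel f"
    and "(LINT x|lborel. f (x + z)) = (LINT x|lborel. f x)"
proof -
  have "integrable (distr lborel borel ((+) z)) f \<longleftrightarrow> integrable lborel (\<lambda>x. f (z + x))"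
    by (rule integrable_distr_eq) auto
  then show "integrable lborel (\<lambda>x. f (x + z)) \<longleftrightarrow> integrable lborel f"
    by (simp add: lborel_distr_plus add.commute)
  have "integral\<^sup>L (distr lborel borel ((+) z)) f = (LINT x|lborel. f (z + x))"
    by (rule integral_distr) auto
  then show "(LINT x|lborel. f (x + z)) = (LINT x|lborel. f x)"
    by (simp add: lborel_distr_plus add.commute)
qed

lemma AE_lborel_translate:
  fixes z :: "'a::euclidean_space"
  assumes "AE x in lborel. P x"
  shows "AE x in lborel. P (x + z)"
proof -
  have "AE x in distr lborel borel ((+) z). P x" unfolding lborel_distr_plus by (rule assms)
  then have "AE x in lborel. P (z + x)" by (rule AE_distrD[rotated]) simp
  then show ?thesis by (simp add: add.commute)
qed

lift_definition translate :: "'a::euclidean_space \<Rightarrow> 'a l2 \<Rightarrow> 'a l2" is "\<lambda>z f x. f (x + z)"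
proof -
  fix z :: 'a and f g :: "'a \<Rightarrow> complex" assume fg: "l2_rel f g"
  then have [measurable]: "f \<in> borel_measurable borel" "g \<in> borel_measurable borel"
    by (auto simp: l2_rel_def)
  have [measurable]: "(\<lambda>x. f (x + z)) \<in> borel_measurable borel" "(\<lambda>x. g (x + z)) \<in> borel_measurable borel"
    by measurable
  have "(\<lambda>x. (cmod (f x))\<^sup>2) \<in> borel_measurable borel" "(\<lambda>x. (cmod (g x))\<^sup>2) \<in> borel_measurable borel"
    by measurable
  with fg show "l2_rel (\<lambda>x. f (x + z)) (\<lambda>x. g (x + z))"
    using lborel_translate(1)[of "\<lambda>x. (cmod (f x))\<^sup>2" z] lborel_translate(1)[of "\<lambda>x. (cmod (g x))\<^sup>2" z]
      AE_lborel_translate[of "\<lambda>x. f x = g x" z]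
    by (simp add: l2_rel_def)
qed

lemma rep_translate: "AE x in lborel. rep_l2 (translate z u) x = rep_l2 u (x + z)"
proof -
  have "translate z u = abs_l2 (\<lambda>x. rep_l2 u (x + z))"
    using translate.abs_eq[OF l2_rel_rep, of z u] by (simp add: abs_rep_l2)
  moreover have "l2_rel (\<lambda>x. rep_l2 u (x + z)) (\<lambda>x. rep_l2 u (x + z))"
    using translate.rsp l2_rel_rep unfolding rel_fun_def by blast
  ultimately show ?thesis using rep_abs_l2 by metis
qed

lemma inner_translate: "translate z u \<bullet> v = u \<bullet> translate (- z) v"
proof -
  have "translate z u \<bullet> v = (LINT x|lborel. rep_l2 u (x + z) \<bullet> rep_l2 v ((x + z) + - z))"
    unfolding inner_l2_rep
  proof (rule integral_cong_AE)
    show "AE x in lborel. rep_l2 (translate z u) x \<bullet> rep_l2 v x = rep_l2 u (x + z) \<bullet> rep_l2 v ((x + z) + - z)"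
      using rep_translate[of z u] by eventually_elim simp
  qed measurable
  also have "\<dots> = (LINT x|lborel. rep_l2 u x \<bullet> rep_l2 v (x + - z))"
    by (rule lborel_translate(2)[where f = "\<lambda>x. rep_l2 u x \<bullet> rep_l2 v (x + - z)"]) measurable
  also have "\<dots> = u \<bullet> translate (- z) v"
    unfolding inner_l2_rep
  proof (rule integral_cong_AE)
    show "AE x in lborel. rep_l2 u x \<bullet> rep_l2 v (x + - z) = rep_l2 u x \<bullet> rep_l2 (translate (- z) v) x"
      using rep_translate[of "- z" v] by eventually_elim simp
  qed measurable
  finally show ?thesis .
qed

lemma translate_translate: "translate z (translate y u) = translate (z + y) u"
  by (rule l2_eqI)
    (use rep_translate[of z "translate y u"] AE_lborel_translate[OF rep_translate[of y u], of z]
      rep_translate[of "z + y" u] in \<open>eventually_elim; simp add: ac_simps\<close>)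

lemma translate_0: "translate 0 u = u"
  by (rule l2_eqI) (use rep_translate[of 0 u] in simp)

lemma norm_translate: "norm (translate z u) = norm u"
  by (simp add: norm_eq_sqrt_inner inner_translate translate_translate translate_0)

lemma translate_test_l2:
  assumes "test_function \<phi>"
  shows "translate z (test_l2 \<phi> c) = test_l2 (\<lambda>x. \<phi> (x + z)) c"
  by (rule l2_eqI)
    (use rep_translate[of z "test_l2 \<phi> c"] AE_lborel_translate[OF rep_test_l2[OF assms, of c], of z]
      rep_test_l2[OF test_function_shift[OF assms, of z], of c] in \<open>eventually_elim; simp\<close>)

text \<open>Dominated convergence: the difference quotients are bounded by the sup of the partial
  derivative and vanish off a fixed ball.\<close>

lemma test_function_integral_deriv:
  fixes \<phi> :: "'a::euclidean_space \<Rightarrow> real"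
  assumes \<phi>: "test_function \<phi>" and b: "b \<in> Basis"
  shows "((\<lambda>h. ((LINT x|lborel. \<phi> (x + h *\<^sub>R b) *\<^sub>R rep_l2 u x) - (LINT x|lborel. \<phi> x *\<^sub>R rep_l2 u x)) /\<^sub>R h)
      \<longlongrightarrow> (LINT x|lborel. frechet_derivative \<phi> (at x) b *\<^sub>R rep_l2 u x)) (at 0)"
proof -
  define D where "D x = frechet_derivative \<phi> (at x) b" for x
  have D: "test_function D" unfolding D_def using \<phi> b by (rule test_function_partial)
  obtain B where B: "B \<ge> 0" "\<And>x. \<bar>D x\<bar> \<le> B" using test_function_bounded[OF D] by blast
  let ?K = "closure {x. \<phi> x \<noteq> 0}"
  have "compact ?K" using \<phi> by (simp add: test_function_def)
  then have "bounded ?K" by (rule compact_imp_bounded)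
  then obtain R where R: "\<And>x. x \<in> ?K \<Longrightarrow> norm x \<le> R" by (auto simp: bounded_iff)
  \<comment> \<open>Increments are restricted to \<open>\<bar>h\<bar> \<le> 1\<close> and
    \<open>b\<close> is a unit vector, so enlarging the radius by 1 contains every shifted
    support.\<close>
  let ?C = "cball 0 (R + 1) :: 'a set"
  have der: "((\<lambda>h. \<phi> (x + h *\<^sub>R b)) has_real_derivative D (x + h *\<^sub>R b)) (at h)" for x h
  proof -
    have lin: "linear (frechet_derivative \<phi> (at (x + h *\<^sub>R b)))"
      using test_function_differentiable[OF \<phi>] by (rule linear_frechet_derivative)
    have "((\<lambda>h. x + h *\<^sub>R b) has_derivative (\<lambda>k. k *\<^sub>R b)) (at h)"
      by (auto intro!: derivative_eq_intros)
    from has_derivative_compose[OF this test_function_differentiable[OF \<phi>, unfolded frechet_derivative_works]]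
    show ?thesis unfolding has_field_derivative_def D_def
      by (simp add: linear_scale[OF lin] mult_commute_abs)
  qed
  have bound: "\<bar>(\<phi> (x + h *\<^sub>R b) - \<phi> x) / h\<bar> \<le> B * indicator ?C x" if h: "h \<noteq> 0" "\<bar>h\<bar> \<le> 1" for x h
  proof (cases "x \<in> ?C")
    case True
    have "norm (\<phi> (x + h *\<^sub>R b) - \<phi> (x + 0 *\<^sub>R b)) \<le> B * norm (h - 0)"
      by (rule field_differentiable_bound[where S = UNIV and f' = "\<lambda>h. D (x + h *\<^sub>R b)"])
        (use der B in \<open>auto simp: real_norm_def\<close>)
    then show ?thesis using True h by (simp add: abs_divide pos_divide_le_eq)
  next
    case False
    then have x: "norm x > R + 1" by simp
    have "norm (h *\<^sub>R b) \<le> 1" using h b by simp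
    then have "norm (x + h *\<^sub>R b) > R" using x norm_triangle_ineq[of "x + h *\<^sub>R b" "- (h *\<^sub>R b)"] by simp
    then have "x + h *\<^sub>R b \<notin> ?K" "x \<notin> ?K" using R x by force+
    then have "\<phi> (x + h *\<^sub>R b) = 0" "\<phi> x = 0" using closure_subset[of "{x. \<phi> x \<noteq> 0}"] by auto
    then show ?thesis using False by simp
  qed
  have Cint: "integrable lborel (\<lambda>x. (B * indicator ?C x) * cmod (rep_l2 u x))"
  proof (rule Bochner_Integration.integrable_bound)
    have "emeasure lborel ?C < \<infinity>" by (intro emeasure_compact_finite) simp
    then show "integrable lborel (\<lambda>x. (B\<^sup>2 * indicator ?C x) + (cmod (rep_l2 u x))\<^sup>2 :: real)"
      by (intro Bochner_Integration.integrable_add rep_l2_square_integrable) simp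
    show "AE x in lborel. norm ((B * indicator ?C x) * cmod (rep_l2 u x)) \<le> norm ((B\<^sup>2 * indicator ?C x) + (cmod (rep_l2 u x))\<^sup>2 :: real)"
    proof (rule AE_I2)
      fix x
      have "B * cmod (rep_l2 u x) \<le> 2 * B * cmod (rep_l2 u x)" using B by simp
      also have "\<dots> \<le> B\<^sup>2 + (cmod (rep_l2 u x))\<^sup>2" by (rule sum_squares_bound)
      finally show "norm ((B * indicator ?C x) * cmod (rep_l2 u x)) \<le> norm ((B\<^sup>2 * indicator ?C x) + (cmod (rep_l2 u x))\<^sup>2 :: real)"
        using B by (simp add: indicator_def abs_mult)
    qed
    have [measurable]: "?C \<in> sets borel" by simp
    show "(\<lambda>x. (B * indicator ?C x) * cmod (rep_l2 u x)) \<in> borel_measurable lborel"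
      by measurable
  qed
  have int: "integrable lborel (\<lambda>x. \<phi> (x + z) *\<^sub>R rep_l2 u x)" for z
    using test_function_scaleR_integrable[OF test_function_shift[OF \<phi>]] .
  have "((\<lambda>h. ((LINT x|lborel. \<phi> (x + h *\<^sub>R b) *\<^sub>R rep_l2 u x) - (LINT x|lborel. \<phi> x *\<^sub>R rep_l2 u x)) /\<^sub>R h)
     \<longlongrightarrow> (LINT x|lborel. D x *\<^sub>R rep_l2 u x)) (at 0)"
    unfolding tendsto_at_iff_sequentially o_def
  proof (intro allI impI)
    fix X :: "nat \<Rightarrow> real" assume X: "\<forall>i. X i \<in> UNIV - {0}" "X \<longlonglongrightarrow> 0"
    have eq: "((LINT x|lborel. \<phi> (x + X n *\<^sub>R b) *\<^sub>R rep_l2 u x) - (LINT x|lborel. \<phi> x *\<^sub>R rep_l2 u x)) /\<^sub>R X n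
       = (LINT x|lborel. ((\<phi> (x + X n *\<^sub>R b) - \<phi> x) / X n) *\<^sub>R rep_l2 u x)" for n
    proof -
      have "(LINT x|lborel. ((\<phi> (x + X n *\<^sub>R b) - \<phi> x) / X n) *\<^sub>R rep_l2 u x)
        = (LINT x|lborel. inverse (X n) *\<^sub>R (\<phi> (x + X n *\<^sub>R b) *\<^sub>R rep_l2 u x - \<phi> x *\<^sub>R rep_l2 u x))"
        by (intro Bochner_Integration.integral_cong) (simp_all add: divide_inverse mult.commute flip: scaleR_diff_left)
      then show ?thesis using int[of "X n *\<^sub>R b"] int[of 0] by simp
    qed
    have ev: "\<forall>\<^sub>F n in sequentially. \<bar>X n\<bar> \<le> 1"
      using tendstoD[OF X(2), of 1] by (auto elim: eventually_mono)
    then obtain N where N: "\<And>n. n \<ge> N \<Longrightarrow> \<bar>X n\<bar> \<le> 1" by (auto simp: eventually_sequentially)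
    \<comment> \<open>The offset \<open>N\<close> ensures
      \<open>\<bar>X (n + N)\<bar> \<le> 1\<close> for every \<open>n\<close>, since the dominating
      function must serve all terms.\<close>
    have "(\<lambda>n. LINT x|lborel. ((\<phi> (x + X (n + N) *\<^sub>R b) - \<phi> x) / X (n + N)) *\<^sub>R rep_l2 u x)
        \<longlonglongrightarrow> (LINT x|lborel. D x *\<^sub>R rep_l2 u x)"
    proof (rule integral_dominated_convergence[where w = "\<lambda>x. (B * indicator ?C x) * cmod (rep_l2 u x)"])
      show "(\<lambda>x. D x *\<^sub>R rep_l2 u x) \<in> borel_measurable lborel"
        using test_function_scaleR_integrable[OF D] by (rule borel_measurable_integrable)
      show "(\<lambda>x. ((\<phi> (x + X (n + N) *\<^sub>R b) - \<phi> x) / X (n + N)) *\<^sub>R rep_l2 u x) \<in> borel_measurable lborel" for n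
        using \<phi> test_function_shift[OF \<phi>] by measurable
      show "integrable lborel (\<lambda>x. (B * indicator ?C x) * cmod (rep_l2 u x))" by (rule Cint)
      show "AE x in lborel. (\<lambda>n. ((\<phi> (x + X (n + N) *\<^sub>R b) - \<phi> x) / X (n + N)) *\<^sub>R rep_l2 u x) \<longlonglongrightarrow> D x *\<^sub>R rep_l2 u x"
      proof (rule AE_I2)
        fix x
        have "((\<lambda>h. (\<phi> (x + h *\<^sub>R b) - \<phi> x) / h) \<longlongrightarrow> D x) (at 0)"
          using der[of x 0] by (simp add: DERIV_def)
        then have "(\<lambda>n. (\<phi> (x + X n *\<^sub>R b) - \<phi> x) / X n) \<longlonglongrightarrow> D x"
          using X unfolding tendsto_at_iff_sequentially o_def by blast
        then have "(\<lambda>n. (\<phi> (x + X (n + N) *\<^sub>R b) - \<phi> x) / X (n + N)) \<longlonglongrightarrow> D x"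
          by (rule LIMSEQ_ignore_initial_segment)
        then show "(\<lambda>n. ((\<phi> (x + X (n + N) *\<^sub>R b) - \<phi> x) / X (n + N)) *\<^sub>R rep_l2 u x) \<longlonglongrightarrow> D x *\<^sub>R rep_l2 u x"
          by (intro tendsto_intros)
      qed
      show "AE x in lborel. norm (((\<phi> (x + X (n + N) *\<^sub>R b) - \<phi> x) / X (n + N)) *\<^sub>R rep_l2 u x)
          \<le> (B * indicator ?C x) * cmod (rep_l2 u x)" for n
        unfolding norm_scaleR
        by (intro AE_I2 mult_right_mono bound) (use X N in auto)
    qed
    then show "(\<lambda>n. ((LINT x|lborel. \<phi> (x + X n *\<^sub>R b) *\<^sub>R rep_l2 u x) - (LINT x|lborel. \<phi> x *\<^sub>R rep_l2 u x)) /\<^sub>R X n)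
        \<longlonglongrightarrow> (LINT x|lborel. D x *\<^sub>R rep_l2 u x)"
      unfolding eq by (rule LIMSEQ_offset)
  qed
  then show ?thesis unfolding D_def .
qed

text \<open>Moving the translation to the test function by its adjoint places the derivative there,
  and the definition of the weak derivative moves it back. This links weak derivatives to the
  translation group.\<close>

lemma weak_partial_translate_deriv:
  fixes u u' :: "'a::euclidean_space l2"
  assumes w: "weak_partial b u u'" and b: "b \<in> Basis" and s: "s \<in> test_span"
  shows "((\<lambda>r. translate (r *\<^sub>R b) u \<bullet> s) has_real_derivative translate (r *\<^sub>R b) u' \<bullet> s) (at r)"
proof -
  let ?P = "\<lambda>s. \<forall>r. ((\<lambda>r. translate (r *\<^sub>R b) u \<bullet> s) has_real_derivative translate (r *\<^sub>R b) u' \<bullet> s) (at r)"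
  have "?P s"
    using s unfolding test_span_def
  proof (rule span_induct)
    show "subspace (Collect ?P)"
      by (auto simp: subspace_def inner_add_right intro!: derivative_eq_intros)
  next
    fix s :: "'a l2" assume "s \<in> {test_l2 \<phi> c | \<phi> c. test_function \<phi>}"
    then obtain \<phi> c where s: "s = test_l2 \<phi> c" and \<phi>: "test_function \<phi>" by blast
    show "?P s"
    proof
      fix r
      define \<psi> where "\<psi> x = \<phi> (x + (- r) *\<^sub>R b)" for x
      have \<psi>: "test_function \<psi>" unfolding \<psi>_def by (rule test_function_shift[OF \<phi>])
      define F where "F h = (LINT x|lborel. \<psi> (x + h *\<^sub>R b) *\<^sub>R rep_l2 u x)" for h
      have p: "translate ((r + h) *\<^sub>R b) u \<bullet> s = F (- h) \<bullet> c" for h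
      proof -
        have "translate ((r + h) *\<^sub>R b) u \<bullet> s = u \<bullet> test_l2 (\<lambda>x. \<phi> (x + - ((r + h) *\<^sub>R b))) c"
          by (simp only: inner_translate s translate_test_l2[OF \<phi>])
        also have "(\<lambda>x. \<phi> (x + - ((r + h) *\<^sub>R b))) = (\<lambda>x. \<psi> (x + (- h) *\<^sub>R b))"
          by (simp add: \<psi>_def algebra_simps)
        also have "u \<bullet> test_l2 \<dots> c = F (- h) \<bullet> c"
          unfolding F_def by (rule inner_test_l2[OF test_function_shift[OF \<psi>]])
        finally show ?thesis .
      qed
      \<comment> \<open>Translating \<open>u\<close> by \<open>h\<close> shifts the test function by
        \<open>- h\<close>; this sign compensates the minus in \<open>weak_partial\<close>.\<close>
      have "filterlim uminus (at (0::real)) (at 0)"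
        by (rule filterlim_atI) (auto intro!: tendsto_eq_intros simp: eventually_at_filter)
      from filterlim_compose[OF test_function_integral_deriv[OF \<psi> b, of u] this]
      have "((\<lambda>h. (F (- h) - F 0) /\<^sub>R (- h)) \<longlongrightarrow> (LINT x|lborel. frechet_derivative \<psi> (at x) b *\<^sub>R rep_l2 u x)) (at 0)"
        by (simp add: F_def)
      also have "(LINT x|lborel. frechet_derivative \<psi> (at x) b *\<^sub>R rep_l2 u x) = - (LINT x|lborel. \<psi> x *\<^sub>R rep_l2 u' x)"
        using w \<psi> by (simp add: weak_partial_def)
      finally have "((\<lambda>h. ((F (- h) - F 0) /\<^sub>R (- h)) \<bullet> (- c)) \<longlongrightarrow> (- (LINT x|lborel. \<psi> x *\<^sub>R rep_l2 u' x)) \<bullet> (- c)) (at 0)"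
        by (intro tendsto_intros)
      moreover have "((F (- h) - F 0) /\<^sub>R (- h)) \<bullet> (- c) = (translate ((r + h) *\<^sub>R b) u \<bullet> s - translate (r *\<^sub>R b) u \<bullet> s) / h" for h
        using p[of h] p[of 0] by (simp add: inner_diff_left divide_inverse)
      moreover have "(- (LINT x|lborel. \<psi> x *\<^sub>R rep_l2 u' x)) \<bullet> (- c) = translate (r *\<^sub>R b) u' \<bullet> s"
      proof -
        have "translate (r *\<^sub>R b) u' \<bullet> s = u' \<bullet> test_l2 (\<lambda>x. \<phi> (x + - (r *\<^sub>R b))) c"
          by (simp only: inner_translate s translate_test_l2[OF \<phi>])
        also have "(\<lambda>x. \<phi> (x + - (r *\<^sub>R b))) = \<psi>" by (simp add: \<psi>_def fun_eq_iff)
        also have "u' \<bullet> test_l2 \<psi> c = (LINT x|lborel. \<psi> x *\<^sub>R rep_l2 u' x) \<bullet> c"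
          by (rule inner_test_l2[OF \<psi>])
        finally show ?thesis by simp
      qed
      ultimately show "((\<lambda>r. translate (r *\<^sub>R b) u \<bullet> s) has_real_derivative translate (r *\<^sub>R b) u' \<bullet> s) (at r)"
        unfolding DERIV_def by simp
    qed
  qed
  then show ?thesis by blast
qed

text \<open>Tested against a vector of the dense span, the difference is Lipschitz in
  \<open>h\<close>. The estimate is closed in the test vector, so it may be applied to the
  difference itself.\<close>

lemma weak_partial_translate_bound:
  assumes w: "weak_partial b u u'" and b: "b \<in> Basis"
  shows "norm (translate (h *\<^sub>R b) u - u) \<le> \<bar>h\<bar> * norm u'"
proof -
  let ?m = "translate (h *\<^sub>R b) u - u"
  have "\<bar>?m \<bullet> s\<bar> \<le> (\<bar>h\<bar> * norm u') * norm s" if s: "s \<in> test_span" for s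
  proof -
    have "norm (translate (h *\<^sub>R b) u \<bullet> s - translate (0 *\<^sub>R b) u \<bullet> s) \<le> (norm u' * norm s) * norm (h - 0)"
    proof (rule field_differentiable_bound[where S = UNIV and f' = "\<lambda>h. translate (h *\<^sub>R b) u' \<bullet> s"])
      fix r :: real
      show "norm (translate (r *\<^sub>R b) u' \<bullet> s) \<le> norm u' * norm s"
        using Cauchy_Schwarz_ineq2[of "translate (r *\<^sub>R b) u'" s] by (simp add: norm_translate)
    qed (use weak_partial_translate_deriv[OF w b s] in auto)
    then show ?thesis by (simp add: translate_0 inner_diff_left mult_ac)
  qed
  then have "test_span \<subseteq> {s. \<bar>?m \<bullet> s\<bar> \<le> (\<bar>h\<bar> * norm u') * norm s}" by blast
  moreover have "closed {s. \<bar>?m \<bullet> s\<bar> \<le> (\<bar>h\<bar> * norm u') * norm s}"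
    by (intro closed_Collect_le continuous_intros)
  ultimately have "\<bar>?m \<bullet> ?m\<bar> \<le> (\<bar>h\<bar> * norm u') * norm ?m"
    using closure_minimal test_span_dense by blast
  then have "norm ?m * norm ?m \<le> (\<bar>h\<bar> * norm u') * norm ?m"
    by (simp add: power2_norm_eq_inner[symmetric] power2_eq_square)
  then show ?thesis by (cases "norm ?m = 0") auto
qed

text \<open>The difference quotients are bounded by \<open>norm u'\<close>, so their convergence
  against the dense span extends to every \<open>v\<close>.\<close>

lemma weak_partial_weak_limit:
  assumes w: "weak_partial b u u'" and b: "b \<in> Basis"
  shows "((\<lambda>h. ((translate (h *\<^sub>R b) u - u) /\<^sub>R h) \<bullet> v) \<longlongrightarrow> u' \<bullet> v) (at 0)"
proof (rule tendstoI)
  define q where "q h = (translate (h *\<^sub>R b) u - u) /\<^sub>R h" for h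
  have q: "norm (q h) \<le> norm u'" if "h \<noteq> 0" for h
  proof -
    have "norm (q h) = norm (translate (h *\<^sub>R b) u - u) / \<bar>h\<bar>"
      by (simp add: q_def divide_inverse mult.commute)
    then show ?thesis
      using weak_partial_translate_bound[OF w b, of h] that by (simp add: pos_divide_le_eq mult.commute)
  qed
  fix e :: real assume e: "e > 0"
  \<comment> \<open>With this distance each of the two replacements of \<open>v\<close> by
    \<open>s\<close> costs at most \<open>e / 4\<close>, leaving \<open>e / 2\<close> for the limit
    at \<open>s\<close>.\<close>
  define \<delta> where "\<delta> = e / (4 * (norm u' + 1))"
  have \<delta>: "\<delta> > 0" "norm u' * \<delta> \<le> e / 4"
    using e by (auto simp: \<delta>_def field_simps add_pos_nonneg intro!: divide_pos_pos)
  have "v \<in> closure test_span" by (simp add: test_span_dense)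
  then obtain s where s: "s \<in> test_span" "dist s v < \<delta>" using \<delta> closure_approachable by blast
  have "((\<lambda>h. q h \<bullet> s) \<longlongrightarrow> u' \<bullet> s) (at 0)"
    using weak_partial_translate_deriv[OF w b s(1), of 0]
    by (simp add: DERIV_def q_def translate_0 inner_diff_left divide_inverse mult.commute)
  then have "\<forall>\<^sub>F h in at 0. dist (q h \<bullet> s) (u' \<bullet> s) < e / 2" using e by (intro tendstoD) auto
  moreover have "\<forall>\<^sub>F h in at (0::real). h \<noteq> 0" by (simp add: eventually_at_filter)
  ultimately show "\<forall>\<^sub>F h in at 0. dist (((translate (h *\<^sub>R b) u - u) /\<^sub>R h) \<bullet> v) (u' \<bullet> v) < e"
  proof eventually_elim
    case (elim h)
    have 1: "\<bar>z \<bullet> (v - s)\<bar> \<le> e / 4" if "norm z \<le> norm u'" for z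
    proof -
      have "\<bar>z \<bullet> (v - s)\<bar> \<le> norm z * norm (v - s)" by (rule Cauchy_Schwarz_ineq2)
      also have "\<dots> \<le> norm u' * \<delta>"
        using that s(2) by (intro mult_mono) (auto simp: dist_norm norm_minus_commute)
      finally show ?thesis using \<delta> by linarith
    qed
    have "q h \<bullet> v - u' \<bullet> v = (q h \<bullet> s - u' \<bullet> s) + q h \<bullet> (v - s) - u' \<bullet> (v - s)"
      by (simp add: inner_diff_right)
    then have "\<bar>q h \<bullet> v - u' \<bullet> v\<bar> < e"
      using 1[OF q[OF elim(2)]] 1[of u'] elim(1) unfolding dist_real_def by linarith
    then show ?case by (simp add: q_def dist_real_def)
  qed
qed

text \<open>The difference quotient of \<open>u\<close> paired with \<open>v\<close> equals minus
  the quotient of \<open>v\<close> with increment \<open>- h\<close> paired with \<open>u\<close>,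
  because opposite translations are adjoint. Both sides have limits by the preceding lemma, so no
  approximation by smooth functions is required.\<close>

lemma weak_partial_integration_by_parts:
  assumes u: "weak_partial b u u'" and v: "weak_partial b v v'" and b: "b \<in> Basis"
  shows "u' \<bullet> v = - (u \<bullet> v')"
proof (rule tendsto_unique[OF trivial_limit_at])
  show "((\<lambda>h. ((translate (h *\<^sub>R b) u - u) /\<^sub>R h) \<bullet> v) \<longlongrightarrow> u' \<bullet> v) (at (0::real))"
    by (rule weak_partial_weak_limit[OF u b])
  have "filterlim uminus (at (0::real)) (at 0)"
    by (rule filterlim_atI) (auto intro!: tendsto_eq_intros simp: eventually_at_filter)
  from filterlim_compose[OF weak_partial_weak_limit[OF v b, of u] this]
  have "((\<lambda>h. - (((translate (- h *\<^sub>R b) v - v) /\<^sub>R (- h)) \<bullet> u)) \<longlongrightarrow> - (v' \<bullet> u)) (at 0)"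
    by (rule tendsto_minus)
  moreover have "(\<lambda>h. - (((translate (- h *\<^sub>R b) v - v) /\<^sub>R (- h)) \<bullet> u))
      = (\<lambda>h. ((translate (h *\<^sub>R b) u - u) /\<^sub>R h) \<bullet> v)"
  proof
    fix h
    show "- (((translate (- h *\<^sub>R b) v - v) /\<^sub>R (- h)) \<bullet> u) = ((translate (h *\<^sub>R b) u - u) /\<^sub>R h) \<bullet> v"
      using inner_translate[of "h *\<^sub>R b" u v]
      by (simp add: inner_diff_left inner_diff_right inner_commute)
  qed
  moreover have "- (v' \<bullet> u) = - (u \<bullet> v')" by (simp add: inner_commute)
  ultimately show "((\<lambda>h. ((translate (h *\<^sub>R b) u - u) /\<^sub>R h) \<bullet> v) \<longlongrightarrow> - (u \<bullet> v')) (at 0)"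
    by simp
qed

lemma weak_partial_unique:
  assumes "weak_partial b u v" "weak_partial b u v'"
  shows "v = v'"
proof -
  have "v - v' = 0"
  proof (rule l2_zero_if_orthogonal_to_test_functions)
    fix \<phi> :: "'a \<Rightarrow> real" assume \<phi>: "test_function \<phi>"
    have "(LINT x|lborel. \<phi> x *\<^sub>R rep_l2 (v - v') x) = (LINT x|lborel. \<phi> x *\<^sub>R rep_l2 v x - \<phi> x *\<^sub>R rep_l2 v' x)"
    proof (rule integral_cong_AE)
      show "AE x in lborel. \<phi> x *\<^sub>R rep_l2 (v - v') x = \<phi> x *\<^sub>R rep_l2 v x - \<phi> x *\<^sub>R rep_l2 v' x"
        using rep_l2_diff[of v v'] by eventually_elim (simp add: scaleR_diff_right)
    qed (use \<phi> in measurable)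
    also have "\<dots> = 0"
      using assms \<phi> by (simp add: test_function_scaleR_integrable weak_partial_def)
    finally show "(LINT x|lborel. \<phi> x *\<^sub>R rep_l2 (v - v') x) = 0" .
  qed
  then show ?thesis by simp
qed

lemma weak_deriv_weak_partial:
  assumes "u \<in> H1" "b \<in> Basis"
  shows "weak_partial b u (weak_deriv b u)"
proof -
  obtain v where "weak_partial b u v" using assms by (auto simp: H1_def)
  then show ?thesis
    unfolding weak_deriv_def by (rule theI) (use weak_partial_unique \<open>weak_partial b u v\<close> in blast)
qed

text \<open>One integration by parts in each direction. The resulting form is symmetric in
  \<open>u\<close> and \<open>v\<close> and nonpositive for \<open>u = v\<close>, which yields the
  two properties of the Laplacian below.\<close>

lemma inner_laplacian:
  assumes u: "u \<in> H2" and v: "v \<in> H1"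
  shows "laplacian u \<bullet> v = - (\<Sum>b\<in>Basis. weak_deriv b u \<bullet> weak_deriv b v)"
proof -
  have "weak_deriv b (weak_deriv b u) \<bullet> v = - (weak_deriv b u \<bullet> weak_deriv b v)" if b: "b \<in> Basis" for b
    using u v b by (intro weak_partial_integration_by_parts[OF _ _ b] weak_deriv_weak_partial) (auto simp: H2_def)
  then show ?thesis by (simp add: laplacian_def inner_sum_left sum_negf)
qed

lemma laplacian_symmetric: "u \<in> H2 \<Longrightarrow> v \<in> H2 \<Longrightarrow> laplacian u \<bullet> v = u \<bullet> laplacian v"
  using inner_laplacian[of u v] inner_laplacian[of v u]
  by (simp add: H2_def inner_commute[of u] inner_commute[of "weak_deriv _ u"])

lemma laplacian_dissipative: "u \<in> H2 \<Longrightarrow> laplacian u \<bullet> u \<le> 0"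
  using inner_laplacian[of u u] by (simp add: H2_def sum_nonneg)

section \<open>The heat semigroup and the error bound\<close>

lemma heat_semigroup_smoothing:
  assumes "heat_semigroup G"
  shows "smoothing_semigroup G"
proof (rule symmetric_dissipative_imp_smoothing)
  show "C0_semigroup G" using assms by (simp add: heat_semigroup_def)
  have gen: "x \<in> H2 \<and> y = laplacian x" if "(x, y) \<in> generator G" for x y
    using assms that by (auto simp: heat_semigroup_def)
  show "y \<bullet> x \<le> 0" if "(x, y) \<in> generator G" for x y
    using gen[OF that] laplacian_dissipative by auto
  show "y \<bullet> x' = x \<bullet> y'" if "(x, y) \<in> generator G" "(x', y') \<in> generator G" for x y x' y'
    using gen[OF that(1)] gen[OF that(2)] laplacian_symmetric by auto
qed

lemma mult_l2_linear: "linear (mult_l2 m)"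
  by (rule bounded_linear.linear[OF bounded_bilinear.bounded_linear_right[OF bounded_bilinear_mult_l2]])

text \<open>The assumptions of \<open>mild_solution\<close> on continuity and \<open>deriv\<close>,
  with time counted from the start \<open>\<sigma>\<close>.\<close>

definition mild_on :: "(real \<Rightarrow> 'a::euclidean_space l2 \<Rightarrow> 'a l2) \<Rightarrow> (real \<Rightarrow> 'a linf) \<Rightarrow> real \<Rightarrow> real \<Rightarrow> (real \<Rightarrow> 'a l2) \<Rightarrow> bool" where
  "mild_on G V \<sigma> T u \<longleftrightarrow> continuous_on {0..T} u \<and>
     (\<forall>r t. 0 < r \<longrightarrow> r < t \<longrightarrow> t \<le> T \<longrightarrow>
       ((\<lambda>r. G (t - r) (u r)) has_vector_derivative G (t - r) (mult_l2 (V (\<sigma> + r)) (u r))) (at r))"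

text \<open>The sampling times \<open>c\<close> are left free: the product for the evolution family
  samples \<open>V\<close> at left end points of the steps, the iterated semigroups at right end
  points.\<close>

definition splitting :: "(real \<Rightarrow> 'a::euclidean_space l2 \<Rightarrow> 'a l2) \<Rightarrow> (real \<Rightarrow> 'a linf) \<Rightarrow> (nat \<Rightarrow> real) \<Rightarrow> real \<Rightarrow> nat \<Rightarrow> 'a l2 \<Rightarrow> 'a l2" where
  "splitting G V c T n =
     time_ordered_prod (\<lambda>i x. mult_l2 (exp_linf ((T / real n) *\<^sub>R V (c i))) (G (T / real n) x)) n"

text \<open>The order of quantifiers is the point: \<open>N\<close> is fixed before the length
  \<open>T\<close>, the start \<open>\<sigma>\<close>, the solution \<open>u\<close>, its bound
  \<open>C\<close> and the sampling times. It depends only on \<open>G\<close>, \<open>V\<close>,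
  \<open>M\<close>, \<open>b\<close> and \<open>e\<close>.\<close>

lemma uniform_product_estimate:
  fixes V :: "real \<Rightarrow> 'a::euclidean_space linf" and G :: "real \<Rightarrow> 'a l2 \<Rightarrow> 'a l2"
  assumes G: "smoothing_semigroup G" and Vu: "uniformly_continuous_on UNIV V"
    and VM: "\<And>s. norm (V s) \<le> M" and b: "b \<ge> 0" and e: "e > 0"
  obtains N where "N > 0" and
    "\<And>n T C \<sigma> u c. \<lbrakk>n \<ge> N; 0 \<le> T; T \<le> b; mild_on G V \<sigma> T u;
       \<And>r. 0 \<le> r \<Longrightarrow> r \<le> T \<Longrightarrow> norm (u r) \<le> C;
       \<And>i. \<sigma> + real i * (T / real n) \<le> c i \<and> c i \<le> \<sigma> + (real i + 1) * (T / real n)\<rbrakk> \<Longrightarrow>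
       norm (u T - splitting G V c T n (u 0)) \<le> e * C"
proof -
  have M0: "M \<ge> 0" using VM[of 0] norm_ge_zero order_trans by blast
  define K where "K = exp (b * M)"
  define Q where "Q = exp (b * (M + b * M\<^sup>2 * K))"
  \<comment> \<open>\<open>Q\<close> bounds the Gronwall factor for all \<open>T \<le> b\<close>.
    The oscillation \<open>w\<close> then costs at most \<open>e / 2\<close>, and
    \<open>\<rho> n * Q\<close> uses the other half; \<open>b + 1\<close> avoids division by
    zero.\<close>
  define w where "w = e / (2 * (b + 1) * Q)"
  define \<rho> where "\<rho> n = M\<^sup>2 * b * (b / real n + 6 * (b / sqrt (real n))) + 12 * M * (b / sqrt (real n))
      + b * (b / real n) * M\<^sup>2 * K" for n
  have Q: "Q > 0" by (simp add: Q_def)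
  have w: "w > 0" using e b Q by (simp add: w_def)
  have bw: "b * w * Q \<le> e / 2"
  proof -
    have "w * Q = e / (2 * (b + 1))" using Q by (simp add: w_def)
    then have "b * w * Q = (b / (b + 1)) * (e / 2)" by (simp add: mult.assoc)
    also have "\<dots> \<le> 1 * (e / 2)" using b e by (intro mult_right_mono) auto
    finally show ?thesis by simp
  qed
  have sq: "filterlim (\<lambda>n. sqrt (real n)) at_top sequentially"
    by (rule filterlim_compose[OF sqrt_at_top filterlim_real_sequentially])
  have "\<rho> \<longlonglongrightarrow> M\<^sup>2 * b * (0 + 6 * 0) + 12 * M * 0 + b * 0 * M\<^sup>2 * K"
    unfolding \<rho>_def
    by (intro tendsto_intros tendsto_divide_0[OF tendsto_const] filterlim_at_top_imp_at_infinity
        sq filterlim_real_sequentially)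
  then have "(\<lambda>n. \<rho> n * Q) \<longlonglongrightarrow> 0 * Q" by (intro tendsto_intros) simp
  then have "\<forall>\<^sub>F n in sequentially. \<rho> n * Q < e / 2" using e by (intro order_tendstoD) auto
  then obtain N1 where N1: "\<And>n. n \<ge> N1 \<Longrightarrow> \<rho> n * Q < e / 2" by (auto simp: eventually_sequentially)
  obtain \<delta> where \<delta>: "\<delta> > 0" "\<And>x y. dist x y < \<delta> \<Longrightarrow> dist (V x) (V y) < w"
    using Vu w unfolding uniformly_continuous_on_def by (metis UNIV_I)
  \<comment> \<open>From \<open>N2\<close> on, a step is shorter than the \<open>\<delta>\<close>
    belonging to the oscillation \<open>w\<close>.\<close>
  obtain N2 where N2: "real N2 > b / \<delta>" using reals_Archimedean2 by blast
  define N where "N = max (max N1 N2) 1"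
  show thesis
  proof (rule that)
    show "N > 0" by (simp add: N_def)
    fix n :: nat and T C \<sigma> :: real and u :: "real \<Rightarrow> 'a l2" and c :: "nat \<Rightarrow> real"
    assume n: "n \<ge> N" and T: "0 \<le> T" "T \<le> b" and mild: "mild_on G V \<sigma> T u"
      and ub: "\<And>r. 0 \<le> r \<Longrightarrow> r \<le> T \<Longrightarrow> norm (u r) \<le> C"
      and c: "\<And>i. \<sigma> + real i * (T / real n) \<le> c i \<and> c i \<le> \<sigma> + (real i + 1) * (T / real n)"
    define \<kappa> where "\<kappa> i = c i - \<sigma>" for i
    have c_eq: "c i = \<sigma> + \<kappa> i" for i by (simp add: \<kappa>_def)
    have \<kappa>: "real i * (T / real n) \<le> \<kappa> i \<and> \<kappa> i \<le> (real i + 1) * (T / real n)" for i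
      using c[of i] unfolding c_eq by linarith
    define h where "h = T / real n"
    have n0: "n > 0" "n \<ge> N1" "n \<ge> N2" using n by (auto simp: N_def)
    have h: "0 \<le> h" using T by (simp add: h_def)
    have "b / real n < \<delta>"
    proof -
      have "b / \<delta> < real n" using N2 n0 by linarith
      then show ?thesis using \<delta> n0 by (simp add: field_simps)
    qed
    then have h\<delta>: "h < \<delta>" using T divide_right_mono[of T b "real n"] by (simp add: h_def)
    interpret smoothing_semigroup G by (rule G)
    interpret sol: mild_solution G u "\<lambda>r. mult_l2 (V (\<sigma> + r))" M C T
    proof
      fix r x
      have "norm (mult_l2 (V (\<sigma> + r)) x) \<le> norm (V (\<sigma> + r)) * norm x" by (rule mult_l2_bound)
      also have "\<dots> \<le> M * norm x" by (intro mult_right_mono VM) simp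
      finally show "norm (mult_l2 (V (\<sigma> + r)) x) \<le> M * norm x" .
    qed (use M0 T mild[unfolded mild_on_def] ub in \<open>auto simp: linear_add[OF mult_l2_linear] linear_scale[OF mult_l2_linear]\<close>)
    define K' where "K' = exp (T * M)"
    define R where "R = T * w + M\<^sup>2 * T * (h + 6 * sqrt (h * T)) + 12 * M * (h * sqrt (real n)) + T * h * M\<^sup>2 * K'"
    have "norm (u T - time_ordered_prod (\<lambda>i x. mult_l2 (exp_linf (h *\<^sub>R V (\<sigma> + \<kappa> i))) (G h x)) n (u 0))
        \<le> C * R * exp (T * (M + T * M\<^sup>2 * K'))"
      unfolding h_def R_def K'_def
    proof (rule sol.product_estimate[OF n0(1) less_imp_le[OF w], where \<tau> = \<kappa>], unfold h_def[symmetric])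
      fix i x
      show "linear (mult_l2 (exp_linf (h *\<^sub>R V (\<sigma> + \<kappa> i))))" by (rule mult_l2_linear)
      show "norm (mult_l2 (exp_linf (h *\<^sub>R V (\<sigma> + \<kappa> i))) x - x - h *\<^sub>R mult_l2 (V (\<sigma> + \<kappa> i)) x)
          \<le> (h * M)\<^sup>2 * exp (h * M) * norm x"
        by (rule mult_exp_minus_linear[OF h VM])
      fix r assume r: "real i * h \<le> r" "r \<le> (real i + 1) * h"
      have "dist (\<sigma> + r) (\<sigma> + \<kappa> i) < \<delta>"
        using r \<kappa>[of i] h\<delta> unfolding h_def[symmetric] by (simp add: dist_real_def algebra_simps abs_less_iff)
      then have "norm (V (\<sigma> + r) - V (\<sigma> + \<kappa> i)) \<le> w" using \<delta>(2) by (fastforce simp: dist_norm)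
      then have "norm (mult_l2 (V (\<sigma> + r) - V (\<sigma> + \<kappa> i)) x) \<le> w * norm x"
        by (intro order_trans[OF mult_l2_bound] mult_right_mono) auto
      then show "norm (mult_l2 (V (\<sigma> + r)) x - mult_l2 (V (\<sigma> + \<kappa> i)) x) \<le> w * norm x"
        by (simp add: bounded_bilinear.diff_left[OF bounded_bilinear_mult_l2])
    qed
    also have "\<dots> \<le> C * ((b * w + \<rho> n) * Q)"
    proof -
      have sqn: "sqrt (real n) > 0" using n0 by simp
      have hb: "h \<le> b / real n" using T by (simp add: h_def divide_right_mono)
      have hT: "sqrt (h * T) \<le> b / sqrt (real n)"
      proof -
        have "h * T \<le> b\<^sup>2 / real n"
          using mult_mono[OF T(2) T(2)] T b by (simp add: h_def power2_eq_square divide_right_mono)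
        then have "sqrt (h * T) \<le> sqrt (b\<^sup>2 / real n)" by (rule real_sqrt_le_mono)
        then show ?thesis using b by (simp add: real_sqrt_divide)
      qed
      have hn: "h * sqrt (real n) \<le> b / sqrt (real n)"
      proof -
        have "h * sqrt (real n) = T * (sqrt (real n) / real n)" by (simp add: h_def)
        also have "\<dots> = T / sqrt (real n)" by (simp only: sqrt_divide_self_eq of_nat_0_le_iff divide_inverse[of T])
        finally have "h * sqrt (real n) = T / sqrt (real n)" .
        then show ?thesis using T by (simp add: divide_right_mono)
      qed
      have KK: "K' \<le> K" "K' > 0" using T M0 by (auto simp: K'_def K_def mult_right_mono)
      have R1: "T * w \<le> b * w" using T w by (intro mult_right_mono) auto
      have R2: "M\<^sup>2 * T * (h + 6 * sqrt (h * T)) \<le> M\<^sup>2 * b * (b / real n + 6 * (b / sqrt (real n)))"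
        using T h hb hT by (intro mult_mono add_mono mult_left_mono) auto
      have R3: "12 * M * (h * sqrt (real n)) \<le> 12 * M * (b / sqrt (real n))"
        using hn M0 by (intro mult_left_mono) auto
      have R4: "T * h * M\<^sup>2 * K' \<le> b * (b / real n) * M\<^sup>2 * K"
        using T b h hb KK by (intro mult_mono) auto
      have "R \<le> b * w + \<rho> n"
        unfolding R_def \<rho>_def using R1 R2 R3 R4 by linarith
      moreover have "exp (T * (M + T * M\<^sup>2 * K')) \<le> Q"
        unfolding Q_def using T KK M0 b
        by (auto intro!: mult_mono add_mono mult_nonneg_nonneg add_nonneg_nonneg)
      moreover have "R \<ge> 0"
        unfolding R_def using T h w M0 KK by (intro add_nonneg_nonneg mult_nonneg_nonneg) auto
      ultimately have "R * exp (T * (M + T * M\<^sup>2 * K')) \<le> (b * w + \<rho> n) * Q"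
        by (intro mult_mono) auto
      then show ?thesis using mult_left_mono[OF _ sol.C] by (simp add: mult.assoc)
    qed
    also have "\<dots> \<le> C * e"
      using N1[OF n0(2)] bw sol.C by (intro mult_left_mono) (auto simp: algebra_simps)
    finally show "norm (u T - splitting G V c T n (u 0)) \<le> e * C"
      by (simp add: h_def splitting_def c_eq mult.commute)
  qed
qed

lemma bounded_linear_time_ordered_prod:
  assumes "\<And>i. bounded_linear (P i)"
  shows "bounded_linear (time_ordered_prod P n)"
  using assms by (induction n) (auto intro: bounded_linear_ident bounded_linear_compose simp: id_def o_def)

lemma bounded_linear_step:
  assumes "contraction_semigroup G" "h \<ge> 0"
  shows "bounded_linear (\<lambda>x. mult_l2 m (G h x))"
proof -
  interpret contraction_semigroup G by fact
  show ?thesis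
    using assms(2) by (intro bounded_linear_compose[OF bounded_bilinear.bounded_linear_right[OF bounded_bilinear_mult_l2]]
      G_bounded_linear)
qed

lemma bounded_linear_splitting:
  assumes "contraction_semigroup G" "T \<ge> 0"
  shows "bounded_linear (splitting G V c T n)"
  unfolding splitting_def using assms
  by (intro bounded_linear_time_ordered_prod bounded_linear_step) auto

section \<open>The evolution family\<close>

lemma evolution_family_product_limit:
  fixes V :: "real \<Rightarrow> 'a::euclidean_space linf" and G :: "real \<Rightarrow> 'a l2 \<Rightarrow> 'a l2"
  assumes V: "V \<in> BUC" and G: "heat_semigroup G" and U: "solves V U"
    and K: "compact K" "K \<subseteq> {(t, s). s \<le> t}"
  shows "uniform_limit K
     (\<lambda>n (t, s). norm (U t s u0 - time_ordered_prod
        (\<lambda>p u. mult_l2 (exp_linf (((t - s) / real n) *\<^sub>R V (s + real p * (t - s) / real n)))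
                 (G ((t - s) / real n) u)) n u0))
     (\<lambda>_. 0) sequentially"
proof -
  interpret smoothing_semigroup G by (rule heat_semigroup_smoothing[OF G])
  have cs: "contraction_semigroup G" by unfold_locales
  obtain B where B: "\<And>p. p \<in> K \<Longrightarrow> norm p \<le> B" using compact_imp_bounded[OF K(1)] by (auto simp: bounded_iff)
  \<comment> \<open>Both coordinates of a point of \<open>K\<close> are bounded by \<open>B\<close>,
    so \<open>t - s\<close> is at most \<open>2 * B\<close>.\<close>
  define b where "b = max 0 (2 * B)"
  have b: "b \<ge> 0" by (simp add: b_def)
  have Tb: "s \<le> t" "t - s \<le> b" if "(t, s) \<in> K" for t s
  proof -
    show "s \<le> t" using that K(2) by auto
    show "t - s \<le> b" using B[OF that] norm_fst_le[of t s] norm_snd_le[of s t]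
      by (auto simp: b_def)
  qed
  have EU: "evolution_family U" and dense: "\<And>s. closure {y. classical_solution V s (\<lambda>t. U t s y)} = UNIV"
    using U by (auto simp: solves_def)
  have Ubl: "bounded_linear (U t s)" if "s \<le> t" for t s using EU that by (auto simp: evolution_family_def)
  have Uid: "U t t y = y" for t y using EU by (auto simp: evolution_family_def)
  have Ucont: "continuous_on {(t, s). s \<le> t} (\<lambda>(t, s). U t s y)" for y using EU by (auto simp: evolution_family_def)
  obtain M' \<omega> where M': "M' \<ge> 1" "\<And>s t. s \<le> t \<Longrightarrow> onorm (U t s) \<le> M' * exp (\<omega> * (t - s))"
    using EU by (auto simp: evolution_family_def)
  define C1 where "C1 = M' * exp (\<bar>\<omega>\<bar> * b)"
  have C1: "C1 > 0" using M' by (simp add: C1_def)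
  have Ubd: "norm (U t s y) \<le> C1 * norm y" if "s \<le> t" "t - s \<le> b" for t s y
  proof -
    have "norm (U t s y) \<le> onorm (U t s) * norm y" by (rule onorm[OF Ubl[OF that(1)]])
    also have "\<dots> \<le> (M' * exp (\<omega> * (t - s))) * norm y" using M'(2)[OF that(1)] by (rule mult_right_mono) simp
    also have "\<dots> \<le> C1 * norm y"
    proof -
      have "\<omega> * (t - s) \<le> \<bar>\<omega>\<bar> * (t - s)" using that by (intro mult_right_mono) auto
      also have "\<dots> \<le> \<bar>\<omega>\<bar> * b" using that by (intro mult_left_mono) auto
      finally show ?thesis using M' by (auto simp: C1_def intro!: mult_right_mono mult_left_mono)
    qed
    finally show ?thesis .
  qed
  have Vu: "uniformly_continuous_on UNIV V" using V by (simp add: BUC_def)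
  then have Vc: "continuous_on UNIV V" by (rule uniformly_continuous_imp_continuous)
  obtain MV where MV: "\<And>s. norm (V s) \<le> MV" using V by (auto simp: BUC_def bounded_iff)
  show ?thesis
  proof (rule uniform_limitI)
    fix \<epsilon> :: real assume \<epsilon>: "\<epsilon> > 0"
    \<comment> \<open>\<open>C1 * norm y\<close> bounds the solution starting at \<open>y\<close>
      uniformly over the time intervals that occur in \<open>K\<close>; this choice brings the error
      for \<open>u0\<close> below \<open>\<epsilon>\<close>.\<close>
    define e where "e = \<epsilon> / (2 * C1 * (norm u0 + 1))"
    have e: "e > 0" using \<epsilon> C1 by (simp add: e_def add_nonneg_pos)
    have eC: "e * (C1 * norm u0) < \<epsilon>"
    proof -
      have "e * (C1 * norm u0) = (\<epsilon> / 2) * (norm u0 / (norm u0 + 1))"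
        using C1 by (simp add: e_def field_simps add_nonneg_pos add_nonneg_eq_0_iff)
      also have "\<dots> \<le> (\<epsilon> / 2) * 1" using \<epsilon> by (intro mult_left_mono) (auto simp: divide_le_eq add_nonneg_pos)
      finally show ?thesis using \<epsilon> by simp
    qed
    obtain N where N: "N > 0" and est: "\<And>n T C \<sigma> u c. \<lbrakk>n \<ge> N; 0 \<le> T; T \<le> b; mild_on G V \<sigma> T u;
       \<And>r. 0 \<le> r \<Longrightarrow> r \<le> T \<Longrightarrow> norm (u r) \<le> C;
       \<And>i. \<sigma> + real i * (T / real n) \<le> c i \<and> c i \<le> \<sigma> + (real i + 1) * (T / real n)\<rbrakk> \<Longrightarrow>
       norm (u T - splitting G V c T n (u 0)) \<le> e * C"
      using uniform_product_estimate[OF smoothing_semigroup_axioms Vu MV b e] by blast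
    have main: "norm (U t s u0 - time_ordered_prod
        (\<lambda>p u. mult_l2 (exp_linf (((t - s) / real n) *\<^sub>R V (s + real p * (t - s) / real n)))
                 (G ((t - s) / real n) u)) n u0) < \<epsilon>"
      if n: "n \<ge> N" and ts: "(t, s) \<in> K" for n t s
    proof -
      define T where "T = t - s"
      have T: "0 \<le> T" "T \<le> b" using Tb[OF ts] by (auto simp: T_def)
      define P where "P = splitting G V (\<lambda>i. s + real i * T / real n) T n"
      have P: "bounded_linear P" unfolding P_def by (rule bounded_linear_splitting[OF cs T(1)])
      have est_classical: "norm (U t s y - P y) \<le> e * (C1 * norm y)" if y: "classical_solution V s (\<lambda>t. U t s y)" for y
      proof -
        obtain v' where v': "\<And>t. t \<ge> s \<Longrightarrow> ((\<lambda>t. U t s y) has_vector_derivative v' t) (at t within {s..})"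
          "\<And>t. t \<ge> s \<Longrightarrow> U t s y \<in> H2"
          "\<And>t. t \<ge> s \<Longrightarrow> v' t = laplacian (U t s y) + mult_l2 (V t) (U t s y)"
          using y unfolding classical_solution_def by blast
        define u where "u r = U (s + r) s y" for r
        have uc: "continuous_on {0..T} u"
        proof -
          have "continuous_on {0..T} (\<lambda>r. (\<lambda>(t, s). U t s y) (s + r, s))"
            by (rule continuous_on_compose2[OF Ucont]) (auto intro!: continuous_intros)
          then show ?thesis by (simp add: u_def)
        qed
        have mild: "mild_on G V s T u"
          unfolding mild_on_def
        proof (intro conjI allI impI uc)
          fix r t' assume r: "0 < r" "r < t'" "t' \<le> T"
          show "((\<lambda>r. G (t' - r) (u r)) has_vector_derivative G (t' - r) (mult_l2 (V (s + r)) (u r))) (at r)"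
          proof (rule duhamel[OF cs bounded_linear_ident _ _ uc, where d = "\<lambda>r. laplacian (u r)"])
            show "continuous_on {0..T} (\<lambda>r. mult_l2 (V (s + r)) (u r))"
              by (intro bounded_bilinear.continuous_on[OF bounded_bilinear_mult_l2] uc
                  continuous_on_compose2[OF Vc] continuous_intros) auto
            fix r assume r: "0 \<le> r" "r < T"
            show "(u r, laplacian (u r)) \<in> generator G"
              using G v'(2)[of "s + r"] r by (auto simp: heat_semigroup_def u_def)
            have "((\<lambda>t. U t s y) has_vector_derivative v' (s + r)) (at (s + r) within {s..s + T})"
              using v'(1)[of "s + r"] r by (auto intro: has_vector_derivative_within_subset)
            from right_derivativeI[OF this]
            show "((\<lambda>h. (u (r + h) - u r) /\<^sub>R h) \<longlongrightarrow> laplacian (u r) + mult_l2 (V (s + r)) (u r)) (at_right 0)"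
              using r v'(3)[of "s + r"] by (simp add: u_def add.assoc)
          qed (use r in auto)
        qed
        have "norm (u T - P (u 0)) \<le> e * (C1 * norm y)"
          unfolding P_def
        proof (rule est[OF n T mild])
          show "norm (u r) \<le> C1 * norm y" if "0 \<le> r" "r \<le> T" for r
            unfolding u_def using that T by (intro Ubd) auto
        qed (use T in \<open>auto simp: divide_right_mono mult_right_mono\<close>)
        then show ?thesis by (simp add: u_def T_def Uid)
      qed
      have "norm (U t s u0 - P u0) \<le> e * (C1 * norm u0)"
      proof -
        \<comment> \<open>For fixed \<open>n\<close> the inequality is closed in \<open>y\<close>.
          Since \<open>n\<close> was chosen independently of \<open>y\<close>, it passes from the
          dense set of classical initial values to \<open>u0\<close>.\<close>
        have "{y. classical_solution V s (\<lambda>t. U t s y)} \<subseteq> {y. norm (U t s y - P y) \<le> e * (C1 * norm y)}"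
          using est_classical by blast
        moreover have "closed {y. norm (U t s y - P y) \<le> e * (C1 * norm y)}"
          using linear_continuous_on[OF Ubl[OF Tb(1)[OF ts]]] linear_continuous_on[OF P]
          by (intro closed_Collect_le continuous_intros) auto
        ultimately show ?thesis using closure_minimal dense[of s] by blast
      qed
      also note eC
      finally show ?thesis by (simp add: P_def splitting_def T_def)
    qed
    show "\<forall>\<^sub>F n in sequentially. \<forall>x\<in>K. dist (case x of (t, s) \<Rightarrow> norm (U t s u0 - time_ordered_prod
        (\<lambda>p u. mult_l2 (exp_linf (((t - s) / real n) *\<^sub>R V (s + real p * (t - s) / real n)))
                 (G ((t - s) / real n) u)) n u0)) 0 < \<epsilon>"
      using eventually_ge_at_top[of N] by eventually_elim (use main in \<open>auto simp: dist_real_def\<close>)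
  qed
qed

section \<open>Bounded uniformly continuous functions\<close>

lemma BUC_D:
  assumes "f \<in> BUC"
  shows "bdd_above (range (\<lambda>s. norm (f s)))" "uniformly_continuous_on UNIV f" "continuous_on UNIV f"
  using assms by (auto simp: BUC_def bounded_iff bdd_above_def intro: uniformly_continuous_imp_continuous)

lemma norm_le_buc_norm: "f \<in> BUC \<Longrightarrow> norm (f s) \<le> buc_norm f"
  unfolding buc_norm_def by (rule cSUP_upper[OF UNIV_I BUC_D(1)])

lemma buc_norm_nonneg: "f \<in> BUC \<Longrightarrow> buc_norm f \<ge> 0"
  using norm_le_buc_norm[of f 0] norm_ge_zero order_trans by blast

lemma buc_norm_le: "(\<And>s. norm (f s) \<le> c) \<Longrightarrow> buc_norm f \<le> c"
  unfolding buc_norm_def by (rule cSUP_least) auto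

lemma BUC_add:
  assumes "f \<in> BUC" "g \<in> BUC"
  shows "(\<lambda>s. f s + g s) \<in> BUC"
  using assms bounded_plus_comp[of f UNIV g]
  by (auto simp: BUC_def intro: uniformly_continuous_on_add)

lemma BUC_bounded_linear:
  assumes T: "bounded_linear T" and f: "f \<in> BUC"
  shows "(\<lambda>s. T (f s)) \<in> BUC"
proof -
  have "bounded (range (\<lambda>s. T (f s)))"
    using bounded_linear_image[OF _ T, of "range f"] f by (simp add: BUC_def image_image)
  moreover have "uniformly_continuous_on UNIV (\<lambda>s. T (f s))"
    using bounded_linear.uniformly_continuous_on[OF T] f by (auto simp: BUC_def)
  ultimately show ?thesis by (simp add: BUC_def)
qed

lemma BUC_scaleR: "f \<in> BUC \<Longrightarrow> (\<lambda>s. c *\<^sub>R f s) \<in> BUC"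
  by (rule BUC_bounded_linear[OF bounded_linear_scaleR_right])

lemma BUC_diff: "f \<in> BUC \<Longrightarrow> g \<in> BUC \<Longrightarrow> (\<lambda>s. f s - g s) \<in> BUC"
  using BUC_add[OF _ BUC_scaleR[of g "-1"], of f] by simp

lemma BUC_shift:
  assumes f: "f \<in> BUC"
  shows "(\<lambda>s. f (s - a)) \<in> BUC"
proof -
  have "bounded (range (\<lambda>s. f (s - a)))"
    by (rule bounded_subset[of "range f"]) (use f in \<open>auto simp: BUC_def\<close>)
  moreover have "uniformly_continuous_on UNIV (\<lambda>s. f (s - a))"
    using BUC_D(2)[OF f] unfolding uniformly_continuous_on_def
    by (auto simp: dist_real_def) (metis add_diff_cancel_right diff_diff_eq2 diff_add_cancel diff_diff_eq)
  ultimately show ?thesis by (simp add: BUC_def)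
qed

text \<open>Along a characteristic the evaluation point moves with the limit parameter; uniformity
  near \<open>x0\<close> together with continuity of the limit permits this.\<close>

lemma loc_uniform_limit_tendsto:
  assumes lim: "loc_uniform_limit F f net" and f: "continuous_on UNIV f" and x: "(x \<longlongrightarrow> x0) net"
  shows "((\<lambda>i. F i (x i)) \<longlongrightarrow> f x0) net"
proof (rule tendstoI)
  fix e :: real assume e: "e > 0"
  have "uniform_limit (cball x0 1) F f net" using lim by (simp add: loc_uniform_limit_def)
  then have "\<forall>\<^sub>F i in net. \<forall>y\<in>cball x0 1. dist (F i y) (f y) < e / 2" using e by (intro uniform_limitD) auto
  moreover have "\<forall>\<^sub>F i in net. dist (x i) x0 < 1" using x by (rule tendstoD) simp
  moreover have "((\<lambda>i. f (x i)) \<longlongrightarrow> f x0) net" using f x by (rule continuous_on_tendsto_compose) auto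
  then have "\<forall>\<^sub>F i in net. dist (f (x i)) (f x0) < e / 2" using e by (intro tendstoD) auto
  ultimately show "\<forall>\<^sub>F i in net. dist (F i (x i)) (f x0) < e"
  proof eventually_elim
    case (elim i)
    then have "dist (F i (x i)) (f (x i)) < e / 2" by (simp add: dist_commute)
    then show ?case using elim dist_triangle[of "F i (x i)" "f x0" "f (x i)"] by linarith
  qed
qed

text \<open>
  Regularisation in two steps: a moving average in \<open>s\<close> makes \<open>f\<close> continuously differentiable, the
  average of the heat semigroup moves its values into the domain of \<open>\<Delta>\<close>.
\<close>

definition moving_average :: "real \<Rightarrow> (real \<Rightarrow> 'x::banach) \<Rightarrow> real \<Rightarrow> 'x" where
  "moving_average \<delta> f s = integral {s - \<delta>..s} f /\<^sub>R \<delta>"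

lemma moving_average_deriv:
  assumes f: "continuous_on UNIV f" and \<delta>: "\<delta> > 0"
  shows "(moving_average \<delta> f has_vector_derivative (f s - f (s - \<delta>)) /\<^sub>R \<delta>) (at s)"
proof -
  \<comment> \<open>A base point to the left of both \<open>x\<close> and
    \<open>x - \<delta>\<close> for all \<open>x > s - 1\<close>, so one antiderivative serves both
    ends of the window.\<close>
  define c where "c = s - \<delta> - 1"
  have int: "f integrable_on {a..b}" for a b
    by (intro integrable_continuous_real continuous_on_subset[OF f]) auto
  define F where "F x = integral {c..x} f" for x
  have F: "(F has_vector_derivative f x) (at x)" if "c < x" for x
  proof -
    have "(F has_vector_derivative f x) (at x within {c..x + 1})"
      unfolding F_def by (rule integral_has_vector_derivative) (use that in \<open>auto intro: continuous_on_subset[OF f]\<close>)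
    moreover have "at x within {c..x + 1} = at x" using that by (intro at_within_interior) auto
    ultimately show ?thesis by simp
  qed
  have shift: "((\<lambda>x. F (x - \<delta>)) has_vector_derivative f (s - \<delta>)) (at s)"
  proof -
    have "((\<lambda>x. x - \<delta>) has_vector_derivative 1) (at s)" by (auto intro!: derivative_eq_intros)
    moreover have "(F has_vector_derivative f (s - \<delta>)) (at (s - \<delta>))" by (rule F) (simp add: c_def)
    ultimately show ?thesis using vector_diff_chain_at[of "\<lambda>x. x - \<delta>" 1 s F] by (simp add: o_def)
  qed
  have "((\<lambda>x. (F x - F (x - \<delta>)) /\<^sub>R \<delta>) has_vector_derivative (f s - f (s - \<delta>)) /\<^sub>R \<delta>) (at s)"
    using F[of s] shift \<delta> by (auto intro!: derivative_eq_intros simp: c_def)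
  then show ?thesis
  proof (rule has_vector_derivative_transform_within_open[where S = "{s - 1<..}"])
    fix x assume "x \<in> {s - 1<..}"
    then have "F (x - \<delta>) + integral {x - \<delta>..x} f = F x"
      unfolding F_def using \<delta> int by (intro Henstock_Kurzweil_Integration.integral_combine) (auto simp: c_def)
    then have "integral {x - \<delta>..x} f = F x - F (x - \<delta>)" by (simp add: algebra_simps)
    then show "(F x - F (x - \<delta>)) /\<^sub>R \<delta> = moving_average \<delta> f x"
      by (simp add: moving_average_def)
  qed auto
qed

lemma moving_average_diff_le:
  assumes f: "continuous_on UNIV f" and \<delta>: "\<delta> > 0" and e: "\<And>r. s - \<delta> \<le> r \<Longrightarrow> r \<le> s \<Longrightarrow> norm (f r - c) \<le> e"
  shows "norm (moving_average \<delta> f s - c) \<le> e"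
proof -
  have c: "continuous_on {s - \<delta>..s} (\<lambda>r. f r - c)"
    by (intro continuous_intros continuous_on_subset[OF f]) auto
  have "norm (integral {s - \<delta>..s} (\<lambda>r. f r - c)) \<le> e * (s - (s - \<delta>))"
    by (rule integral_bound[OF _ c]) (use e \<delta> in auto)
  moreover have "integral {s - \<delta>..s} (\<lambda>r. f r - c) = \<delta> *\<^sub>R (moving_average \<delta> f s - c)"
  proof -
    have "f integrable_on {s - \<delta>..s}"
      by (intro integrable_continuous_real continuous_on_subset[OF f]) auto
    then have "integral {s - \<delta>..s} (\<lambda>r. f r - c) = integral {s - \<delta>..s} f - integral {s - \<delta>..s} (\<lambda>r. c)"
      by (intro Henstock_Kurzweil_Integration.integral_diff) auto
    then show ?thesis using \<delta> by (simp add: moving_average_def scaleR_diff_right)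
  qed
  ultimately show ?thesis using \<delta> by (simp add: mult.commute)
qed

text \<open>The derivative is bounded by \<open>2 * buc_norm f / \<delta>\<close>, which makes the
  average Lipschitz.\<close>

lemma moving_average_BUC:
  assumes f: "f \<in> BUC" and \<delta>: "\<delta> > 0"
  shows "moving_average \<delta> f \<in> BUC"
proof -
  note cont = BUC_D(3)[OF f]
  have b: "norm (moving_average \<delta> f s) \<le> buc_norm f" for s
    using moving_average_diff_le[OF cont \<delta>, of s 0 "buc_norm f"] norm_le_buc_norm[OF f] by simp
  define L where "L = 2 * buc_norm f / \<delta> + 1"
  have L: "L > 0" using buc_norm_nonneg[OF f] \<delta> by (simp add: L_def add_nonneg_pos)
  have lip: "norm (moving_average \<delta> f x - moving_average \<delta> f y) \<le> L * norm (x - y)" for x y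
  proof (rule differentiable_bound[where S = UNIV and f' = "\<lambda>s h. h *\<^sub>R ((f s - f (s - \<delta>)) /\<^sub>R \<delta>)"])
    fix s
    show "(moving_average \<delta> f has_derivative (\<lambda>h. h *\<^sub>R ((f s - f (s - \<delta>)) /\<^sub>R \<delta>))) (at s within UNIV)"
      using moving_average_deriv[OF cont \<delta>, of s] by (simp add: has_vector_derivative_def)
    have "norm (f s - f (s - \<delta>)) \<le> 2 * buc_norm f"
      using norm_triangle_ineq4[of "f s" "f (s - \<delta>)"] norm_le_buc_norm[OF f, of s] norm_le_buc_norm[OF f, of "s - \<delta>"]
      by linarith
    then have "norm ((f s - f (s - \<delta>)) /\<^sub>R \<delta>) \<le> L"
      using \<delta> by (simp add: L_def divide_inverse mult.commute mult_left_mono add_increasing2)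
    then have "norm (h *\<^sub>R ((f s - f (s - \<delta>)) /\<^sub>R \<delta>)) \<le> L * norm h" for h :: real
      by (subst norm_scaleR, subst mult.commute) (auto intro: mult_right_mono)
    then show "onorm (\<lambda>h. h *\<^sub>R ((f s - f (s - \<delta>)) /\<^sub>R \<delta>)) \<le> L"
      by (rule onorm_le)
  qed auto
  have "uniformly_continuous_on UNIV (moving_average \<delta> f)"
    unfolding uniformly_continuous_on_def
  proof (intro allI impI)
    fix e :: real assume e: "e > 0"
    have "dist (moving_average \<delta> f x') (moving_average \<delta> f x) < e" if "dist x' x < e / L" for x x'
      using lip[of x' x] that L by (simp add: dist_norm pos_less_divide_eq mult.commute)
    then show "\<exists>d>0. \<forall>x\<in>UNIV. \<forall>x'\<in>UNIV. dist x' x < d \<longrightarrow> dist (moving_average \<delta> f x') (moving_average \<delta> f x) < e"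
      using e L by (intro exI[of _ "e / L"]) auto
  qed
  then show ?thesis using b by (auto simp: BUC_def bounded_iff)
qed

section \<open>Regularisation into the domain of the evolution operator\<close>

context contraction_semigroup
begin

text \<open>The averages are contractions, so convergence at the finitely many centres of an
  \<open>e / 3\<close> net suffices.\<close>

lemma mean_uniform_on_compact:
  assumes K: "compact K" and e: "e > 0"
  shows "\<forall>\<^sub>F \<delta> in at_right 0. \<forall>x\<in>K. norm (mean \<delta> x - x) < e"
proof -
  obtain k where k: "finite k" "K \<subseteq> (\<Union>x\<in>k. ball x (e / 3))"
    using K e unfolding compact_eq_totally_bounded by (metis divide_pos_pos zero_less_numeral)
  have "\<forall>\<^sub>F \<delta> in at_right 0. \<forall>y\<in>k. dist (mean \<delta> y) y < e / 3"
    using e k(1) by (intro eventually_ball_finite ballI tendstoD[OF mean_tendsto]) auto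
  then show ?thesis using eventually_at_right_less[of 0]
  proof eventually_elim
    case (elim \<delta>)
    show ?case
    proof
      fix x assume "x \<in> K"
      then obtain y where y: "y \<in> k" "dist y x < e / 3" using k(2) by auto
      have "mean \<delta> x - x = mean \<delta> (x - y) + (mean \<delta> y - y) + (y - x)"
        by (simp add: linear_diff[OF mean_linear])
      moreover have "norm (mean \<delta> (x - y)) \<le> norm (x - y)" by (rule mean_bound[OF elim(2)])
      moreover have "norm (mean \<delta> y - y) < e / 3" using elim(1) y(1) by (auto simp: dist_norm)
      moreover have "norm (x - y) < e / 3" "norm (y - x) < e / 3"
        using y(2) by (auto simp: dist_norm norm_minus_commute)
      moreover have "norm (mean \<delta> (x - y) + (mean \<delta> y - y) + (y - x))
          \<le> norm (mean \<delta> (x - y)) + norm (mean \<delta> y - y) + norm (y - x)"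
        by (intro norm_triangle_le add_mono) auto
      ultimately show "norm (mean \<delta> x - x) < e" by simp
    qed
  qed
qed

definition regularization :: "real \<Rightarrow> (real \<Rightarrow> 'a) \<Rightarrow> real \<Rightarrow> 'a" where
  "regularization \<delta> f s = mean \<delta> (moving_average \<delta> f s)"

lemma regularization_BUC: "f \<in> BUC \<Longrightarrow> \<delta> > 0 \<Longrightarrow> regularization \<delta> f \<in> BUC"
  unfolding regularization_def[abs_def]
  by (intro BUC_bounded_linear[OF mean_bounded_linear] moving_average_BUC)

lemma regularization_bound:
  assumes "f \<in> BUC" "\<delta> > 0"
  shows "buc_norm (regularization \<delta> f) \<le> buc_norm f"
proof (rule buc_norm_le)
  fix s
  have "norm (moving_average \<delta> f s) \<le> buc_norm f"
    using moving_average_diff_le[OF BUC_D(3)[OF assms(1)] assms(2), of s 0 "buc_norm f"]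
      norm_le_buc_norm[OF assms(1)] by simp
  then show "norm (regularization \<delta> f s) \<le> buc_norm f"
    using mean_bound[OF assms(2), of "moving_average \<delta> f s"] by (simp add: regularization_def)
qed

text \<open>The moving average converges uniformly by uniform continuity. The average of the heat
  semigroup converges uniformly only on compact sets of vectors, here the image of \<open>K\<close>;
  hence the locally uniform statement.\<close>

lemma regularization_limit:
  assumes f: "f \<in> BUC"
  shows "loc_uniform_limit (\<lambda>\<delta>. regularization \<delta> f) f (at_right 0)"
  unfolding loc_uniform_limit_def
proof (intro allI impI uniform_limitI)
  fix K :: "real set" and e :: real assume K: "compact K" and e: "e > 0"
  obtain \<eta> where \<eta>: "\<eta> > 0" "\<And>x y. dist x y < \<eta> \<Longrightarrow> dist (f x) (f y) < e / 3"
    using BUC_D(2)[OF f] e unfolding uniformly_continuous_on_def by (metis UNIV_I divide_pos_pos zero_less_numeral)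
  have "compact (f ` K)" using K by (intro compact_continuous_image continuous_on_subset[OF BUC_D(3)[OF f]]) auto
  then have "\<forall>\<^sub>F \<delta> in at_right 0. \<forall>x\<in>f ` K. norm (mean \<delta> x - x) < e / 3"
    using e by (intro mean_uniform_on_compact) auto
  moreover have "\<forall>\<^sub>F \<delta> in at_right (0::real). 0 < \<delta> \<and> \<delta> < \<eta>"
    using \<eta> by (auto simp: eventually_at_right_field intro!: exI[of _ \<eta>])
  ultimately show "\<forall>\<^sub>F \<delta> in at_right 0. \<forall>s\<in>K. dist (regularization \<delta> f s) (f s) < e"
  proof eventually_elim
    case (elim \<delta>)
    then have \<delta>: "\<delta> > 0" "\<delta> < \<eta>" by auto
    show ?case
    proof
      fix s assume s: "s \<in> K"
      have "norm (moving_average \<delta> f s - f s) \<le> e / 3"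
      proof (rule moving_average_diff_le[OF BUC_D(3)[OF f] \<delta>(1)])
        fix r assume "s - \<delta> \<le> r" "r \<le> s"
        then have "dist r s < \<eta>" using \<delta> by (simp add: dist_real_def)
        then show "norm (f r - f s) \<le> e / 3" using \<eta>(2)[of r s] by (simp add: dist_norm)
      qed
      then have "norm (mean \<delta> (moving_average \<delta> f s - f s)) \<le> e / 3"
        using mean_bound[OF \<delta>(1)] order_trans by blast
      moreover have "norm (mean \<delta> (f s) - f s) < e / 3" using elim s by auto
      moreover have eq: "regularization \<delta> f s - f s = mean \<delta> (moving_average \<delta> f s - f s) + (mean \<delta> (f s) - f s)"
        by (simp add: regularization_def linear_diff[OF mean_linear])
      ultimately have "norm (regularization \<delta> f s - f s) < e"
        unfolding eq using norm_triangle_ineq[of "mean \<delta> (moving_average \<delta> f s - f s)" "mean \<delta> (f s) - f s"] e by linarith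
      then show "dist (regularization \<delta> f s) (f s) < e" by (simp add: dist_norm)
    qed
  qed
qed

text \<open>On a regularised function both parts of the operator become bounded: the time derivative
  is a difference of \<open>f\<close> over distance \<open>\<delta>\<close>, the Laplacian a
  difference of the heat semigroup over time \<open>\<delta>\<close>. Each is again in
  \<open>BUC\<close> with values in the original space.\<close>

lemma regularization_domain:
  fixes j :: "'a \<Rightarrow> 'b::banach"
  assumes f: "f \<in> BUC" and \<delta>: "\<delta> > 0" and ex: "extrapolation G j G1"
  shows "\<exists>g. (regularization \<delta> f, g) \<in> evolution_operator j G1"
proof -
  note j = extrapolation_bounded_linear[OF ex]
  note cont = BUC_D(3)[OF f]
  define \<phi> where "\<phi> = moving_average \<delta> f"
  define \<phi>' where "\<phi>' s = (f s - f (s - \<delta>)) /\<^sub>R \<delta>" for s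
  define \<psi>' where "\<psi>' s = mean \<delta> (\<phi>' s)" for s
  define a where "a s = (G \<delta> (\<phi> s) - \<phi> s) /\<^sub>R \<delta>" for s
  have \<phi>: "\<phi> \<in> BUC" unfolding \<phi>_def by (rule moving_average_BUC[OF f \<delta>])
  have "\<phi>' \<in> BUC" unfolding \<phi>'_def by (intro BUC_scaleR BUC_diff BUC_shift f)
  then have \<psi>': "\<psi>' \<in> BUC" unfolding \<psi>'_def by (intro BUC_bounded_linear[OF mean_bounded_linear[OF \<delta>]])
  have a: "a \<in> BUC" unfolding a_def
    by (intro BUC_scaleR BUC_diff BUC_bounded_linear[OF G_bounded_linear] \<phi>) (use \<delta> in auto)
  have "(\<phi> has_vector_derivative \<phi>' s) (at s)" for s
    unfolding \<phi>_def \<phi>'_def by (rule moving_average_deriv[OF cont \<delta>])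
  then have \<psi>d: "((\<lambda>s. j (regularization \<delta> f s)) has_vector_derivative j (\<psi>' s)) (at s)" for s
    unfolding regularization_def \<phi>_def[symmetric] \<psi>'_def
    by (intro bounded_linear.has_vector_derivative[OF j]
        bounded_linear.has_vector_derivative[OF mean_bounded_linear[OF \<delta>]])
  have gen: "(j (regularization \<delta> f s), j (a s)) \<in> generator G1" for s
  proof -
    let ?x = "regularization \<delta> f s"
    have "(?x, a s) \<in> generator G"
      unfolding regularization_def \<phi>_def[symmetric] a_def by (rule mean_generator[OF \<delta>])
    then have "((\<lambda>h. j ((G h ?x - ?x) /\<^sub>R h)) \<longlongrightarrow> j (a s)) (at_right 0)"
      by (intro bounded_linear.tendsto[OF j]) (simp add: generator_def)
    moreover have "\<forall>\<^sub>F h in at_right 0. j ((G h ?x - ?x) /\<^sub>R h) = (G1 h (j ?x) - j ?x) /\<^sub>R h"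
      using eventually_at_right_less[of 0]
      by eventually_elim (use bounded_linear.linear[OF j] in
          \<open>simp add: extrapolation_intertwine[OF ex] linear_diff linear_scale\<close>)
    ultimately show ?thesis unfolding generator_def by (auto intro: Lim_transform_eventually)
  qed
  have 1: "(\<lambda>s. a s - \<psi>' s) \<in> BUC" by (intro BUC_diff a \<psi>')
  have 2: "(\<lambda>s. j (regularization \<delta> f s)) \<in> BUC" "(\<lambda>s. j (\<psi>' s)) \<in> BUC"
    using regularization_BUC[OF f \<delta>] \<psi>' by (auto intro: BUC_bounded_linear[OF j])
  have "j (a s - \<psi>' s) = - j (\<psi>' s) + j (a s)" for s
    using bounded_linear.linear[OF j] by (simp add: linear_diff)
  then have "(regularization \<delta> f, \<lambda>s. a s - \<psi>' s) \<in> evolution_operator j G1"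
    unfolding evolution_operator_def
    by (intro CollectI case_prodI conjI exI[of _ "\<lambda>s. j (\<psi>' s)"] exI[of _ "\<lambda>s. j (a s)"] allI
        regularization_BUC[OF f \<delta>] 1 2 \<psi>d gen)
  then show ?thesis by blast
qed

end

section \<open>Orbits of bi-continuous semigroups\<close>

locale bicontinuous =
  fixes W :: "real \<Rightarrow> (real \<Rightarrow> 'a::banach) \<Rightarrow> (real \<Rightarrow> 'a)"
  assumes W: "bicontinuous_semigroup W"
begin

lemma W_BUC: "t \<ge> 0 \<Longrightarrow> f \<in> BUC \<Longrightarrow> W t f \<in> BUC"
  using W by (simp add: bicontinuous_semigroup_def)

lemma W_0: "f \<in> BUC \<Longrightarrow> W 0 f = f"
  using W by (simp add: bicontinuous_semigroup_def)

lemma W_add: "t \<ge> 0 \<Longrightarrow> r \<ge> 0 \<Longrightarrow> f \<in> BUC \<Longrightarrow> W (t + r) f = W t (W r f)"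
  using W by (simp add: bicontinuous_semigroup_def)

lemma W_lincomb:
  "t \<ge> 0 \<Longrightarrow> f \<in> BUC \<Longrightarrow> g \<in> BUC \<Longrightarrow> W t (\<lambda>s. f s + c *\<^sub>R g s) = (\<lambda>s. W t f s + c *\<^sub>R W t g s)"
  using W by (simp add: bicontinuous_semigroup_def)

lemma W_diff: "t \<ge> 0 \<Longrightarrow> f \<in> BUC \<Longrightarrow> g \<in> BUC \<Longrightarrow> W t (\<lambda>s. f s - g s) = (\<lambda>s. W t f s - W t g s)"
  using W_lincomb[of t f g "-1"] by simp

lemma W_scaleR:
  assumes "t \<ge> 0" "f \<in> BUC"
  shows "W t (\<lambda>s. c *\<^sub>R f s) = (\<lambda>s. c *\<^sub>R W t f s)"
  using W_lincomb[OF assms assms(2), of "c - 1"] by (simp add: scaleR_diff_left)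

lemma W_bound:
  obtains M \<omega> where "M \<ge> 0" "\<And>t f. t \<ge> 0 \<Longrightarrow> f \<in> BUC \<Longrightarrow> buc_norm (W t f) \<le> M * exp (\<omega> * t) * buc_norm f"
proof -
  have "\<exists>M \<omega>. \<forall>t\<ge>0. \<forall>f\<in>BUC. buc_norm (W t f) \<le> M * exp (\<omega> * t) * buc_norm f"
    using W unfolding bicontinuous_semigroup_def by (elim conjE)
  then obtain M \<omega> where M': "\<forall>t\<ge>0. \<forall>f\<in>BUC. buc_norm (W t f) \<le> M * exp (\<omega> * t) * buc_norm f"
    by (elim exE)
  have M: "buc_norm (W t f) \<le> M * exp (\<omega> * t) * buc_norm f" if "t \<ge> 0" "f \<in> BUC" for t f
    using M' that by simp
  show thesis
  proof (rule that[of "\<bar>M\<bar>"])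
    fix t :: real and f :: "real \<Rightarrow> 'a" assume t: "t \<ge> 0" and f: "f \<in> BUC"
    have "M * exp (\<omega> * t) * buc_norm f \<le> \<bar>M\<bar> * exp (\<omega> * t) * buc_norm f"
      by (intro mult_right_mono buc_norm_nonneg f) auto
    then show "buc_norm (W t f) \<le> \<bar>M\<bar> * exp (\<omega> * t) * buc_norm f" using M[OF t f] by linarith
  qed simp
qed

lemma W_orbit_limit: "f \<in> BUC \<Longrightarrow> t \<ge> 0 \<Longrightarrow> loc_uniform_limit (\<lambda>r. W r f) (W t f) (at t within {0..})"
  using W by (simp add: bicontinuous_semigroup_def)

lemma W_null_sequence:
  assumes "\<And>n. F n \<in> BUC" "\<And>n. buc_norm (F n) \<le> C" "loc_uniform_limit F (\<lambda>_. 0) sequentially"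
    and t: "t \<ge> 0"
  shows "loc_uniform_limit (\<lambda>n. W t (F n)) (\<lambda>_. 0) sequentially"
  unfolding loc_uniform_limit_def
proof (intro allI impI)
  fix K :: "real set" assume K: "compact K"
  have "\<forall>F. (\<forall>n. F n \<in> BUC) \<and> (\<exists>C. \<forall>n. buc_norm (F n) \<le> C) \<and> loc_uniform_limit F (\<lambda>_. 0) sequentially \<longrightarrow>
        (\<forall>b K. compact K \<longrightarrow> uniform_limit ({0..b} \<times> K) (\<lambda>n (t, s). W t (F n) s) (\<lambda>_. 0) sequentially)"
    using W unfolding bicontinuous_semigroup_def by (elim conjE)
  from this[rule_format, of F K t]
  have "uniform_limit ({0..t} \<times> K) (\<lambda>n (t, s). W t (F n) s) (\<lambda>_. 0) sequentially"
    using assms K by blast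
  then have "uniform_limit ({t} \<times> K) (\<lambda>n (t, s). W t (F n) s) (\<lambda>_. 0) sequentially"
    by (rule uniform_limit_on_subset) (use t in auto)
  then show "uniform_limit K (\<lambda>n. W t (F n)) (\<lambda>_. 0) sequentially"
    by (simp add: uniform_limit_iff)
qed

text \<open>\<open>W r\<close> respects locally uniform limits only along bounded sequences. The
  limit of the quotients is therefore tested on sequences of increments, where the bound built into
  the generator applies.\<close>

lemma generator_invariant:
  assumes fg: "(f, g) \<in> bicontinuous_generator W" and r: "r \<ge> 0"
  shows "(W r f, W r g) \<in> bicontinuous_generator W"
proof -
  have f: "f \<in> BUC" and g: "g \<in> BUC" using fg by (auto simp: bicontinuous_generator_def)
  obtain C where C': "\<forall>h\<in>{0<..1}. buc_norm (\<lambda>s. (W h f s - f s) /\<^sub>R h) \<le> C"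
    and lim: "loc_uniform_limit (\<lambda>h s. (W h f s - f s) /\<^sub>R h) g (at_right 0)"
    using fg by (auto simp: bicontinuous_generator_def)
  from C' have C: "buc_norm (\<lambda>s. (W h f s - f s) /\<^sub>R h) \<le> C" if "0 < h" "h \<le> 1" for h
    using that by auto
  define q where "q h s = (W h f s - f s) /\<^sub>R h" for h s
  have q: "q h \<in> BUC" if "h > 0" for h
    unfolding q_def using that by (intro BUC_scaleR BUC_diff W_BUC f) auto
  have Wq: "(\<lambda>s. (W h (W r f) s - W r f s) /\<^sub>R h) = W r (q h)" if h: "h > 0" for h
  proof -
    have "W h (W r f) = W r (W h f)"
      using W_add[of h r f] W_add[of r h f] h r f by (simp add: add.commute)
    then show ?thesis
      unfolding q_def using h r by (simp add: W_scaleR W_diff BUC_diff W_BUC f)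
  qed
  obtain M \<omega> where M: "M \<ge> 0" "\<And>t f. t \<ge> 0 \<Longrightarrow> f \<in> BUC \<Longrightarrow> buc_norm (W t f) \<le> M * exp (\<omega> * t) * buc_norm f"
    using W_bound by blast
  have bdd: "buc_norm (\<lambda>s. (W h (W r f) s - W r f s) /\<^sub>R h) \<le> M * exp (\<omega> * r) * C" if h: "0 < h" "h \<le> 1" for h
  proof -
    have "buc_norm (W r (q h)) \<le> M * exp (\<omega> * r) * buc_norm (q h)" by (rule M(2)[OF r q[OF h(1)]])
    also have "\<dots> \<le> M * exp (\<omega> * r) * C"
      using C[OF h] M(1) by (intro mult_left_mono) (auto simp: q_def[abs_def])
    finally show ?thesis by (simp add: Wq[OF h(1)])
  qed
  have "loc_uniform_limit (\<lambda>h s. (W h (W r f) s - W r f s) /\<^sub>R h) (W r g) (at_right 0)"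
    unfolding loc_uniform_limit_def
  proof (intro allI impI uniform_limitI)
    fix K :: "real set" and e :: real assume K: "compact K" and e: "e > 0"
    show "\<forall>\<^sub>F h in at_right 0. \<forall>s\<in>K. dist ((W h (W r f) s - W r f s) /\<^sub>R h) (W r g s) < e"
    proof (rule sequentially_imp_eventually_at_right[OF zero_less_one])
      fix X :: "nat \<Rightarrow> real" assume X: "\<And>n. 0 < X n" "\<And>n. X n < 1" "X \<longlonglongrightarrow> 0"
      define F where "F n s = q (X n) s - g s" for n s
      have F: "F n \<in> BUC" for n unfolding F_def by (intro BUC_diff q g X)
      have "buc_norm (F n) \<le> C + buc_norm g" for n
      proof (rule buc_norm_le)
        fix s
        have "norm (q (X n) s) \<le> C"
          using norm_le_buc_norm[OF q[OF X(1)], of n s] C[OF X(1) less_imp_le[OF X(2)]]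
          unfolding q_def[abs_def] by (rule order_trans)
        then show "norm (F n s) \<le> C + buc_norm g"
          using norm_le_buc_norm[OF g, of s] norm_triangle_ineq4[of "q (X n) s" "g s"] by (simp add: F_def)
      qed
      moreover have "loc_uniform_limit F (\<lambda>_. 0) sequentially"
        unfolding loc_uniform_limit_def
      proof (intro allI impI uniform_limitI)
        fix K :: "real set" and e :: real assume K: "compact K" and e: "e > 0"
        have "\<forall>\<^sub>F h in at_right 0. \<forall>s\<in>K. dist (q h s) (g s) < e"
          using lim K e by (auto simp: loc_uniform_limit_def uniform_limit_iff q_def)
        moreover have "filterlim X (at_right 0) sequentially"
          using X by (intro filterlim_at_withinI) auto
        ultimately have "\<forall>\<^sub>F n in sequentially. \<forall>s\<in>K. dist (q (X n) s) (g s) < e"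
          by (rule eventually_compose_filterlim)
        then show "\<forall>\<^sub>F n in sequentially. \<forall>s\<in>K. dist (F n s) 0 < e"
          by (simp add: F_def dist_norm)
      qed
      ultimately have "loc_uniform_limit (\<lambda>n. W r (F n)) (\<lambda>_. 0) sequentially"
        by (intro W_null_sequence F r)
      then have "\<forall>\<^sub>F n in sequentially. \<forall>s\<in>K. dist (W r (F n) s) 0 < e"
        using K e by (auto simp: loc_uniform_limit_def uniform_limit_iff)
      then show "\<forall>\<^sub>F n in sequentially. \<forall>s\<in>K. dist ((W (X n) (W r f) s - W r f s) /\<^sub>R X n) (W r g s) < e"
      proof eventually_elim
        case (elim n)
        have "W r (F n) = (\<lambda>s. W r (q (X n)) s - W r g s)"
          unfolding F_def using r by (intro W_diff q X g)
        then show ?case using elim fun_cong[OF Wq[OF X(1)[of n]]] by (simp add: dist_norm)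
      qed
    qed
  qed
  moreover have "\<exists>C. \<forall>h\<in>{0<..1}. buc_norm (\<lambda>s. (W h (W r f) s - W r f s) /\<^sub>R h) \<le> C"
    by (rule exI[of _ "M * exp (\<omega> * r) * C"]) (use bdd in auto)
  ultimately show ?thesis
    using W_BUC[OF r f] W_BUC[OF r g] unfolding bicontinuous_generator_def by blast
qed

lemma orbit_continuous:
  assumes f: "f \<in> BUC"
  shows "continuous_on {0..} (\<lambda>r. W r f (\<sigma> + r))"
  unfolding continuous_on_def
proof
  fix t :: real assume t: "t \<in> {0..}"
  show "((\<lambda>r. W r f (\<sigma> + r)) \<longlongrightarrow> W t f (\<sigma> + t)) (at t within {0..})"
    by (rule loc_uniform_limit_tendsto[OF W_orbit_limit[OF f]])
      (use t BUC_D(3)[OF W_BUC[OF _ f]] in \<open>auto intro!: tendsto_intros\<close>)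
qed

end

section \<open>The perturbed evolution semigroup\<close>

text \<open>The increment along the characteristic is a time increment, evaluated at the advanced
  point, plus a space increment of the fixed function \<open>W r f\<close>. Only the latter needs
  the embedding, since differentiability in space is known in the larger space alone.\<close>

lemma (in bicontinuous) orbit_right_derivative_embedded:
  fixes j :: "'a \<Rightarrow> 'b::banach"
  assumes fg: "(f, g) \<in> bicontinuous_generator W" and r: "r \<ge> 0" and j: "bounded_linear j"
    and jD: "((\<lambda>x. j (W r f x)) has_vector_derivative f') (at (\<sigma> + r))"
  shows "((\<lambda>h. (j (W (r + h) f (\<sigma> + (r + h))) - j (W r f (\<sigma> + r))) /\<^sub>R h)
      \<longlongrightarrow> j (W r g (\<sigma> + r)) + f') (at_right 0)"
proof -
  define x where "x = \<sigma> + r"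
  have f: "f \<in> BUC" and g: "g \<in> BUC" using fg by (auto simp: bicontinuous_generator_def)
  define q where "q h s = (W h (W r f) s - W r f s) /\<^sub>R h" for h s
  have "loc_uniform_limit q (W r g) (at_right 0)"
    using generator_invariant[OF fg r] unfolding bicontinuous_generator_def q_def[abs_def] by blast
  then have "((\<lambda>h. q h (x + h)) \<longlongrightarrow> W r g x) (at_right 0)"
    by (rule loc_uniform_limit_tendsto) (use BUC_D(3)[OF W_BUC[OF r g]] in \<open>auto intro!: tendsto_eq_intros\<close>)
  then have "((\<lambda>h. j (q h (x + h))) \<longlongrightarrow> j (W r g x)) (at_right 0)"
    by (rule bounded_linear.tendsto[OF j])
  moreover have "((\<lambda>x. j (W r f x)) has_vector_derivative f') (at x within {x..x + 1})"
    using jD by (auto simp: x_def intro: has_vector_derivative_at_within)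
  then have "((\<lambda>h. (j (W r f (x + h)) - j (W r f x)) /\<^sub>R h) \<longlongrightarrow> f') (at_right 0)"
    by (rule right_derivativeI) auto
  ultimately have "((\<lambda>h. j (q h (x + h)) + (j (W r f (x + h)) - j (W r f x)) /\<^sub>R h) \<longlongrightarrow> j (W r g x) + f') (at_right 0)"
    by (rule tendsto_add)
  then show ?thesis
    unfolding x_def[symmetric]
  proof (rule Lim_transform_eventually)
    show "\<forall>\<^sub>F h in at_right 0. j (q h (x + h)) + (j (W r f (x + h)) - j (W r f x)) /\<^sub>R h
        = (j (W (r + h) f (\<sigma> + (r + h))) - j (W r f x)) /\<^sub>R h"
      using eventually_at_right_less[of 0]
    proof eventually_elim
      case (elim h)
      have "W (r + h) f = W h (W r f)" using W_add[of h r f] elim r f by (simp add: add.commute)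
      then show ?case
        using bounded_linear.linear[OF j]
        by (simp add: q_def x_def linear_diff linear_scale add.assoc flip: scaleR_add_right)
    qed
  qed
qed

text \<open>Each shift moves the evaluation point back by \<open>h\<close>, so the iterate at
  \<open>\<sigma> + k * h\<close> sees \<open>f\<close> only at \<open>\<sigma>\<close>. The
  multiplication acts after the shift, whence factor \<open>i\<close> samples \<open>V\<close> at
  the right end point \<open>\<sigma> + (i + 1) * h\<close>.\<close>

lemma iterated_splitting_eq_time_ordered_prod:
  "((mult_semigroup V h \<circ> shift_semigroup G h) ^^ k) f (\<sigma> + real k * h)
    = time_ordered_prod (\<lambda>i x. mult_l2 (exp_linf (h *\<^sub>R V (\<sigma> + (real i + 1) * h))) (G h x)) k (f \<sigma>)"
proof (induction k)
  case (Suc k)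
  let ?\<Phi> = "mult_semigroup V h \<circ> shift_semigroup G h"
  have step: "?\<Phi> g s = mult_l2 (exp_linf (h *\<^sub>R V s)) (G h (g (s - h)))" for g s
    by (simp add: mult_semigroup_def shift_semigroup_def)
  have "(?\<Phi> ^^ Suc k) f (\<sigma> + real (Suc k) * h)
      = mult_l2 (exp_linf (h *\<^sub>R V (\<sigma> + real (Suc k) * h))) (G h ((?\<Phi> ^^ k) f (\<sigma> + real (Suc k) * h - h)))"
    using step[of "(?\<Phi> ^^ k) f"] by simp
  moreover have "\<sigma> + real (Suc k) * h - h = \<sigma> + real k * h" "\<sigma> + real (Suc k) * h = \<sigma> + (real k + 1) * h"
    by (simp_all add: algebra_simps)
  moreover have "time_ordered_prod Q (Suc k) x = Q k (time_ordered_prod Q k x)" for Q and x :: "'a l2"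
    by simp
  ultimately show ?case by (simp only: Suc.IH)
qed simp

lemma iterated_splitting:
  assumes "n > 0"
  shows "((mult_semigroup V (t / real n) \<circ> shift_semigroup G (t / real n)) ^^ n) f s
    = splitting G V (\<lambda>i. s - t + (real i + 1) * (t / real n)) t n (f (s - t))"
  using iterated_splitting_eq_time_ordered_prod[where \<sigma> = "s - t" and h = "t / real n" and k = n] assms
  by (simp add: splitting_def)

lemma evolution_semigroup_product_limit:
  fixes V :: "real \<Rightarrow> 'a::euclidean_space linf" and G :: "real \<Rightarrow> 'a l2 \<Rightarrow> 'a l2"
    and j :: "'a l2 \<Rightarrow> 'y::banach"
  assumes V: "V \<in> BUC" and G: "heat_semigroup G" and ex: "extrapolation G j G1"
    and W: "bicontinuous_semigroup W"
    and gen: "bicontinuous_generator W = perturbed_operator (evolution_operator j G1) V"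
    and f: "f \<in> BUC" and a: "0 \<le> a"
  shows "uniform_limit {a..b}
     (\<lambda>n t. buc_norm (\<lambda>s.
        ((mult_semigroup V (t / real n) \<circ> shift_semigroup G (t / real n)) ^^ n) f s - W t f s))
     (\<lambda>_. 0) sequentially"
proof -
  interpret smoothing_semigroup G by (rule heat_semigroup_smoothing[OF G])
  interpret W: bicontinuous W by unfold_locales (rule W)
  have cs: "contraction_semigroup G" by unfold_locales
  note j = extrapolation_bounded_linear[OF ex]
  define b' where "b' = max 0 b"
  have b': "b' \<ge> 0" by (simp add: b'_def)
  have Vu: "uniformly_continuous_on UNIV V" and Vc: "continuous_on UNIV V" using BUC_D[OF V] by auto
  obtain M \<omega> where M: "M \<ge> 0" "\<And>t f. t \<ge> 0 \<Longrightarrow> f \<in> BUC \<Longrightarrow> buc_norm (W t f) \<le> M * exp (\<omega> * t) * buc_norm f"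
    using W.W_bound by blast
  \<comment> \<open>A bound for all orbits up to time \<open>b'\<close> whose initial function has
    norm at most that of \<open>f\<close>. It is shared by the regularisations of \<open>f\<close>
    and independent of the base point, which gives convergence in the sup norm.\<close>
  define C where "C = M * exp (\<bar>\<omega>\<bar> * b') * buc_norm f"
  have C: "C \<ge> 0" using M(1) buc_norm_nonneg[OF f] by (simp add: C_def)
  have W_le: "norm (W r u s) \<le> C" if u: "u \<in> BUC" "buc_norm u \<le> buc_norm f" and r: "0 \<le> r" "r \<le> b'" for u r s
  proof -
    have "\<omega> * r \<le> \<bar>\<omega>\<bar> * r" using r by (intro mult_right_mono) auto
    also have "\<dots> \<le> \<bar>\<omega>\<bar> * b'" using r by (intro mult_left_mono) auto
    finally have "M * exp (\<omega> * r) * buc_norm u \<le> C"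
      unfolding C_def using M(1) u(2) buc_norm_nonneg[OF u(1)] by (intro mult_mono mult_left_mono) auto
    then show ?thesis using M(2)[OF r(1) u(1)] norm_le_buc_norm[OF W.W_BUC[OF r(1) u(1)], of s] by linarith
  qed
  show ?thesis
  proof (rule uniform_limitI)
    fix \<epsilon> :: real assume \<epsilon>: "\<epsilon> > 0"
    define e where "e = \<epsilon> / (2 * (C + 1))"
    have e: "e > 0" using \<epsilon> C by (simp add: e_def)
    have eC: "e * C < \<epsilon>"
    proof -
      have "e * C = (\<epsilon> / 2) * (C / (C + 1))" by (simp add: e_def)
      also have "\<dots> \<le> (\<epsilon> / 2) * 1" using \<epsilon> C by (intro mult_left_mono) (auto simp: divide_le_eq)
      finally show ?thesis using \<epsilon> by simp
    qed
    obtain N where N: "N > 0" and est: "\<And>n T C \<sigma> u c. \<lbrakk>n \<ge> N; 0 \<le> T; T \<le> b'; mild_on G V \<sigma> T u;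
       \<And>r. 0 \<le> r \<Longrightarrow> r \<le> T \<Longrightarrow> norm (u r) \<le> C;
       \<And>i. \<sigma> + real i * (T / real n) \<le> c i \<and> c i \<le> \<sigma> + (real i + 1) * (T / real n)\<rbrakk> \<Longrightarrow>
       norm (u T - splitting G V c T n (u 0)) \<le> e * C"
      using uniform_product_estimate[OF smoothing_semigroup_axioms Vu norm_le_buc_norm[OF V] b' e] by blast
    have main: "norm (((mult_semigroup V (t / real n) \<circ> shift_semigroup G (t / real n)) ^^ n) f s - W t f s) \<le> e * C"
      if n: "n \<ge> N" and t: "0 \<le> t" "t \<le> b'" for n t s
    proof -
      define P where "P = splitting G V (\<lambda>i. s - t + (real i + 1) * (t / real n)) t n"
      have P: "bounded_linear P" unfolding P_def by (rule bounded_linear_splitting[OF cs t(1)])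
      have domain: "norm (W t u s - P (u (s - t))) \<le> e * C"
        if u: "u \<in> BUC" "buc_norm u \<le> buc_norm f" and ug: "(u, g) \<in> bicontinuous_generator W" for u g
      proof -
        define v where "v r = W r u (s - t + r)" for r
        have vc: "continuous_on {0..t} v"
          unfolding v_def by (rule continuous_on_subset[OF W.orbit_continuous[OF u(1)]]) auto
        have mild: "mild_on G V (s - t) t v"
          unfolding mild_on_def
        proof (intro conjI allI impI vc)
          have ex_d: "\<exists>d. (j (v r), d) \<in> generator G1 \<and>
              ((\<lambda>h. (j (v (r + h)) - j (v r)) /\<^sub>R h) \<longlongrightarrow> d + j (mult_l2 (V (s - t + r)) (v r))) (at_right 0)"
            if r: "0 \<le> r" for r
          proof -
            have "(W r u, W r g) \<in> perturbed_operator (evolution_operator j G1) V"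
              using W.generator_invariant[OF ug r] gen by simp
            then obtain g0 where g0: "(W r u, g0) \<in> evolution_operator j G1"
              "W r g = (\<lambda>s. g0 s + mult_l2 (V s) (W r u s))"
              by (auto simp: perturbed_operator_def)
            obtain f' d where f': "\<And>x. ((\<lambda>x. j (W r u x)) has_vector_derivative f' x) (at x)"
              and d: "\<And>x. (j (W r u x), d x) \<in> generator G1" and g0': "\<And>x. j (g0 x) = - f' x + d x"
              using g0(1) unfolding evolution_operator_def by blast
            \<comment> \<open>Along the characteristic the space derivative \<open>f'\<close>
              cancels the \<open>- f'\<close> of the evolution operator, leaving the Laplacian and
              the potential: the equation that \<open>duhamel\<close> asks for.\<close>
            have "j (W r g (s - t + r)) + f' (s - t + r) = d (s - t + r) + j (mult_l2 (V (s - t + r)) (v r))"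
              using g0' bounded_linear.linear[OF j] by (simp add: g0(2) linear_add v_def)
            then show ?thesis
              using W.orbit_right_derivative_embedded[OF ug r j f', of "s - t"] d[of "s - t + r"]
              unfolding v_def by (intro exI[of _ "d (s - t + r)"]) simp
          qed
          have "\<forall>r\<in>{0..}. \<exists>d. (j (v r), d) \<in> generator G1 \<and>
              ((\<lambda>h. (j (v (r + h)) - j (v r)) /\<^sub>R h) \<longlongrightarrow> d + j (mult_l2 (V (s - t + r)) (v r))) (at_right 0)"
            using ex_d by auto
          from bchoice[OF this] obtain d where d': "\<forall>r\<in>{0..}. (j (v r), d r) \<in> generator G1 \<and>
              ((\<lambda>h. (j (v (r + h)) - j (v r)) /\<^sub>R h) \<longlongrightarrow> d r + j (mult_l2 (V (s - t + r)) (v r))) (at_right 0)"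
            by blast
          have d: "(j (v r), d r) \<in> generator G1"
            "((\<lambda>h. (j (v (r + h)) - j (v r)) /\<^sub>R h) \<longlongrightarrow> d r + j (mult_l2 (V (s - t + r)) (v r))) (at_right 0)"
            if "0 \<le> r" for r
            using d' that by auto
          fix r t' assume r: "0 < r" "r < t'" "t' \<le> t"
          show "((\<lambda>r. G (t' - r) (v r)) has_vector_derivative G (t' - r) (mult_l2 (V (s - t + r)) (v r))) (at r)"
          proof (rule duhamel[OF extrapolation_contraction_semigroup[OF ex] j extrapolation_inj[OF ex]
                extrapolation_intertwine[OF ex] vc])
            show "continuous_on {0..t} (\<lambda>r. mult_l2 (V (s - t + r)) (v r))"
              by (intro bounded_bilinear.continuous_on[OF bounded_bilinear_mult_l2] vc
                  continuous_on_compose2[OF Vc] continuous_intros) auto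
          qed (use r d in auto)
        qed
        have "norm (v t - P (v 0)) \<le> e * C"
          unfolding P_def
        proof (rule est[OF n t mild])
          show "norm (v r) \<le> C" if "0 \<le> r" "r \<le> t" for r
            unfolding v_def using that t by (intro W_le u) auto
        qed (use t in \<open>auto intro!: mult_right_mono simp del: times_divide_eq_right\<close>)
        then show ?thesis using W.W_0[OF u(1)] by (simp add: v_def)
      qed
      \<comment> \<open>The estimate holds so far for initial functions in the domain. It passes to
        \<open>f\<close> at fixed \<open>n\<close>, \<open>t\<close> and \<open>s\<close> through
        regularisations that converge locally uniformly and do not increase the norm.\<close>
      define \<delta> where "\<delta> m = inverse (real (Suc m))" for m
      have \<delta>: "\<delta> m > 0" for m by (simp add: \<delta>_def)
      define u where "u m = regularization (\<delta> m) f" for m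
      have u: "u m \<in> BUC" "buc_norm (u m) \<le> buc_norm f" for m
        unfolding u_def using regularization_BUC[OF f \<delta>] regularization_bound[OF f \<delta>] by auto
      have filt: "filterlim \<delta> (at_right 0) sequentially"
        unfolding \<delta>_def using LIMSEQ_inverse_real_of_nat by (intro filterlim_at_withinI) auto
      have ulim: "loc_uniform_limit u f sequentially"
        unfolding loc_uniform_limit_def
      proof (intro allI impI uniform_limitI)
        fix K :: "real set" and e :: real assume K: "compact K" and e: "e > 0"
        have "\<forall>\<^sub>F h in at_right 0. \<forall>s\<in>K. dist (regularization h f s) (f s) < e"
          using regularization_limit[OF f] K e by (auto simp: loc_uniform_limit_def uniform_limit_iff)
        then show "\<forall>\<^sub>F m in sequentially. \<forall>s\<in>K. dist (u m s) (f s) < e"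
          unfolding u_def by (rule eventually_compose_filterlim[OF _ filt])
      qed
      have "(\<lambda>m. u m (s - t)) \<longlonglongrightarrow> f (s - t)"
        using loc_uniform_limit_tendsto[OF ulim BUC_D(3)[OF f] tendsto_const] .
      then have Plim: "(\<lambda>m. P (u m (s - t))) \<longlonglongrightarrow> P (f (s - t))" by (rule bounded_linear.tendsto[OF P])
      have Wlim: "(\<lambda>m. W t (u m) s) \<longlonglongrightarrow> W t f s"
      proof -
        have "loc_uniform_limit (\<lambda>m. W t (\<lambda>s. u m s - f s)) (\<lambda>_. 0) sequentially"
        proof (rule W.W_null_sequence[where C = "2 * buc_norm f"])
          show "(\<lambda>s. u m s - f s) \<in> BUC" for m by (intro BUC_diff u f)
          show "buc_norm (\<lambda>s. u m s - f s) \<le> 2 * buc_norm f" for m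
          proof (rule buc_norm_le)
            fix s
            show "norm (u m s - f s) \<le> 2 * buc_norm f"
              using norm_triangle_ineq4[of "u m s" "f s"] norm_le_buc_norm[OF u(1), of m s] u(2)[of m]
                norm_le_buc_norm[OF f, of s] by linarith
          qed
          show "loc_uniform_limit (\<lambda>m s. u m s - f s) (\<lambda>_. 0) sequentially"
            using ulim by (simp add: loc_uniform_limit_def uniform_limit_iff dist_norm)
        qed (rule t(1))
        then have "(\<lambda>m. W t (\<lambda>s. u m s - f s) s) \<longlonglongrightarrow> 0"
          by (rule loc_uniform_limit_tendsto[OF _ continuous_on_const tendsto_const])
        then show ?thesis using t by (simp add: W.W_diff u f LIM_zero_iff)
      qed
      have "norm (W t f s - P (f (s - t))) \<le> e * C"
      proof (rule tendsto_le[OF sequentially_bot tendsto_const])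
        show "(\<lambda>m. norm (W t (u m) s - P (u m (s - t)))) \<longlonglongrightarrow> norm (W t f s - P (f (s - t)))"
          by (intro tendsto_intros Wlim Plim)
        have "norm (W t (u m) s - P (u m (s - t))) \<le> e * C" for m
        proof -
          obtain g where "(u m, g) \<in> evolution_operator j G1"
            unfolding u_def using regularization_domain[OF f \<delta> ex] by blast
          then have "(u m, \<lambda>s. g s + mult_l2 (V s) (u m s)) \<in> bicontinuous_generator W"
            unfolding gen perturbed_operator_def by blast
          then show ?thesis by (rule domain[OF u])
        qed
        then show "\<forall>\<^sub>F m in sequentially. norm (W t (u m) s - P (u m (s - t))) \<le> e * C" by simp
      qed
      moreover have "((mult_semigroup V (t / real n) \<circ> shift_semigroup G (t / real n)) ^^ n) f s = P (f (s - t))"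
        unfolding P_def by (rule iterated_splitting) (use n N in simp)
      ultimately show ?thesis by (simp add: norm_minus_commute)
    qed
    show "\<forall>\<^sub>F n in sequentially. \<forall>t\<in>{a..b}. dist (buc_norm (\<lambda>s.
        ((mult_semigroup V (t / real n) \<circ> shift_semigroup G (t / real n)) ^^ n) f s - W t f s)) 0 < \<epsilon>"
      using eventually_ge_at_top[of N]
    proof eventually_elim
      case (elim n)
      show ?case
      proof
        fix t assume "t \<in> {a..b}"
        then have t: "0 \<le> t" "t \<le> b'" using a by (auto simp: b'_def)
        define D where "D s = ((mult_semigroup V (t / real n) \<circ> shift_semigroup G (t / real n)) ^^ n) f s - W t f s" for s
        have D: "norm (D s) \<le> e * C" for s unfolding D_def by (rule main[OF elim t])
        then have "buc_norm D \<le> e * C" by (rule buc_norm_le)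
        \<comment> \<open>\<open>buc_norm\<close> is a real supremum, informative only for bounded
          functions; the bound on \<open>D\<close> justifies comparing it with a single
          value.\<close>
        moreover have "0 \<le> buc_norm D"
        proof -
          have "norm (D 0) \<le> buc_norm D"
            unfolding buc_norm_def using D by (intro cSUP_upper bdd_aboveI2[of _ _ "e * C"]) auto
          then show ?thesis using norm_ge_zero order_trans by blast
        qed
        ultimately show "dist (buc_norm (\<lambda>s.
          ((mult_semigroup V (t / real n) \<circ> shift_semigroup G (t / real n)) ^^ n) f s - W t f s)) 0 < \<epsilon>"
          using eC by (simp add: D_def[abs_def] dist_real_def)
      qed
    qed
  qed
qed

theorem proposition5p1:
  fixes V :: "real \<Rightarrow> 'a::euclidean_space linf"
    and G :: "real \<Rightarrow> 'a l2 \<Rightarrow> 'a l2"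
  assumes V: "V \<in> BUC"
    and G: "heat_semigroup G"
  shows "(\<forall>(j :: 'a l2 \<Rightarrow> 'y::banach) G1 W.
            extrapolation G j G1 \<longrightarrow>
            bicontinuous_semigroup W \<longrightarrow>
            bicontinuous_generator W = perturbed_operator (evolution_operator j G1) V \<longrightarrow>
            (\<forall>f\<in>BUC. \<forall>a b. 0 \<le> a \<longrightarrow>
               uniform_limit {a..b}
                 (\<lambda>n t. buc_norm (\<lambda>s.
                    ((mult_semigroup V (t / real n) \<circ> shift_semigroup G (t / real n)) ^^ n) f s - W t f s))
                 (\<lambda>_. 0) sequentially)) \<and>
         (well_posed V \<longrightarrow>
            (\<forall>U. solves V U \<longrightarrow>
              (\<forall>u0 K. compact K \<and> K \<subseteq> {(t, s). s \<le> t} \<longrightarrow>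
                 uniform_limit K
                   (\<lambda>n (t, s). norm (U t s u0 -
                      time_ordered_prod
                        (\<lambda>p u. mult_l2 (exp_linf (((t - s) / real n) *\<^sub>R V (s + real p * (t - s) / real n)))
                                 (G ((t - s) / real n) u)) n u0))
                   (\<lambda>_. 0) sequentially)))"
proof (intro conjI allI impI ballI; (elim conjE)?)
  fix j :: "'a l2 \<Rightarrow> 'y" and G1 W and f :: "real \<Rightarrow> 'a l2" and a b :: real
  assume "extrapolation G j G1" "bicontinuous_semigroup W"
    "bicontinuous_generator W = perturbed_operator (evolution_operator j G1) V" "f \<in> BUC" "0 \<le> a"
  then show "uniform_limit {a..b}
     (\<lambda>n t. buc_norm (\<lambda>s.
        ((mult_semigroup V (t / real n) \<circ> shift_semigroup G (t / real n)) ^^ n) f s - W t f s))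
     (\<lambda>_. 0) sequentially"
    by (rule evolution_semigroup_product_limit[OF V G])
next
  fix U u0 and K :: "(real \<times> real) set"
  assume "solves V U" "compact K" "K \<subseteq> {(t, s). s \<le> t}"
  then show "uniform_limit K
     (\<lambda>n (t, s). norm (U t s u0 - time_ordered_prod
        (\<lambda>p u. mult_l2 (exp_linf (((t - s) / real n) *\<^sub>R V (s + real p * (t - s) / real n)))
                 (G ((t - s) / real n) u)) n u0))
     (\<lambda>_. 0) sequentially"
    by (rule evolution_family_product_limit[OF V G])
qed

end
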